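(* Let $s\in(0,1)$, $\rho>1$, let $f\in A_\rho$ be given, and for $n\ge1$ let $e_n(f)=(K_s^{-1}-K_{s,n}^{-1})(f)$ denote the error of the Gauss–Jacobi/Gegenbauer numerical method on $(-1,1)$. Then for all $\nu$ with $1<\nu<\rho$ the error estimate $$\|e_n(f)\|_{A_\nu}\le C\,n^s\left(\frac{\nu}{\rho}\right)^n\|f\|_{A_\rho}$$ holds, with a constant $C$ independent of $n$ and $f$. In particular, the operators $K_{s,n}^{-1}:A_\rho\to A_\rho$ converge in norm to the continuous operator $K_s^{-1}$ as $n\to\infty$.
   Context: Analytic functions: for $\rho>1$ the Bernstein ellipse $\mathcal{E}_\rho\subset\mathbb{C}$ is the ellipse with foci $\pm1$ whose minor and major semiaxial lengths add up to $\rho$; $\mathcal{B}_\rho$ is the closed region bounded by (and including) $\mathcal{E}_\rho$. $A_\rho$ is the normed space of functions analytic on the closed set $\mathcal{B}_\rho$ (i.e. on a neighborhood of it), with norm $\|\cdot\|_{A_\rho}=\|\cdot\|_{L^\infty(\mathcal{B}_\rho)}$. Let $C_j^{(s+1/2)}$ be the Gegenbauer polynomials ($C_0^{(\alpha)}=1$, $C_1^{(\alpha)}(x)=2\alpha x$, $C_n^{(\alpha)}(x)=\frac1n[2x(n+\alpha-1)C_{n-1}^{(\alpha)}(x)-(n+2\alpha-2)C_{n-2}^{(\alpha)}(x)]$), let $h_j^{(s+1/2)}=\big(\int_{-1}^1|C_j^{(s+1/2)}(x)|^2(1-x^2)^s\,dx\big)^{1/2}$, $\tilde C_j^{(s+1/2)}=C_j^{(s+1/2)}/h_j^{(s+1/2)}$,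 and $\lambda_j^s=\Gamma(2s+j+1)/j!$. Exact inverse: $K_s^{-1}f=\sum_{j=0}^\infty(\lambda_j^s)^{-1}f_j\tilde C_j^{(s+1/2)}$ with $f_j=\int_{-1}^1f(x)\tilde C_j^{(s+1/2)}(x)(1-x^2)^s\,dx$. This is the inverse of the weighted fractional Laplacian $K_s(\phi)=(-\Delta)^s[\omega^s\phi]$ on $(-1,1)$, $\omega^s(x)=(1-x^2)^s$ (with $\omega^s\phi$ extended by zero), whose eigenfunctions are $C_j^{(s+1/2)}$ with eigenvalues $\lambda_j^s$. Numerical method: let $(x_i)_{i=0}^n$ and $(w_i)_{i=0}^n$ be the nodes and weights of the $(n+1)$-point Gauss–Jacobi quadrature rule on $(-1,1)$ for the weight $(1-x^2)^s$ (exact for polynomials of degree at most $2n+1$). Set $$f_j^{(n)}=\frac1{h_j^{(s+1/2)}}\sum_{i=0}^nf(x_i)C_j^{(s+1/2)}(x_i)w_i,\qquad K_{s,n}^{-1}f=\sum_{j=0}^n\frac{f_j^{(n)}}{\lambda_j^sh_j^{(s+1/2)}}C_j^{(s+1/2)}.$$ *)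

theory Defs
  imports "HOL-Analysis.Analysis" "HOL-Complex_Analysis.Complex_Analysis"
    "HOL-Computational_Algebra.Polynomial"
begin

text \<open>The ellipse with foci \<open>\<plusminus>1\<close> and semiaxes \<open>a > b > 0\<close> with \<open>a + b = \<rho>\<close> satisfies
  \<open>a\<^sup>2 - b\<^sup>2 = 1\<close>, so \<open>a - b = 1 / \<rho>\<close> and the sum of the focal distances on it is
  \<open>2 a = \<rho> + 1 / \<rho>\<close>.\<close>

definition bernstein_region :: "real \<Rightarrow> complex set" where
  "bernstein_region \<rho> = {z. cmod (z - 1) + cmod (z + 1) \<le> \<rho> + 1 / \<rho>}"

text \<open>Elements of \<open>A_space \<rho>\<close> are total functions that are analytic on a neighbourhood of
  \<open>bernstein_region \<rho>\<close>; their values elsewhere are irrelevant.\<close>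

definition A_space :: "real \<Rightarrow> (complex \<Rightarrow> complex) set" where
  "A_space \<rho> = {f. f analytic_on bernstein_region \<rho>}"

definition A_norm :: "real \<Rightarrow> (complex \<Rightarrow> complex) \<Rightarrow> real" where
  "A_norm \<rho> f = (SUP z\<in>bernstein_region \<rho>. cmod (f z))"

text \<open>Bounded linear operators on \<open>A_space \<rho>\<close> and their norm. The norm takes values in
  \<^typ>\<open>ennreal\<close>, so that an unbounded operator has norm \<open>\<infinity>\<close>. Linearity is required on
  \<open>bernstein_region \<rho>\<close> only, since elements of the space are identified when they agree there.\<close>

definition A_operator :: "real \<Rightarrow> ((complex \<Rightarrow> complex) \<Rightarrow> complex \<Rightarrow> complex) \<Rightarrow> bool" where
  "A_operator \<rho> T \<longleftrightarrow>
     (\<forall>f\<in>A_space \<rho>. T f \<in> A_space \<rho>) \<and>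
     (\<forall>f\<in>A_space \<rho>. \<forall>g\<in>A_space \<rho>. \<forall>a b. \<forall>z\<in>bernstein_region \<rho>.
        T (\<lambda>u. a * f u + b * g u) z = a * T f z + b * T g z) \<and>
     (\<exists>M. \<forall>f\<in>A_space \<rho>. A_norm \<rho> (T f) \<le> M * A_norm \<rho> f)"

definition A_opnorm :: "real \<Rightarrow> ((complex \<Rightarrow> complex) \<Rightarrow> complex \<Rightarrow> complex) \<Rightarrow> ennreal" where
  "A_opnorm \<rho> T = (SUP f\<in>{f \<in> A_space \<rho>. A_norm \<rho> f \<le> 1}. ennreal (A_norm \<rho> (T f)))"

text \<open>Polymorphic in the argument, since the polynomials are used both on \<open>[-1, 1]\<close> and in the
  complex plane.\<close>

fun gegenbauer :: "real \<Rightarrow> nat \<Rightarrow> 'a :: real_normed_field \<Rightarrow> 'a" where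
  "gegenbauer \<alpha> 0 x = 1"
| "gegenbauer \<alpha> (Suc 0) x = 2 * of_real \<alpha> * x"
| "gegenbauer \<alpha> (Suc (Suc m)) x =
     (let n = real (Suc (Suc m)) in
      (2 * x * of_real (n + \<alpha> - 1) * gegenbauer \<alpha> (Suc m) x
        - of_real (n + 2 * \<alpha> - 2) * gegenbauer \<alpha> m x) / of_real n)"

definition geg_h :: "real \<Rightarrow> nat \<Rightarrow> real" where
  "geg_h s j = sqrt (integral {-1..1} (\<lambda>x. \<bar>gegenbauer (s + 1/2) j x\<bar>\<^sup>2 * (1 - x\<^sup>2) powr s))"

definition geg_normalized :: "real \<Rightarrow> nat \<Rightarrow> 'a :: real_normed_field \<Rightarrow> 'a" where
  "geg_normalized s j x = gegenbauer (s + 1/2) j x / of_real (geg_h s j)"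

definition geg_eigenvalue :: "real \<Rightarrow> nat \<Rightarrow> real" where
  "geg_eigenvalue s j = Gamma (2 * s + real j + 1) / fact j"

definition geg_coeff :: "real \<Rightarrow> (complex \<Rightarrow> complex) \<Rightarrow> nat \<Rightarrow> complex" where
  "geg_coeff s f j =
     integral {-1..1} (\<lambda>x::real. f (of_real x) * of_real (geg_normalized s j x * (1 - x\<^sup>2) powr s))"

definition Ks_inv_term :: "real \<Rightarrow> (complex \<Rightarrow> complex) \<Rightarrow> complex \<Rightarrow> nat \<Rightarrow> complex" where
  "Ks_inv_term s f z j =
     inverse (of_real (geg_eigenvalue s j)) * geg_coeff s f j * geg_normalized s j z"

definition Ks_inv :: "real \<Rightarrow> (complex \<Rightarrow> complex) \<Rightarrow> complex \<Rightarrow> complex" where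
  "Ks_inv s f z = (\<Sum>j. Ks_inv_term s f z j)"

text \<open>An \<open>(n + 1)\<close>-point quadrature rule of degree of exactness \<open>2 n + 1\<close> is unique up to the
  order of its nodes; this is the Gauss--Jacobi rule for the weight \<open>(1 - t\<^sup>2)\<^sup>s\<close>.\<close>

definition gauss_jacobi_rule :: "real \<Rightarrow> nat \<Rightarrow> (nat \<Rightarrow> real) \<Rightarrow> (nat \<Rightarrow> real) \<Rightarrow> bool" where
  "gauss_jacobi_rule s n x w \<longleftrightarrow>
     inj_on x {..n} \<and> (\<forall>i\<le>n. -1 < x i \<and> x i < 1) \<and>
     (\<forall>p :: real poly. degree p \<le> 2 * n + 1 \<longrightarrow>
        ((\<lambda>t. poly p t * (1 - t\<^sup>2) powr s) has_integral (\<Sum>i\<le>n. poly p (x i) * w i)) {-1..1})"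

definition geg_coeff_num ::
  "real \<Rightarrow> nat \<Rightarrow> (nat \<Rightarrow> real) \<Rightarrow> (nat \<Rightarrow> real) \<Rightarrow> (complex \<Rightarrow> complex) \<Rightarrow> nat \<Rightarrow> complex" where
  "geg_coeff_num s n x w f j =
     1 / of_real (geg_h s j) *
     (\<Sum>i\<le>n. f (of_real (x i)) * of_real (gegenbauer (s + 1/2) j (x i)) * of_real (w i))"

definition Ks_inv_num ::
  "real \<Rightarrow> nat \<Rightarrow> (nat \<Rightarrow> real) \<Rightarrow> (nat \<Rightarrow> real) \<Rightarrow> (complex \<Rightarrow> complex) \<Rightarrow> complex \<Rightarrow> complex" where
  "Ks_inv_num s n x w f z =
     (\<Sum>j\<le>n. geg_coeff_num s n x w f j / of_real (geg_eigenvalue s j * geg_h s j)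
              * gegenbauer (s + 1/2) j z)"

definition Ks_error ::
  "real \<Rightarrow> nat \<Rightarrow> (nat \<Rightarrow> real) \<Rightarrow> (nat \<Rightarrow> real) \<Rightarrow> (complex \<Rightarrow> complex) \<Rightarrow> complex \<Rightarrow> complex" where
  "Ks_error s n x w f z = Ks_inv s f z - Ks_inv_num s n x w f z"

end

theory Submission
  imports Defs
begin

text \<open>Write \<open>p\<^sub>j\<close> for the orthonormal Gegenbauer polynomials, \<open>\<lambda>\<^sub>j\<close> for the eigenvalues, and
  \<open>q\<^sub>j(\<zeta>) = \<integral> p\<^sub>j(x) (1 - x\<^sup>2)\<^sup>s / (\<zeta> - x) dx\<close> for the functions of the second kind. Cauchy's formula over the
  Bernstein ellipse turns the coefficients of \<open>f\<close> into boundary integrals of \<open>f\<close> against \<open>q\<^sub>j\<close>, and the errors of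
  the numerical coefficients into boundary integrals against the quadrature errors for \<open>p\<^sub>j(x) / (\<zeta> - x)\<close>. On
  \<open>[-1, 1]\<close> the kernel \<open>1 / (\<zeta> - x)\<close> is a polynomial of degree less than \<open>m\<close> up to an error \<open>O(\<rho>\<^sup>-\<^sup>m)\<close>
  (\<open>cauchy_kernel_approx\<close>). By orthogonality and by the exactness of the Gauss rule, therefore, \<open>q\<^sub>j = O(\<rho>\<^sup>-\<^sup>j)\<close> on
  the ellipse, and the error of the coefficient of index \<open>j \<le> n\<close> is \<open>O(\<rho>\<^sup>-\<^sup>(\<^sup>2\<^sup>n\<^sup>+\<^sup>2\<^sup>-\<^sup>j\<^sup>))\<close> times the norm of \<open>f\<close>
  (\<open>geg_second_bound\<close>, \<open>quadrature_coeff_error\<close>).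

  The other ingredient is \<open>p\<^sub>j = O(\<nu>\<^sup>j)\<close> on the region of parameter \<open>\<nu>\<close> (\<open>geg_normalized_growth\<close>). After rescaling by
  their leading coefficients the polynomials satisfy the Chebyshev recurrence up to a perturbation of size \<open>1 / j\<^sup>2\<close>,
  and such a perturbation costs only a constant factor. For \<open>\<nu> < \<rho>\<close> the truncated terms are then
  \<open>O((\<nu> / \<rho>)\<^sup>j)\<close>, and truncation and aliasing errors are both \<open>O((\<nu> / \<rho>)\<^sup>n)\<close>; since \<open>n\<^sup>s \<ge> 1\<close>, this is more than
  the claimed estimate.

  Convergence in the norm of operators on the space of parameter \<open>\<rho>\<close> itself does not follow by letting \<open>\<nu>\<close> tend
  to \<open>\<rho>\<close>: the terms of the tail are only \<open>O(1 / \<lambda>\<^sub>j)\<close>, and these bounds are not summable for \<open>s \<le> 1/2\<close>. Cancellation is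
  needed. The tail is an integral operator on the ellipse with kernel \<open>\<Sum>\<^sub>j\<^sub>>\<^sub>n \<lambda>\<^sub>j\<^sup>-\<^sup>1 p\<^sub>j(z) q\<^sub>j(\<zeta>)\<close>. By the
  Christoffel--Darboux formula, the partial sums of \<open>p\<^sub>j(z) q\<^sub>j(\<zeta>)\<close> are \<open>O(1 / |\<zeta> - z|)\<close>; they are also bounded by a
  multiple of the number of terms. Interpolation between the two bounds gives a kernel with the integrable singularity
  \<open>|\<zeta> - z|\<^sup>s\<^sup>/\<^sup>2\<^sup>-\<^sup>1\<close> at the cost of a factor \<open>n\<^sup>s\<^sup>/\<^sup>2\<close>, and summation by parts against \<open>\<lambda>\<^sub>j\<^sup>-\<^sup>1 = O(j\<^sup>-\<^sup>s)\<close> leaves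
  \<open>O(n\<^sup>-\<^sup>s\<^sup>/\<^sup>2)\<close> for the norm of the tail (\<open>Ks_inv_tail_bound\<close>). The same estimate shows that the exact inverse is bounded.
  The aliasing error is \<open>O(n\<^sup>-\<^sup>s)\<close> by the sharp bounds above (\<open>aliasing_bound\<close>).\<close>

section \<open>Bernstein regions and the Joukowski map\<close>

text \<open>The Joukowski map. It sends the circle \<open>|u| = \<rho>\<close> onto the Bernstein ellipse and the unit
  circle onto \<open>[-1, 1]\<close>; every point of the plane has a preimage with \<open>|u| \<ge> 1\<close>.\<close>

definition joukowski :: "complex \<Rightarrow> complex" where
  "joukowski u = (u + 1 / u) / 2"

lemma joukowski_diff:
  assumes "u \<noteq> 0" "v \<noteq> 0"
  shows "joukowski v - joukowski u = (v - u) * (1 - 1 / (u * v)) / 2"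
  using assms by (simp add: joukowski_def field_simps)

lemma focal_sum_joukowski:
  assumes "u \<noteq> 0"
  shows "cmod (joukowski u - 1) + cmod (joukowski u + 1) = cmod u + 1 / cmod u"
proof -
  have a: "joukowski u - 1 = (u - 1)^2 / (2 * u)" "joukowski u + 1 = (u + 1)^2 / (2 * u)"
    using assms by (simp_all add: joukowski_def field_simps power2_eq_square)
  have b: "(cmod (u - 1))^2 + (cmod (u + 1))^2 = 2 * (cmod u)^2 + 2"
    unfolding cmod_power2 by (simp add: power2_eq_square algebra_simps)
  have "cmod (joukowski u - 1) + cmod (joukowski u + 1)
      = ((cmod (u - 1))^2 + (cmod (u + 1))^2) / (2 * cmod u)"
    unfolding a by (simp add: norm_divide norm_mult norm_power add_divide_distrib)
  also have "\<dots> = cmod u + 1 / cmod u"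
    unfolding b using assms by (simp add: field_simps power2_eq_square)
  finally show ?thesis .
qed

lemma joukowski_surj:
  obtains u where "1 \<le> cmod u" "z = joukowski u"
proof -
  define d where "d = csqrt (z^2 - 1)"
  have d2: "d^2 = z^2 - 1" by (simp add: d_def)
  have prod: "(z + d) * (z - d) = 1"
    using d2 by (simp add: algebra_simps power2_eq_square)
  have nz: "z + d \<noteq> 0" "z - d \<noteq> 0" using prod by auto
  have inv: "1 / (z + d) = z - d" "1 / (z - d) = z + d"
    using prod nz by (simp_all add: field_simps)
  have *: "z = joukowski (z + d)" "z = joukowski (z - d)"
    by (simp_all add: joukowski_def inv)
  have "cmod (z + d) * cmod (z - d) = 1"
    using prod by (metis norm_mult norm_one)
  moreover have "cmod (z + d) * cmod (z - d) < 1 * 1" if "cmod (z + d) < 1" "cmod (z - d) < 1"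
    using that by (intro mult_strict_mono') auto
  ultimately have "1 \<le> cmod (z + d) \<or> 1 \<le> cmod (z - d)" by force
  then show thesis using * that by blast
qed

lemma add_inverse_le_iff:
  fixes r q :: real
  assumes "1 \<le> r" "1 \<le> q"
  shows "r + 1 / r \<le> q + 1 / q \<longleftrightarrow> r \<le> q"
proof -
  have "q + 1 / q - (r + 1 / r) = (q - r) * (1 - 1 / (q * r))"
    using assms by (simp add: field_simps)
  moreover have "r \<le> q" if "(q - r) * (1 - 1 / (q * r)) \<ge> 0"
  proof (rule ccontr)
    assume "\<not> r \<le> q"
    then have "q - r < 0" "1 * 1 < q * r" using assms
      by (simp, intro mult_le_less_imp_less) auto
    then have "(q - r) * (1 - 1 / (q * r)) < 0" by (intro mult_neg_pos) auto
    with that show False by simp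
  qed
  moreover have "(q - r) * (1 - 1 / (q * r)) \<ge> 0" if "r \<le> q"
  proof -
    have "1 * 1 \<le> q * r" using assms by (intro mult_mono) auto
    then show ?thesis using that by (intro mult_nonneg_nonneg) (auto simp: divide_le_eq_1)
  qed
  ultimately show ?thesis by linarith
qed

lemma joukowski_in_bernstein_region_iff:
  assumes "1 \<le> cmod u" "1 \<le> \<rho>"
  shows "joukowski u \<in> bernstein_region \<rho> \<longleftrightarrow> cmod u \<le> \<rho>"
proof -
  have "u \<noteq> 0" using assms by auto
  then show ?thesis
    using focal_sum_joukowski[of u] add_inverse_le_iff[OF assms] by (simp add: bernstein_region_def)
qed

lemma bernstein_regionE:
  assumes "z \<in> bernstein_region \<rho>" "1 \<le> \<rho>"
  obtains u where "1 \<le> cmod u" "cmod u \<le> \<rho>" "z = joukowski u"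
  using joukowski_surj[of z] joukowski_in_bernstein_region_iff assms by metis

lemma interval_joukowskiE:
  fixes x :: real
  assumes "-1 \<le> x" "x \<le> 1"
  obtains u where "cmod u = 1" "of_real x = joukowski u"
proof -
  have "cmod (of_real x - 1) + cmod (of_real x + 1) = \<bar>x - 1\<bar> + \<bar>x + 1\<bar>"
    by (metis of_real_1 of_real_add of_real_diff norm_of_real)
  then have "of_real x \<in> bernstein_region 1"
    using assms by (simp add: bernstein_region_def)
  then show thesis by (rule bernstein_regionE) (use that in force)+
qed

lemma interval_subset_bernstein_region:
  assumes "1 \<le> \<rho>" "-1 \<le> x" "x \<le> 1"
  shows "complex_of_real x \<in> bernstein_region \<rho>"
  using interval_joukowskiE[OF assms(2,3)] joukowski_in_bernstein_region_iff assms(1)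
  by (metis order_refl)

lemma bernstein_region_mono:
  assumes "1 \<le> \<nu>" "\<nu> \<le> \<rho>"
  shows "bernstein_region \<nu> \<subseteq> bernstein_region \<rho>"
proof -
  have "\<nu> + 1 / \<nu> \<le> \<rho> + 1 / \<rho>" using add_inverse_le_iff assms by auto
  then show ?thesis by (auto simp: bernstein_region_def)
qed

lemma closed_bernstein_region: "closed (bernstein_region \<rho>)"
  unfolding bernstein_region_def by (intro closed_Collect_le continuous_intros)

lemma bounded_bernstein_region: "bounded (bernstein_region \<rho>)"
proof (rule boundedI)
  fix z assume "z \<in> bernstein_region \<rho>"
  then have "cmod (z - 1) + cmod (z + 1) \<le> \<rho> + 1 / \<rho>" by (simp add: bernstein_region_def)
  moreover have "cmod ((z - 1) + (z + 1)) \<le> cmod (z - 1) + cmod (z + 1)" by (rule norm_triangle_ineq)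
  moreover have "(z - 1) + (z + 1) = 2 * z" by simp
  ultimately have "2 * cmod z \<le> \<rho> + 1 / \<rho>" by (simp add: norm_mult)
  then show "cmod z \<le> \<rho> + 1 / \<rho>" using norm_ge_zero[of z] by linarith
qed

lemma compact_bernstein_region: "compact (bernstein_region \<rho>)"
  using closed_bernstein_region bounded_bernstein_region compact_eq_bounded_closed by blast

lemma convex_bernstein_region: "convex (bernstein_region \<rho>)"
proof (rule convexI)
  fix x y :: complex and u v :: real
  assume xy: "x \<in> bernstein_region \<rho>" "y \<in> bernstein_region \<rho>"
    and uv: "0 \<le> u" "0 \<le> v" "u + v = 1"
  have *: "cmod (u *\<^sub>R x + v *\<^sub>R y - c) \<le> u * cmod (x - c) + v * cmod (y - c)" for c
  proof -
    have "u *\<^sub>R x + v *\<^sub>R y - c = u *\<^sub>R (x - c) + v *\<^sub>R (y - c)"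
      using uv(3) by (simp add: algebra_simps flip: scaleR_add_left)
    then show ?thesis
      by (metis abs_of_nonneg norm_scaleR norm_triangle_ineq uv(1,2))
  qed
  have "cmod (u *\<^sub>R x + v *\<^sub>R y - 1) + cmod (u *\<^sub>R x + v *\<^sub>R y + 1)
      \<le> u * (cmod (x - 1) + cmod (x + 1)) + v * (cmod (y - 1) + cmod (y + 1))"
    using *[of 1] *[of "-1"] by (simp add: algebra_simps)
  also have "\<dots> \<le> \<rho> + 1 / \<rho>"
    using xy uv by (intro convex_bound_le) (auto simp: bernstein_region_def)
  finally show "u *\<^sub>R x + v *\<^sub>R y \<in> bernstein_region \<rho>"
    by (simp add: bernstein_region_def)
qed

lemma bernstein_region_nonempty: "1 \<le> \<rho> \<Longrightarrow> bernstein_region \<rho> \<noteq> {}"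
  using interval_subset_bernstein_region[of \<rho> 0] by auto

text \<open>Analyticity on the compact region leaves room for a larger ellipse. This is what makes the series
  of the exact inverse converge geometrically up to and beyond the boundary ellipse.\<close>

lemma A_space_extends:
  assumes f: "f \<in> A_space \<rho>" and \<rho>: "1 < \<rho>"
  obtains \<rho>' where "\<rho> < \<rho>'" "f \<in> A_space \<rho>'"
proof -
  obtain U where U: "open U" "bernstein_region \<rho> \<subseteq> U" "f holomorphic_on U"
    using f unfolding A_space_def analytic_on_holomorphic by auto
  define \<phi> where "\<phi> z = cmod (z - 1) + cmod (z + 1)" for z
  have cont: "continuous_on X \<phi>" for X unfolding \<phi>_def by (intro continuous_intros)
  define K where "K = bernstein_region (\<rho> + 1) - U"
  have cK: "compact K" unfolding K_def using compact_bernstein_region U(1) by (rule compact_diff)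
  obtain \<rho>' where "\<rho> < \<rho>'" "bernstein_region \<rho>' \<subseteq> U"
  proof (cases "K = {}")
    case True
    then show thesis using that[of "\<rho> + 1"] by (auto simp: K_def)
  next
    case False
    obtain z0 where z0: "z0 \<in> K" "\<And>z. z \<in> K \<Longrightarrow> \<phi> z0 \<le> \<phi> z"
      using continuous_attains_inf[OF cK False cont] by auto
    obtain u where u: "1 \<le> cmod u" "z0 = joukowski u" by (rule joukowski_surj)
    have "z0 \<notin> bernstein_region \<rho>" "z0 \<in> bernstein_region (\<rho> + 1)"
      using z0(1) U(2) by (auto simp: K_def)
    then have r: "\<rho> < cmod u" "cmod u \<le> \<rho> + 1"
      using joukowski_in_bernstein_region_iff u \<rho> by force+
    define \<rho>' where "\<rho>' = (\<rho> + cmod u) / 2"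
    have r': "\<rho> < \<rho>'" "\<rho>' < cmod u" "\<rho>' \<le> \<rho> + 1" using r by (auto simp: \<rho>'_def)
    have "z \<in> U" if z: "z \<in> bernstein_region \<rho>'" for z
    proof (rule ccontr)
      assume "z \<notin> U"
      moreover have "z \<in> bernstein_region (\<rho> + 1)"
        using z bernstein_region_mono[of \<rho>' "\<rho> + 1"] r' \<rho> by auto
      ultimately have "\<phi> z0 \<le> \<phi> z" by (intro z0(2)) (simp add: K_def)
      then have "z0 \<in> bernstein_region \<rho>'" using z by (simp add: \<phi>_def bernstein_region_def)
      then show False using joukowski_in_bernstein_region_iff[of u \<rho>'] u r' \<rho> by auto
    qed
    then show thesis using that r' by blast
  qed
  moreover from this have "f \<in> A_space \<rho>'"
    using U unfolding A_space_def analytic_on_holomorphic by auto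
  ultimately show thesis using that by blast
qed

lemma norm_le_A_norm:
  assumes "f \<in> A_space \<rho>" "z \<in> bernstein_region \<rho>"
  shows "cmod (f z) \<le> A_norm \<rho> f"
proof -
  have "continuous_on (bernstein_region \<rho>) f"
    using assms(1) analytic_imp_holomorphic holomorphic_on_imp_continuous_on
    by (auto simp: A_space_def)
  then have "compact (f ` bernstein_region \<rho>)"
    using compact_bernstein_region compact_continuous_image by blast
  then have "bdd_above (cmod ` f ` bernstein_region \<rho>)"
    by (simp add: compact_imp_bounded bdd_above_norm)
  then show ?thesis unfolding A_norm_def image_image using assms(2) by (intro cSUP_upper)
qed

lemma A_norm_nonneg:
  assumes "f \<in> A_space \<rho>" "1 \<le> \<rho>"
  shows "0 \<le> A_norm \<rho> f"
  using norm_le_A_norm[OF assms(1) interval_subset_bernstein_region[OF assms(2), of 0]]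
  by (meson norm_ge_zero order_trans zero_le_one neg_le_0_iff_le)

lemma A_norm_le:
  assumes "1 \<le> \<rho>" "\<And>z. z \<in> bernstein_region \<rho> \<Longrightarrow> cmod (f z) \<le> B"
  shows "A_norm \<rho> f \<le> B"
  unfolding A_norm_def using bernstein_region_nonempty assms by (intro cSUP_least) auto

section \<open>Gegenbauer polynomials: recurrences, orthogonality and norms\<close>

text \<open>The Gegenbauer polynomials as formal polynomials, so that degrees and derivatives are available.
  The recurrence is stated with index \<open>m\<close> in place of \<open>n = m + 2\<close>.\<close>

fun gegenbauer_poly :: "real \<Rightarrow> nat \<Rightarrow> 'a :: real_normed_field poly" where
  "gegenbauer_poly \<alpha> 0 = 1"
| "gegenbauer_poly \<alpha> (Suc 0) = [:0, 2 * of_real \<alpha>:]"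
| "gegenbauer_poly \<alpha> (Suc (Suc m)) =
     smult (of_real (2 * (real m + 1 + \<alpha>) / (real m + 2))) ([:0, 1:] * gegenbauer_poly \<alpha> (Suc m))
     - smult (of_real ((real m + 2 * \<alpha>) / (real m + 2))) (gegenbauer_poly \<alpha> m)"

lemma gegenbauer_Suc_Suc:
  "gegenbauer \<alpha> (Suc (Suc m)) x =
     of_real (2 * (real m + 1 + \<alpha>) / (real m + 2)) * (x * gegenbauer \<alpha> (Suc m) x)
     - of_real ((real m + 2 * \<alpha>) / (real m + 2)) * gegenbauer \<alpha> m x"
proof -
  have *: "real (Suc (Suc m)) + \<alpha> - 1 = real m + 1 + \<alpha>"
    "real (Suc (Suc m)) + 2 * \<alpha> - 2 = real m + 2 * \<alpha>"
    "real (Suc (Suc m)) = real m + 2" by simp_all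
  show ?thesis unfolding gegenbauer.simps(3) Let_def * of_real_divide of_real_mult
    by (simp add: diff_divide_distrib mult_ac del: of_real_add)
qed

lemma poly_gegenbauer_poly [simp]: "poly (gegenbauer_poly \<alpha> n) x = gegenbauer \<alpha> n x"
  by (induction \<alpha> n rule: gegenbauer_poly.induct)
    (simp_all add: gegenbauer_Suc_Suc del: gegenbauer.simps(3))

lemma degree_gegenbauer_poly: "degree (gegenbauer_poly \<alpha> n :: 'a :: real_normed_field poly) \<le> n"
proof (induction \<alpha> n rule: gegenbauer_poly.induct)
  case (3 \<alpha> m)
  have "degree ([:0, 1:] * gegenbauer_poly \<alpha> (Suc m) :: 'a poly) \<le> Suc (Suc m)"
    using 3(1) degree_pCons_le[of 0 "gegenbauer_poly \<alpha> (Suc m) :: 'a poly"] by simp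
  then show ?case using 3
    by (auto intro!: degree_diff_le order_trans[OF degree_smult_le] simp del: mult_pCons_left)
qed simp_all

lemma gegenbauer_of_real: "gegenbauer \<alpha> n (of_real x) = of_real (gegenbauer \<alpha> n x)"
  by (induction \<alpha> n x rule: gegenbauer.induct) (simp_all add: Let_def)

text \<open>The recurrence solved for \<open>x C\<^sub>m\<^sub>+\<^sub>1\<close>: multiplication by \<open>x\<close> shifts the index by one.\<close>

lemma gegenbauer_times_x:
  assumes "0 < \<alpha>"
  shows "x * gegenbauer \<alpha> (Suc m) x
     = of_real ((real m + 2) / (2 * (real m + 1 + \<alpha>))) * gegenbauer \<alpha> (Suc (Suc m)) x
     + of_real ((real m + 2 * \<alpha>) / (2 * (real m + 1 + \<alpha>))) * gegenbauer \<alpha> m x"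
proof -
  have a: "(of_real (2 * (real m + 1 + \<alpha>)) :: 'a) \<noteq> 0"
    using assms by (subst of_real_eq_0_iff) auto
  have b: "(of_real (real m + 2) :: 'a) \<noteq> 0"
    by (subst of_real_eq_0_iff) auto
  show ?thesis using a b unfolding gegenbauer_Suc_Suc of_real_divide
    by (simp add: field_simps del: of_real_add of_real_mult gegenbauer.simps)
qed

lemma X_times_gegenbauer_poly:
  assumes "0 < \<alpha>"
  shows "[:0, 1:] * gegenbauer_poly \<alpha> (Suc m) =
     smult ((real m + 2) / (2 * (real m + 1 + \<alpha>))) (gegenbauer_poly \<alpha> (Suc (Suc m)))
     + smult ((real m + 2 * \<alpha>) / (2 * (real m + 1 + \<alpha>))) (gegenbauer_poly \<alpha> m)"
proof (rule poly_eq_poly_eq_iff[THEN iffD1, OF ext])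
  fix x :: real
  show "poly ([:0, 1:] * gegenbauer_poly \<alpha> (Suc m)) x
      = poly (smult ((real m + 2) / (2 * (real m + 1 + \<alpha>))) (gegenbauer_poly \<alpha> (Suc (Suc m)))
     + smult ((real m + 2 * \<alpha>) / (2 * (real m + 1 + \<alpha>))) (gegenbauer_poly \<alpha> m)) x"
    using gegenbauer_times_x[OF assms, of x m] by (simp del: gegenbauer_poly.simps gegenbauer.simps)
qed

text \<open>The structure relation \<open>(1 - x\<^sup>2) C\<^sub>n' = (n + 2 \<alpha>) x C\<^sub>n - (n + 1) C\<^sub>n\<^sub>+\<^sub>1\<close>. It turns an integration by
  parts against the weight into an identity between the integrals of the \<open>C\<^sub>n\<close> themselves.\<close>

lemma gegenbauer_deriv:
  fixes x :: real
  assumes "0 < \<alpha>"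
  shows "(1 - x^2) * poly (pderiv (gegenbauer_poly \<alpha> n)) x
     = (real n + 2 * \<alpha>) * x * gegenbauer \<alpha> n x - (real n + 1) * gegenbauer \<alpha> (Suc n) x"
proof (induction n rule: induct_nat_012)
  case 0
  show ?case by simp
next
  case 1
  show ?case by (simp add: Let_def pderiv_pCons field_simps power2_eq_square)
next
  case (ge2 m)
  let ?C = "\<lambda>k. gegenbauer \<alpha> k x" and ?D = "\<lambda>k. poly (pderiv (gegenbauer_poly \<alpha> k)) x"
  have C2: "(real m + 2) * ?C (Suc (Suc m)) = 2 * (real m + 1 + \<alpha>) * (x * ?C (Suc m)) - (real m + 2 * \<alpha>) * ?C m"
    by (simp add: Let_def field_simps)
  have C3: "(real m + 3) * ?C (Suc (Suc (Suc m)))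
      = 2 * (real m + 2 + \<alpha>) * (x * ?C (Suc (Suc m))) - (real m + 1 + 2 * \<alpha>) * ?C (Suc m)"
    by (subst gegenbauer.simps(3)) (simp add: Let_def field_simps del: gegenbauer.simps)
  have "?D (Suc (Suc m)) = (2 * (real m + 1 + \<alpha>) / (real m + 2)) * (?C (Suc m) + x * ?D (Suc m))
      - ((real m + 2 * \<alpha>) / (real m + 2)) * ?D m"
    by (simp only: gegenbauer_poly.simps pderiv_diff pderiv_smult pderiv_mult poly_diff poly_smult poly_add
        poly_mult
        poly_gegenbauer_poly of_real_eq_id id_apply) (simp add: pderiv_pCons)
  moreover have "(real m + 2) * ((A / (real m + 2)) * U - (B / (real m + 2)) * V) = A * U - B * V" for A B U V
    by (simp add: right_diff_distrib)
  ultimately have D2: "(real m + 2) * ?D (Suc (Suc m))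
      = 2 * (real m + 1 + \<alpha>) * (?C (Suc m) + x * ?D (Suc m)) - (real m + 2 * \<alpha>) * ?D m"
    by (simp only:)
  have "(real m + 2) * ((1 - x^2) * ?D (Suc (Suc m)))
      = (real m + 2) * ((real m + 2 + 2 * \<alpha>) * x * ?C (Suc (Suc m)) - (real m + 3) * ?C (Suc (Suc (Suc m))))"
    using C2 C3 D2 ge2 unfolding of_nat_Suc by algebra
  then have "(1 - x^2) * ?D (Suc (Suc m))
      = (real m + 2 + 2 * \<alpha>) * x * ?C (Suc (Suc m)) - (real m + 3) * ?C (Suc (Suc (Suc m)))"
    by (subst (asm) mult_left_cancel) auto
  moreover have "real m + 2 = real (Suc (Suc m))" "real m + 3 = real (Suc (Suc m)) + 1" by simp_all
  ultimately show ?case by (simp only:)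
qed

text \<open>The real polynomials that are orthogonal for the weight \<open>(1 - x\<^sup>2)\<^sup>s\<close>.\<close>

abbreviation geg_poly :: "real \<Rightarrow> nat \<Rightarrow> real poly" where
  "geg_poly s \<equiv> gegenbauer_poly (s + 1/2)"

lemma continuous_on_weight: "0 < s \<Longrightarrow> continuous_on {-1..1::real} (\<lambda>x. (1 - x^2) powr s)"
  by (intro continuous_on_powr' continuous_intros) (auto simp: abs_square_le_1 abs_le_iff)

text \<open>The moment functional \<open>p \<mapsto> \<integral> p(x) (1 - x\<^sup>2)\<^sup>s dx\<close> over \<open>[-1, 1]\<close>, on real polynomials.\<close>

definition weighted_integral :: "real \<Rightarrow> real poly \<Rightarrow> real" where
  "weighted_integral s p = integral {-1..1} (\<lambda>x. poly p x * (1 - x^2) powr s)"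

context
  fixes s :: real
  assumes s: "0 < s"
begin

lemma continuous_on_poly_weight: "continuous_on {-1..1::real} (\<lambda>x. poly p x * (1 - x^2) powr s)"
  by (intro continuous_intros continuous_on_weight s)

lemma has_integral_weighted_integral:
  "((\<lambda>x. poly p x * (1 - x^2) powr s) has_integral weighted_integral s p) {-1..1}"
  unfolding weighted_integral_def
  by (intro integrable_integral integrable_continuous_interval continuous_on_poly_weight)

lemma weighted_integral_add: "weighted_integral s (p + q) = weighted_integral s p + weighted_integral s q"
  using has_integral_add[OF has_integral_weighted_integral[of p] has_integral_weighted_integral[of q]]
  unfolding weighted_integral_def by (simp add: algebra_simps integral_unique)

lemma weighted_integral_smult: "weighted_integral s (smult c p) = c * weighted_integral s p"
  unfolding weighted_integral_def by (simp add: mult.assoc)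

lemma weighted_integral_diff: "weighted_integral s (p - q) = weighted_integral s p - weighted_integral s q"
  using weighted_integral_add[of "p - q" q] by simp

lemma weighted_integral_pos:
  assumes "\<And>x. 0 \<le> poly p x" "p \<noteq> 0"
  shows "0 < weighted_integral s p"
proof -
  have nn: "0 \<le> poly p x * (1 - x^2) powr s" for x using assms by simp
  have "weighted_integral s p \<noteq> 0"
  proof
    assume "weighted_integral s p = 0"
    then have *: "\<forall>x\<in>{-1..1}. poly p x * (1 - x^2) powr s = 0"
      unfolding weighted_integral_def
      using integral_eq_0_iff[OF continuous_on_poly_weight, of p] nn by simp
    have "poly p x = 0" if "x \<in> {-1<..<1}" for x
      using that *[rule_format, of x] by (auto simp: abs_square_eq_1)
    then have "{-1<..<1} \<subseteq> {x. poly p x = 0}" by auto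
    moreover have "infinite {-1<..<1::real}" by (simp add: infinite_Ioo)
    ultimately show False using poly_roots_finite[OF assms(2)] finite_subset by blast
  qed
  moreover have "0 \<le> weighted_integral s p"
    unfolding weighted_integral_def using nn
    by (intro integral_nonneg integrable_continuous_interval continuous_on_poly_weight) auto
  ultimately show ?thesis by simp
qed

text \<open>The integral of the derivative of \<open>(1 - x\<^sup>2)\<^sup>s\<^sup>+\<^sup>1 p(x)\<close> vanishes.\<close>

lemma weighted_integral_by_parts:
  "weighted_integral s ([:1, 0, -1:] * pderiv p) = 2 * (s + 1) * weighted_integral s ([:0, 1:] * p)"
proof -
  let ?F = "\<lambda>x. (1 - x^2) powr (s + 1) * poly p x"
  let ?q = "[:1, 0, -1:] * pderiv p - smult (2 * (s + 1)) ([:0, 1:] * p)"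
  have "((\<lambda>x. poly ?q x * (1 - x^2) powr s) has_integral (?F 1 - ?F (-1))) {-1..1}"
  proof (rule fundamental_theorem_of_calculus_interior)
    show "continuous_on {-1..1} ?F"
      using s by (intro continuous_on_mult continuous_on_weight continuous_intros) auto
    fix x :: real assume "x \<in> {-1<..<1}"
    then have pos: "0 < 1 - x^2" by (simp add: abs_square_less_1 abs_less_iff)
    have d: "((\<lambda>z. z powr (s + 1)) has_real_derivative (s + 1) * (1 - x^2) powr (s + 1 - 1)) (at (1 - x^2))"
      by (rule has_real_derivative_powr[OF pos])
    have "((\<lambda>x. (1 - x^2) powr (s + 1)) has_real_derivative (s + 1) * (1 - x^2) powr (s + 1 - 1) * (- 2 * x))
        (at x)"
      by (rule DERIV_chain2[where f = "\<lambda>z. z powr (s + 1)" and g = "\<lambda>x. 1 - x^2", OF d])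
          (auto intro!: derivative_eq_intros)
    then have "((\<lambda>x. (1 - x^2) powr (s + 1)) has_real_derivative (s + 1) * (1 - x^2) powr s * (- 2 * x)) (at x)"
      by simp
    then have "(?F has_real_derivative
        (s + 1) * (1 - x^2) powr s * (- 2 * x) * poly p x + poly (pderiv p) x * (1 - x^2) powr (s + 1)) (at x)"
      by (rule DERIV_mult) (rule poly_DERIV)
    moreover have "(s + 1) * (1 - x^2) powr s * (- 2 * x) * poly p x
        + poly (pderiv p) x * (1 - x^2) powr (s + 1)
       = poly ?q x * (1 - x^2) powr s"
      using pos by (simp add: powr_add algebra_simps power2_eq_square)
    ultimately show "(?F has_vector_derivative poly ?q x * (1 - x^2) powr s) (at x)"
      by (simp add: has_real_derivative_iff_has_vector_derivative)
  qed simp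
  then have "weighted_integral s ?q = 0" unfolding weighted_integral_def by (simp add: integral_unique)
  then show ?thesis by (simp only: weighted_integral_diff weighted_integral_smult) 
qed

lemma weighted_integral_gegenbauer: "weighted_integral s (geg_poly s (Suc n)) = 0"
proof -
  have "weighted_integral s (geg_poly s n) = 0 \<or> n = 0" for n
  proof (induction n rule: less_induct)
    case (less n)
    \<comment> \<open>the structure relation, integrated by parts\<close>
    have eq: "(real n + 1) * weighted_integral s (geg_poly s (Suc n))
        = (real n - 1) * weighted_integral s ([:0, 1:] * geg_poly s n)" for n
    proof -
      have "smult (real n + 1) (geg_poly s (Suc n))
          = smult (real n + 2 * (s + 1/2)) ([:0, 1:] * geg_poly s n) - [:1, 0, -1:] * pderiv (geg_poly s n)"
        using gegenbauer_deriv[of "s + 1/2" _ n] s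
        by (intro poly_eq_poly_eq_iff[THEN iffD1, OF ext])
            (simp del: gegenbauer_poly.simps gegenbauer.simps add: algebra_simps power2_eq_square)
      from arg_cong[OF this, of "weighted_integral s"] show ?thesis
        by (simp only: weighted_integral_diff weighted_integral_smult weighted_integral_by_parts)
            (simp add: algebra_simps)
    qed
    consider "n = 0" | "n = 1" | m where "n = Suc (Suc m)" by (metis One_nat_def nat.exhaust)
    then show ?case
    proof cases
      case 2
      have "geg_poly s 1 = smult (2 * (s + 1/2)) ([:0, 1:] * geg_poly s 0)" by simp
      then have "weighted_integral s (geg_poly s 1)
          = 2 * (s + 1/2) * weighted_integral s ([:0, 1:] * geg_poly s 0)"
        by (metis weighted_integral_smult)
      with eq[of 0] have "(2 * s + 2) * weighted_integral s ([:0, 1:] * geg_poly s 0) = 0"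
          by (simp add: algebra_simps)
      then have "weighted_integral s ([:0, 1:] * geg_poly s 0) = 0" using s by simp
      with eq[of 0] show ?thesis using 2 by simp
    next
      case (3 m)
      let ?I = "weighted_integral s"
      have e: "(real m + 2) * ?I (geg_poly s (Suc (Suc m))) = real m * ?I ([:0, 1:] * geg_poly s (Suc m))"
        using eq[of "Suc m"] by (simp add: algebra_simps)
      have x: "?I ([:0, 1:] * geg_poly s (Suc m))
          = (real m + 2) / (2 * (real m + 1 + (s+1/2))) * ?I (geg_poly s (Suc (Suc m)))
         + (real m + 2 * (s+1/2)) / (2 * (real m + 1 + (s+1/2))) * ?I (geg_poly s m)"
        using s by (simp only: X_times_gegenbauer_poly[of "s+1/2"] weighted_integral_add weighted_integral_smult)
      have "real m * ?I (geg_poly s m) = 0" using less[of m] 3 by auto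
      then have "real m * ?I ([:0, 1:] * geg_poly s (Suc m))
          = (real m / (2 * (real m + 1 + (s+1/2)))) * ((real m + 2) * ?I (geg_poly s (Suc (Suc m))))"
        unfolding x by (cases "m = 0") (simp_all add: algebra_simps add_divide_distrib del: gegenbauer_poly.simps)
      with e have "(1 - real m / (2 * (real m + 1 + (s+1/2)))) *
          ((real m + 2) * ?I (geg_poly s (Suc (Suc m)))) = 0"
        by (simp add: algebra_simps del: gegenbauer_poly.simps)
      moreover have "real m / (2 * (real m + 1 + (s+1/2))) < 1" using s by (simp add: field_simps)
      then have "1 - real m / (2 * (real m + 1 + (s+1/2))) \<noteq> 0" by linarith
      moreover have "real m + 2 \<noteq> 0" by simp
      ultimately have "?I (geg_poly s (Suc (Suc m))) = 0" by (metis mult_eq_0_iff)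
      then show ?thesis using 3 by (simp del: gegenbauer_poly.simps)
    qed simp
  qed
  then show ?thesis by blast
qed

text \<open>Multiplication by \<open>x\<close> shifts the index of \<open>C\<^sub>n\<close> by one in either direction, so that \<open>x\<^sup>k C\<^sub>n\<close> with \<open>k < n\<close>
  is a combination of \<open>C\<^sub>m\<close> with \<open>m \<ge> 1\<close>, each of which has integral zero.\<close>

lemma gegenbauer_orthogonal:
  assumes "degree p < n"
  shows "weighted_integral s (p * geg_poly s n) = 0"
proof -
  have "degree p \<le> k \<Longrightarrow> k < n \<Longrightarrow> weighted_integral s (p * geg_poly s n) = 0" for k
  proof (induction k arbitrary: p n)
    case 0
    then obtain a where "p = [:a:]" using degree_eq_zeroE by blast
    moreover obtain m where "n = Suc m" using 0 gr0_implies_Suc by blast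
    ultimately show ?case using weighted_integral_smult[of a] weighted_integral_gegenbauer
      by (simp del: gegenbauer_poly.simps)
  next
    case (Suc k)
    obtain a q where p: "p = pCons a q" by (rule pCons_cases)
    obtain m where n: "n = Suc (Suc m)" using Suc.prems by (metis Suc_lessE less_nat_zero_code not0_implies_Suc)
    have dq: "degree q \<le> k" using Suc.prems(1) p by (cases "q = 0") auto
    have "p * geg_poly s n = smult a (geg_poly s n) + q * ([:0, 1:] * geg_poly s n)" unfolding p
        by (simp del: gegenbauer_poly.simps)
    also have "\<dots> = smult a (geg_poly s n) + (smult ((real (Suc m) + 2) / (2 * (real (Suc m) + 1 + (s+1/2))))
        (q * geg_poly s (Suc n))
      + smult ((real (Suc m) + 2 * (s+1/2)) / (2 * (real (Suc m) + 1 + (s+1/2)))) (q * geg_poly s (Suc m)))"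
      unfolding n using s
      by (subst X_times_gegenbauer_poly) (simp_all del: gegenbauer_poly.simps add: algebra_simps)
    finally have "weighted_integral s (p * geg_poly s n) = a * 0
      + ((real (Suc m) + 2) / (2 * (real (Suc m) + 1 + (s+1/2))) * 0
      + (real (Suc m) + 2 * (s+1/2)) / (2 * (real (Suc m) + 1 + (s+1/2))) * 0)"
      using Suc.IH[OF dq, of "Suc n"] Suc.IH[OF dq, of "Suc m"] Suc.prems weighted_integral_gegenbauer[of "Suc m"] n
      by (simp only: weighted_integral_add weighted_integral_smult)
    then show ?case by simp
  qed
  then show ?thesis using assms by blast
qed

lemma geg_h_squared: "(geg_h s n)^2 = weighted_integral s (geg_poly s n * geg_poly s n)"
proof -
  have "(geg_h s n)^2 = integral {-1..1} (\<lambda>x. \<bar>gegenbauer (s + 1/2) n x\<bar>\<^sup>2 * (1 - x\<^sup>2) powr s)"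
    unfolding geg_h_def using integrable_continuous_interval[OF continuous_on_poly_weight[of "geg_poly s n
        * geg_poly s n"]]
    by (intro real_sqrt_pow2 integral_nonneg) (auto simp: power2_eq_square)
  also have "\<dots> = weighted_integral s (geg_poly s n * geg_poly s n)"
    unfolding weighted_integral_def by (simp add: power2_eq_square)
  finally show ?thesis .
qed

lemma geg_h_Suc_squared:
  "(geg_h s (Suc n))^2 = (real n + (s+1/2)) * (real n + 2 * (s+1/2)) / ((real n + 1) * (real n + 1 + (s+1/2)))
      * (geg_h s n)^2"
proof -
  let ?I = "weighted_integral s"
  let ?a = "s + 1/2"
  have geg_poly_Suc: "geg_poly s (Suc n) = smult (2 * (real n + ?a) / (real n + 1)) ([:0, 1:] * geg_poly s n)
      - (if n = 0 then 0 else smult ((real n - 1 + 2 * ?a) / (real n + 1)) (geg_poly s (n - 1)))"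
    by (cases n) (simp_all add: algebra_simps)
  have "geg_poly s (Suc n) * geg_poly s (Suc n)
      = smult (2 * (real n + ?a) / (real n + 1)) (geg_poly s n * ([:0, 1:] * geg_poly s (Suc n)))
     - smult ((real n - 1 + 2 * ?a) / (real n + 1))
         ((if n = 0 then 0 else geg_poly s (n - 1)) * geg_poly s (Suc n))"
    by (subst (1) geg_poly_Suc) (simp del: gegenbauer_poly.simps add: algebra_simps)
  moreover have "?I ((if n = 0 then 0 else geg_poly s (n - 1)) * geg_poly s (Suc n)) = 0"
    using degree_gegenbauer_poly[of ?a "n - 1", where 'a = real]
        by (intro gegenbauer_orthogonal) (auto split: if_splits)
  ultimately have 1: "?I (geg_poly s (Suc n) * geg_poly s (Suc n))
      = 2 * (real n + ?a) / (real n + 1) * ?I (geg_poly s n * ([:0, 1:] * geg_poly s (Suc n)))"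
    by (simp only: weighted_integral_diff weighted_integral_smult)
  have "geg_poly s n * ([:0, 1:] * geg_poly s (Suc n))
      = smult ((real n + 2) / (2 * (real n + 1 + ?a))) (geg_poly s n * geg_poly s (Suc (Suc n)))
     + smult ((real n + 2 * ?a) / (2 * (real n + 1 + ?a))) (geg_poly s n * geg_poly s n)"
    using s by (subst X_times_gegenbauer_poly) (simp_all del: gegenbauer_poly.simps add: algebra_simps)
  moreover have "?I (geg_poly s n * geg_poly s (Suc (Suc n))) = 0"
    using degree_gegenbauer_poly[of ?a n, where 'a = real] by (intro gegenbauer_orthogonal) auto
  ultimately have 2: "?I (geg_poly s n * ([:0, 1:] * geg_poly s (Suc n)))
      = (real n + 2 * ?a) / (2 * (real n + 1 + ?a)) * ?I (geg_poly s n * geg_poly s n)"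
    by (simp only: weighted_integral_add weighted_integral_smult)
  have "2 * A / B * (C / (2 * D) * H) = A * C / (B * D) * H" for A B C D H :: real by simp
  then show ?thesis unfolding geg_h_squared 1 2 by (simp only:)
qed

lemma geg_h_pos: "0 < geg_h s n"
proof -
  have "0 < (geg_h s n)^2"
  proof (induction n)
    case 0
    show ?case unfolding geg_h_squared by (intro weighted_integral_pos) auto
  next
    case (Suc n)
    then show ?case unfolding geg_h_Suc_squared using s by (intro mult_pos_pos divide_pos_pos) auto
  qed
  moreover have "0 \<le> geg_h s n" unfolding geg_h_def
    using integrable_continuous_interval[OF continuous_on_poly_weight[of "geg_poly s n * geg_poly s n"]]
    by (intro real_sqrt_ge_zero integral_nonneg) (auto simp: power2_eq_square)
  ultimately show ?thesis by (simp add: less_le)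
qed

end

section \<open>Growth of the normalized Gegenbauer polynomials in the complex plane\<close>

lemma sum_inverse_squares_le: "(\<Sum>i<n. 1 / (real i + 1)^2) \<le> 2"
proof -
  have step: "1 / (real n + 2)^2 \<le> 1 / (real n + 1) - 1 / (real n + 2)" for n
  proof -
    have "1 / (real n + 2)^2 \<le> 1 / ((real n + 1) * (real n + 2))"
      unfolding power2_eq_square by (intro divide_left_mono mult_right_mono) auto
    also have "\<dots> = 1 / (real n + 1) - 1 / (real n + 2)" by (simp add: field_simps)
    finally show ?thesis .
  qed
  have "(\<Sum>i<Suc n. 1 / (real i + 1)^2) \<le> 2 - 1 / (real n + 1)" for n
  proof (induction n)
    case (Suc n)
    have "(\<Sum>i<Suc (Suc n). 1 / (real i + 1)^2) = (\<Sum>i<Suc n. 1 / (real i + 1)^2) + 1 / (real n + 2)^2"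
      by (subst sum.lessThan_Suc) (simp add: add.commute)
    moreover have e: "real (Suc n) + 1 = real n + 2" by simp
    ultimately show ?case unfolding e using Suc step[of n] by linarith
  qed simp
  moreover have "0 \<le> 1 / (real n + 1)" for n by simp
  ultimately have "(\<Sum>i<Suc n. 1 / (real i + 1)^2) \<le> 2" for n by (smt (verit))
  then show ?thesis by (cases n) auto
qed

text \<open>For \<open>\<kappa> = 0\<close> the recurrence is that of the Chebyshev polynomials of the second kind at the point
  \<open>joukowski u\<close>. A perturbation that is summable in \<open>n\<close> does not change the rate of growth; the bound
  is uniform for \<open>1 \<le> |u| \<le> \<rho>\<close>, down to the interval.\<close>

lemma perturbed_chebyshev_recurrence_bound:
  fixes y :: "nat \<Rightarrow> complex" and \<kappa> :: "nat \<Rightarrow> real"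
  assumes \<rho>: "1 < \<rho>" and u: "1 \<le> cmod u" "cmod u \<le> \<rho>"
    and y0: "y 0 = 1" and y1: "y 1 = u + 1 / u"
    and rec: "\<And>n. y (Suc (Suc n)) = (u + 1 / u) * y (Suc n) - of_real (1 - \<kappa> n) * y n"
    and \<kappa>: "\<And>n. \<bar>\<kappa> n\<bar> \<le> 1 / (real n + 1)^2"
  shows "cmod (y n) \<le> \<rho> / (\<rho> - 1) * exp (2 / (\<rho> - 1)) * \<rho> ^ n"
proof -
  \<comment> \<open>The difference \<open>y\<^sub>n\<^sub>+\<^sub>1 - y\<^sub>n / u\<close> is multiplied by \<open>u\<close> in each unperturbed step. It is controlled
    together with \<open>y\<^sub>n\<close>, and \<open>E\<close> collects the factors that come from the perturbation.\<close>
  define B where "B = \<rho> / (\<rho> - 1)"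
  define c where "c = 1 / (\<rho> - 1)"
  define E where "E n = exp (c * (\<Sum>i<n. 1 / (real i + 1)^2))" for n
  have u0: "u \<noteq> 0" using u by auto
  have B: "1 \<le> B" "\<rho> + B = \<rho> * B" "B = \<rho> * c" and c: "0 < c" using \<rho> by (simp_all add: B_def c_def field_simps)
  have E_pos: "0 < E n" for n by (simp add: E_def)
  have E_Suc: "E n * (1 + c / (real n + 1)^2) \<le> E (Suc n)" for n
  proof -
    have "E (Suc n) = E n * exp (c / (real n + 1)^2)" by (simp add: E_def distrib_left exp_add)
    then show ?thesis using exp_ge_add_one_self[of "c / (real n + 1)^2"] E_pos[of n] by simp
  qed
  have "E n * 1 \<le> E n * (1 + c / (real n + 1)^2)" for n
    using E_pos[of n] c by (intro mult_left_mono) auto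
  then have E_mono: "E n \<le> E (Suc n)" for n using E_Suc[of n] by (metis mult_1_right order_trans)
  have "cmod (y n) \<le> B * \<rho> ^ n * E n \<and> cmod (y (Suc n) - y n / u) \<le> \<rho> * \<rho> ^ n * E n"
  proof (induction n)
    case 0
    then show ?case using y0 y1 u B by (simp add: E_def)
  next
    case (Suc n)
    have "cmod (y n / u) \<le> cmod (y n)"
      using divide_left_mono[of 1 "cmod u" "cmod (y n)"] u u0 by (simp add: norm_divide)
    moreover have "cmod (y (Suc n)) \<le> cmod (y (Suc n) - y n / u) + cmod (y n / u)"
      by (metis diff_add_cancel norm_triangle_ineq)
    ultimately have "cmod (y (Suc n)) \<le> \<rho> * \<rho> ^ n * E n + B * \<rho> ^ n * E n" using Suc by linarith
    also have "\<dots> = (\<rho> + B) * (\<rho> ^ n * E n)" by (simp add: algebra_simps)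
    also have "\<dots> = B * \<rho> ^ Suc n * E n" unfolding B(2) by simp
    also have "\<dots> \<le> B * \<rho> ^ Suc n * E (Suc n)" using E_mono B \<rho> by (intro mult_left_mono) auto
    finally have 1: "cmod (y (Suc n)) \<le> B * \<rho> ^ Suc n * E (Suc n)" .
    have "y (Suc (Suc n)) - y (Suc n) / u = u * (y (Suc n) - y n / u) + of_real (\<kappa> n) * y n"
      unfolding rec using u0 by (simp add: field_simps)
    then have "cmod (y (Suc (Suc n)) - y (Suc n) / u)
        \<le> cmod u * cmod (y (Suc n) - y n / u) + \<bar>\<kappa> n\<bar> * cmod (y n)"
      by (metis norm_triangle_ineq norm_mult norm_of_real)
    also have "\<dots> \<le> \<rho> * (\<rho> * \<rho> ^ n * E n) + 1 / (real n + 1)^2 * (B * \<rho> ^ n * E n)"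
      using Suc u \<kappa>[of n] by (intro add_mono mult_mono) auto
    also have "\<dots> = (\<rho> + c / (real n + 1)^2) * (\<rho> * \<rho> ^ n * E n)"
      unfolding B(3) by (simp add: algebra_simps)
    also have "\<dots> \<le> (\<rho> * (1 + c / (real n + 1)^2)) * (\<rho> * \<rho> ^ n * E n)"
    proof (intro mult_right_mono)
      have "1 * (c / (real n + 1)^2) \<le> \<rho> * (c / (real n + 1)^2)" using \<rho> c by (intro mult_right_mono) auto
      then show "\<rho> + c / (real n + 1)\<^sup>2 \<le> \<rho> * (1 + c / (real n + 1)\<^sup>2)" by (simp add: algebra_simps)
    qed (use \<rho> E_pos[of n] in auto)
    also have "\<dots> = \<rho> * \<rho> ^ Suc n * (E n * (1 + c / (real n + 1)^2))" by simp
    also have "\<dots> \<le> \<rho> * \<rho> ^ Suc n * E (Suc n)" using E_Suc[of n] \<rho> by (intro mult_left_mono) auto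
    finally show ?case using 1 by blast
  qed
  then have "cmod (y n) \<le> B * \<rho> ^ n * E n" by blast
  also have "\<dots> \<le> B * \<rho> ^ n * exp (2 / (\<rho> - 1))"
  proof (intro mult_left_mono)
    have "c * (\<Sum>i<n. 1 / (real i + 1)^2) \<le> c * 2" using sum_inverse_squares_le c by (intro mult_left_mono) auto
    then show "E n \<le> exp (2 / (\<rho> - 1))" by (simp add: E_def c_def)
  qed (use B \<rho> in auto)
  finally show ?thesis by (simp add: B_def mult_ac)
qed

context
  fixes s :: real
  assumes s: "0 < s" "s < 1"
begin

text \<open>The leading coefficient of \<open>C\<^sub>n\<close> divided by \<open>2\<^sup>n\<close>. After division by it the three-term recurrence becomes
  \<open>y\<^sub>n\<^sub>+\<^sub>2 = 2 z y\<^sub>n\<^sub>+\<^sub>1 - (1 - \<kappa>\<^sub>n) y\<^sub>n\<close>, where \<open>\<kappa>\<^sub>n\<close> is the defect below.\<close>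

definition geg_scale :: "nat \<Rightarrow> real" where "geg_scale n = pochhammer (s + 1/2) n / fact n"

text \<open>The deviation \<open>\<kappa>\<^sub>n\<close> of the rescaled recurrence from the Chebyshev recurrence; it is of size \<open>1 / n\<^sup>2\<close>.\<close>

definition geg_defect :: "nat \<Rightarrow> real" where
  "geg_defect n = (s + 1 / 2) * ((s + 1 / 2) - 1) / ((real n + 1 + (s + 1 / 2)) * (real n + (s + 1 / 2)))"

lemma geg_scale_0: "geg_scale 0 = 1" by (simp add: geg_scale_def)

lemma geg_scale_Suc: "geg_scale (Suc n) = (real n + (s + 1 / 2)) / (real n + 1) * geg_scale n"
  by (simp add: geg_scale_def pochhammer_Suc field_simps)

lemma geg_scale_pos: "0 < geg_scale n"
  unfolding geg_scale_def using s by (intro divide_pos_pos pochhammer_pos) auto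

lemma geg_defect_eq: "1 - geg_defect n = (real n + 1) * (real n + 2 * (s + 1 / 2)) /
    ((real n + 1 + (s + 1 / 2)) * (real n + (s + 1 / 2)))"
proof -
  have "(real n + 1 + (s + 1 / 2)) * (real n + (s + 1 / 2)) \<noteq> 0" using s by auto
  then show ?thesis by (simp add: geg_defect_def field_simps)
qed

lemma geg_defect_less_1: "geg_defect n < 1"
proof -
  have "0 < (real n + 1) * (real n + 2 * (s + 1 / 2)) / ((real n + 1 + (s + 1 / 2)) * (real n + (s + 1 / 2)))"
    using s by (intro divide_pos_pos mult_pos_pos) auto
  then show ?thesis using geg_defect_eq[of n] by linarith
qed

lemma abs_geg_defect_le: "\<bar>geg_defect n\<bar> \<le> 1 / (real n + 1)^2"
proof -
  have p: "0 < (real n + 1 + (s + 1 / 2)) * (real n + (s + 1 / 2))" using s by auto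
  have "\<bar>(s + 1 / 2) * ((s + 1 / 2) - 1)\<bar> \<le> 3/4"
  proof -
    have "(s + 1 / 2) * ((s + 1 / 2) - 1) = s^2 - 1/4" by (simp add: power2_eq_square algebra_simps)
    moreover have "s^2 < 1" using s by (simp add: abs_square_less_1)
    moreover have "0 \<le> s^2" by simp
    ultimately show ?thesis by linarith
  qed
  then have "\<bar>(s + 1 / 2) * ((s + 1 / 2) - 1)\<bar> * (real n + 1)^2 \<le> 3/4 * (real n + 1)^2"
      by (intro mult_right_mono) auto
  also have "\<dots> \<le> (real n + 1)^2 - 1/4"
  proof -
    have "1 \<le> (real n + 1)^2" by (simp add: power2_eq_square algebra_simps)
    then show ?thesis by simp
  qed
  also have "\<dots> = (real n + 3/2) * (real n + 1/2)" by (simp add: power2_eq_square algebra_simps)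
  also have "\<dots> \<le> (real n + 1 + (s + 1 / 2)) * (real n + (s + 1 / 2))" using s by (intro mult_mono) auto
  finally have le: "\<bar>(s + 1 / 2) * ((s + 1 / 2) - 1)\<bar> * (real n + 1)^2
      \<le> (real n + 1 + (s + 1 / 2)) * (real n + (s + 1 / 2))" .
  have "A / P \<le> 1 / Q" if "A * Q \<le> P" "0 < P" "0 < Q" for A P Q :: real
    using that by (simp add: field_simps)
  from this[OF le p] show ?thesis unfolding geg_defect_def abs_divide abs_of_pos[OF p] by simp
qed

lemma geg_h_ratio_Suc:
  "(geg_h s (Suc n) / geg_scale (Suc n))^2 = (1 - geg_defect n) * (geg_h s n / geg_scale n)^2"
proof -
  have nz: "real n + 1 \<noteq> 0" "real n + (s + 1 / 2) \<noteq> 0" "real n + 1 + (s + 1 / 2) \<noteq> 0"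
    using s by auto
  have "(A * B / (D * F) * h) / ((A / D)^2 * c) = D * B / (F * A) * (h / c)"
    if "D \<noteq> 0" "A \<noteq> 0" "F \<noteq> 0" for A B D F h c :: real
    using that by (simp add: field_simps power2_eq_square)
  from this[OF nz] show ?thesis
    unfolding geg_defect_eq geg_scale_Suc power_divide[of _ "geg_scale n"] power_divide[of _ "_ * geg_scale n"]
      geg_h_Suc_squared[OF s(1)] power_mult_distrib .
qed

text \<open>The squares of the norms of the rescaled polynomials are multiplied by \<open>1 - \<kappa>\<^sub>n\<close> in each step, and
  the product of these factors stays away from zero.\<close>

lemma geg_h_ratio_bounded_below:
  obtains g where "0 < g" "\<And>n. g \<le> geg_h s n / geg_scale n"
proof -
  define H where "H n = (geg_h s n / geg_scale n)^2" for n
  have H_pos: "0 < H n" for n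
    using geg_h_pos[OF s(1), of n] geg_scale_pos[of n] by (simp add: H_def)
  \<comment> \<open>comparison with the telescoping product of the factors \<open>1 - 1 / k\<^sup>2\<close>\<close>
  have "H 1 / 2 * ((real n + 2) / (real n + 1)) \<le> H (Suc n)" for n
  proof (induction n)
    case (Suc n)
    have d: "1 - 1 / (real n + 2)^2 \<le> 1 - geg_defect (Suc n)"
      using abs_geg_defect_le[of "Suc n"] by (simp add: add.commute abs_le_iff)
    have e: "1 - 1 / (real n + 2)^2 = (real n + 1) * (real n + 3) / (real n + 2)^2"
    proof -
      have "1 - 1 / K^2 = (K - 1) * (K + 1) / K^2" if "K \<noteq> 0" for K :: real
        using that by (simp add: field_simps power2_eq_square)
      from this[of "real n + 2"] show ?thesis by (simp add: add_ac)
    qed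
    have "N * M / K^2 * (q * (K / N)) = q * (M / K)" if "K \<noteq> 0" "N \<noteq> 0" for K M N q :: real
      using that by (simp add: field_simps power2_eq_square)
    from this[of "real n + 2" "real n + 1" "real n + 3" "H 1 / 2"]
    have "H 1 / 2 * ((real (Suc n) + 2) / (real (Suc n) + 1))
        = (1 - 1 / (real n + 2)^2) * (H 1 / 2 * ((real n + 2) / (real n + 1)))"
      unfolding e by (simp add: add_ac)
    also have "\<dots> \<le> (1 - geg_defect (Suc n)) * H (Suc n)"
      using d Suc H_pos[of 1] geg_defect_less_1[of "Suc n"] by (intro mult_mono) auto
    finally show ?case using geg_h_ratio_Suc[of "Suc n"] by (simp add: H_def)
  qed (use H_pos[of 1] in simp)
  moreover have "H 1 / 2 * 1 \<le> H 1 / 2 * ((real n + 2) / (real n + 1))" for n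
    using H_pos[of 1] by (intro mult_left_mono) auto
  ultimately have 1: "H 1 / 2 \<le> H (Suc n)" for n by (metis mult.right_neutral order_trans)
  define m where "m = min (H 0) (H 1 / 2)"
  have m: "0 < m" using H_pos[of 0] H_pos[of 1] by (simp add: m_def)
  have le: "m \<le> H n" for n using 1[of "n - 1"] by (cases n) (auto simp: m_def min_def)
  have "sqrt m \<le> geg_h s n / geg_scale n" for n
    using le[of n] geg_h_pos[OF s(1), of n] geg_scale_pos[of n]
    by (intro real_le_lsqrt) (auto simp: H_def)
  then show thesis using that[of "sqrt m"] m by simp
qed

text \<open>The sharp exponential rate, without a power of \<open>n\<close>. Any such loss would destroy the convergence in
  operator norm for small \<open>s\<close>.\<close>

lemma geg_normalized_growth:
  assumes \<rho>: "1 < \<rho>"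
  obtains K where "0 < K" "\<And>n z. z \<in> bernstein_region \<rho> \<Longrightarrow> cmod (geg_normalized s n z) \<le> K * \<rho> ^ n"
proof -
  obtain g where g: "0 < g" "\<And>n. g \<le> geg_h s n / geg_scale n" using geg_h_ratio_bounded_below by blast
  define L where "L = \<rho> / (\<rho> - 1) * exp (2 / (\<rho> - 1))"
  have L: "0 < L" using \<rho> by (simp add: L_def)
  have "cmod (geg_normalized s n z) \<le> L / g * \<rho> ^ n" if z: "z \<in> bernstein_region \<rho>" for n z
  proof -
    have "1 \<le> \<rho>" using \<rho> by simp
    with z obtain u where u: "1 \<le> cmod u" "cmod u \<le> \<rho>" "z = joukowski u" by (rule bernstein_regionE)
    have zu: "2 * z = u + 1 / u" unfolding u(3) joukowski_def by simp
    define y where "y n = gegenbauer (s + 1 / 2) n z / of_real (geg_scale n)" for n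
    have nz: "of_real (geg_scale n) \<noteq> (0::complex)" for n using geg_scale_pos[of n] by simp
    have "cmod (y n) \<le> L * \<rho> ^ n" unfolding L_def
    proof (rule perturbed_chebyshev_recurrence_bound[OF \<rho> u(1,2)])
      show "y 0 = 1" by (simp add: y_def geg_scale_0)
      have "complex_of_real (s + 1 / 2) \<noteq> 0" using s by (subst of_real_eq_0_iff) simp
      moreover have "geg_scale (Suc 0) = (s + 1 / 2)" by (simp add: geg_scale_def)
      ultimately show "y 1 = u + 1 / u" unfolding zu[symmetric] y_def One_nat_def gegenbauer.simps
        by (simp del: of_real_add)
      show "\<bar>geg_defect n\<bar> \<le> 1 / (real n + 1)^2" for n by (rule abs_geg_defect_le)
      show "y (Suc (Suc n)) = (u + 1 / u) * y (Suc n) - of_real (1 - geg_defect n) * y n" for n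
      proof -
        have nz': "real n + 2 \<noteq> 0" "real n + 1 \<noteq> 0" "real n + 1 + (s + 1 / 2) \<noteq> 0" "real n + (s + 1 / 2) \<noteq> 0"
          using s by auto
        have sc: "geg_scale (Suc (Suc n)) = (real n + 1 + (s + 1 / 2)) / (real n + 2) * geg_scale (Suc n)"
          by (subst geg_scale_Suc) (simp add: add_ac)
        have "2 * F / K / (F / K * c) = 2 / c" if "F \<noteq> 0" "K \<noteq> 0" for F K c :: real
          using that by simp
        from this[OF nz'(3,1)]
        have e1: "2 * (real n + 1 + (s + 1 / 2)) / (real n + 2) / geg_scale (Suc (Suc n))
            = 2 / geg_scale (Suc n)"
          unfolding sc .
        have "B / K / (F / K * (A / D * c)) = D * B / (F * A) / c"
          if "K \<noteq> 0" "D \<noteq> 0" "F \<noteq> 0" "A \<noteq> 0" for A B D F K c :: real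
          using that by (simp add: field_simps)
        from this[OF nz']
        have e2: "(real n + 2 * (s + 1 / 2)) / (real n + 2) / geg_scale (Suc (Suc n))
            = (1 - geg_defect n) / geg_scale n"
          unfolding sc geg_scale_Suc[of n] geg_defect_eq .
        have "(of_real X * U - of_real Y * V) / of_real c = of_real (X / c) * U - of_real (Y / c) * V"
          for X Y c :: real and U V :: complex by (simp add: diff_divide_distrib)
        then have "y (Suc (Suc n)) = of_real (2 / geg_scale (Suc n)) * (z * gegenbauer (s + 1 / 2) (Suc n) z)
            - of_real ((1 - geg_defect n) / geg_scale n) * gegenbauer (s + 1 / 2) n z"
          unfolding y_def gegenbauer_Suc_Suc e1[symmetric] e2[symmetric] .
        moreover have "of_real (2 / c) * (z * U) - of_real (X / d) * V
            = 2 * z * (U / of_real c) - of_real X * (V / of_real d)" for X c d :: real and U V :: complex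
          by simp
        ultimately show ?thesis unfolding y_def zu[symmetric] by (simp only:)
      qed
    qed
    moreover have "geg_normalized s n z = y n / of_real (geg_h s n / geg_scale n)"
      using nz[of n] by (simp add: geg_normalized_def y_def)
    moreover have pos: "0 < geg_h s n / geg_scale n" using g(1) g(2)[of n] by linarith
    ultimately have "cmod (geg_normalized s n z) = cmod (y n) / (geg_h s n / geg_scale n)"
      by (simp only: norm_divide[of "y n"] norm_of_real abs_of_pos[OF pos])
    also have "\<dots> \<le> L * \<rho> ^ n / (geg_h s n / geg_scale n)"
      using \<open>cmod (y n) \<le> L * \<rho> ^ n\<close> pos by (intro divide_right_mono) linarith+
    also have "\<dots> \<le> L * \<rho> ^ n / g"
      using g L \<rho> by (intro divide_left_mono mult_pos_pos) (auto intro: less_le_trans)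
    finally show ?thesis by simp
  qed
  then show thesis using that[of "L / g"] L g by auto
qed

end

section \<open>Approximation of the Cauchy kernel and functions of the second kind\<close>

text \<open>Chebyshev polynomials of the first kind. They serve only to approximate the Cauchy kernel:
  \<open>T\<^sub>n(joukowski u) = (u\<^sup>n + u\<^sup>-\<^sup>n) / 2\<close> is bounded on the interval and of size \<open>\<rho>\<^sup>n\<close> on the ellipse.\<close>

fun chebyshev_poly :: "nat \<Rightarrow> complex poly" where
  "chebyshev_poly 0 = 1"
| "chebyshev_poly (Suc 0) = [:0, 1:]"
| "chebyshev_poly (Suc (Suc n)) = [:0, 2:] * chebyshev_poly (Suc n) - chebyshev_poly n"

lemma degree_chebyshev_poly: "degree (chebyshev_poly n) \<le> n"
proof (induction n rule: chebyshev_poly.induct)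
  case (3 n)
  have "degree ([:0, 2:] * chebyshev_poly (Suc n)) \<le> 1 + Suc n"
    by (rule order_trans[OF degree_mult_le]) (use 3 in simp)
  then show ?case using 3 by (auto intro!: degree_diff_le)
qed simp_all

lemma chebyshev_poly_joukowski:
  assumes "u \<noteq> 0"
  shows "poly (chebyshev_poly n) (joukowski u) = (u ^ n + 1 / u ^ n) / 2"
proof (induction n rule: chebyshev_poly.induct)
  case (3 n)
  have "(u + 1 / u) * ((u ^ Suc n + 1 / u ^ Suc n) / 2) - (u ^ n + 1 / u ^ n) / 2
      = (u ^ Suc (Suc n) + 1 / u ^ Suc (Suc n)) / 2"
    using assms by (simp add: field_simps)
  moreover have "2 * joukowski u = u + 1 / u" by (simp add: joukowski_def)
  moreover have "poly (chebyshev_poly (Suc (Suc n))) (joukowski u)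
      = 2 * joukowski u * poly (chebyshev_poly (Suc n)) (joukowski u) - poly (chebyshev_poly n) (joukowski u)"
    by simp
  ultimately show ?case unfolding 3 by (simp only:)
qed (simp_all add: joukowski_def)

lemma chebyshev_poly_interval_bound:
  assumes "x \<in> {-1..1}"
  shows "cmod (poly (chebyshev_poly n) (of_real x)) \<le> 1"
proof -
  have x: "-1 \<le> x" "x \<le> 1" using assms by auto
  obtain u where u: "cmod u = 1" "of_real x = joukowski u" using x by (rule interval_joukowskiE)
  have "u \<noteq> 0" using u by auto
  have "cmod (u ^ n + 1 / u ^ n) \<le> cmod (u ^ n) + cmod (1 / u ^ n)" by (rule norm_triangle_ineq)
  also have "\<dots> = 2" using u by (simp add: norm_power norm_divide)
  finally show ?thesis unfolding u(2) chebyshev_poly_joukowski[OF \<open>u \<noteq> 0\<close>] by simp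
qed

lemma chebyshev_poly_ellipse_bound:
  assumes \<rho>: "1 < \<rho>" and v: "cmod v = \<rho>"
  shows "(1 - 1 / \<rho>) / 2 * \<rho> ^ n \<le> cmod (poly (chebyshev_poly n) (joukowski v))"
proof (cases n)
  case 0
  have "0 \<le> 1 / \<rho>" using \<rho> by simp
  moreover have "(1 - i) / 2 \<le> 1" if "0 \<le> i" for i :: real using that by simp
  ultimately have "(1 - 1 / \<rho>) / 2 \<le> 1" by blast
  then show ?thesis using 0 by simp
next
  case (Suc m)
  have v0: "v \<noteq> 0" using v \<rho> by auto
  have "1 / \<rho> ^ n \<le> 1" using \<rho> by simp
  also have "1 \<le> \<rho> ^ m" using \<rho> by simp
  finally have "1 / \<rho> ^ n \<le> \<rho> ^ n / \<rho>" using \<rho> Suc by simp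
  then have "(1 - 1 / \<rho>) * \<rho> ^ n \<le> \<rho> ^ n - 1 / \<rho> ^ n" by (simp add: algebra_simps)
  also have "\<dots> = cmod (v ^ n) - cmod (- (1 / v ^ n))" using v by (simp add: norm_power norm_divide)
  also have "\<dots> \<le> cmod (v ^ n - - (1 / v ^ n))" by (rule norm_triangle_ineq2)
  finally have "(1 - 1 / \<rho>) * \<rho> ^ n \<le> cmod (v ^ n + 1 / v ^ n)" by simp
  then show ?thesis unfolding chebyshev_poly_joukowski[OF v0] by (simp add: norm_divide)
qed

lemma joukowski_dist_ge:
  assumes \<rho>: "1 < \<rho>" and v: "cmod v = \<rho>" and u: "1 \<le> cmod u"
  shows "(1 - 1 / \<rho>) / 2 * cmod (v - u) \<le> cmod (joukowski v - joukowski u)"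
proof -
  have nz: "u \<noteq> 0" "v \<noteq> 0" using u v \<rho> by auto
  have "\<rho> \<le> cmod u * cmod v" using u v \<rho> by simp
  then have "1 / (cmod u * cmod v) \<le> 1 / \<rho>" using \<rho> by (intro divide_left_mono) auto
  moreover have "1 - 1 / (cmod u * cmod v) \<le> cmod (1 - 1 / (u * v))"
    using norm_triangle_ineq2[of 1 "1 / (u * v)"] by (simp add: norm_divide norm_mult)
  ultimately have "1 - 1 / \<rho> \<le> cmod (1 - 1 / (u * v))" by linarith
  then have "(1 - 1 / \<rho>) * cmod (v - u) \<le> cmod (1 - 1 / (u * v)) * cmod (v - u)" by (rule mult_right_mono) simp
  then show ?thesis unfolding joukowski_diff[OF nz] by (simp add: norm_mult norm_divide mult.commute)
qed

lemma ellipse_interval_dist_ge: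
  assumes \<rho>: "1 < \<rho>" and v: "cmod v = \<rho>" and x: "x \<in> {-1..1}"
  shows "(1 - 1 / \<rho>) / 2 * (\<rho> - 1) \<le> cmod (joukowski v - of_real x)"
proof -
  have x: "-1 \<le> x" "x \<le> 1" using x by auto
  obtain u where u: "cmod u = 1" "of_real x = joukowski u" using x by (rule interval_joukowskiE)
  have "\<rho> - 1 \<le> cmod (v - u)" using norm_triangle_ineq2[of v u] u v by simp
  then have "(1 - 1 / \<rho>) / 2 * (\<rho> - 1) \<le> (1 - 1 / \<rho>) / 2 * cmod (v - u)" using \<rho> by (intro mult_left_mono) auto
  also have "\<dots> \<le> cmod (joukowski v - joukowski u)" using joukowski_dist_ge[OF \<rho> v] u by simp
  finally show ?thesis using u by simp
qed

text \<open>The constant in the approximation of the Cauchy kernel below: the reciprocal of the product of a lower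
  bound of \<open>\<rho>\<^sup>-\<^sup>n |T\<^sub>n|\<close> on the ellipse and a lower bound of its distance from \<open>[-1, 1]\<close>.\<close>

definition cauchy_kernel_const :: "real \<Rightarrow> real" where
  "cauchy_kernel_const \<rho> = 1 / ((1 - 1 / \<rho>) / 2 * ((1 - 1 / \<rho>) / 2 * (\<rho> - 1)))"

lemma cauchy_kernel_const_pos: "1 < \<rho> \<Longrightarrow> 0 < cauchy_kernel_const \<rho>"
  by (simp add: cauchy_kernel_const_def)

text \<open>The polynomial \<open>(1 - T\<^sub>m(x) / T\<^sub>m(\<zeta>)) / (\<zeta> - x)\<close> in \<open>x\<close> has degree less than \<open>m\<close> and approximates
  \<open>1 / (\<zeta> - x)\<close> with error \<open>O(\<rho>\<^sup>-\<^sup>m)\<close> on the interval. For \<open>m = 0\<close> it is the zero polynomial, which is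
  the reason for the disjunction.\<close>

lemma cauchy_kernel_approx:
  assumes \<rho>: "1 < \<rho>" and v: "cmod v = \<rho>"
  obtains P :: "complex poly" where "P = 0 \<or> degree P < m"
    "\<And>x. x \<in> {-1..1} \<Longrightarrow> cmod (1 / (joukowski v - of_real x) - poly P (of_real x))
        \<le> cauchy_kernel_const \<rho> / \<rho> ^ m"
proof -
  define \<zeta> where "\<zeta> = joukowski v"
  define T where "T = chebyshev_poly m"
  define t where "t = poly T \<zeta>"
  have d: "0 < (1 - 1 / \<rho>) / 2" using \<rho> by simp
  have t: "(1 - 1 / \<rho>) / 2 * \<rho> ^ m \<le> cmod t"
    unfolding t_def T_def \<zeta>_def by (rule chebyshev_poly_ellipse_bound[OF \<rho> v])
  have "0 < (1 - 1 / \<rho>) / 2 * \<rho> ^ m" using d \<rho> by (intro mult_pos_pos) auto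
  with t have t0: "t \<noteq> 0" by auto
  have "poly (T - [:t:]) \<zeta> = 0" by (simp add: t_def)
  then obtain R where R: "T - [:t:] = [:-\<zeta>, 1:] * R" by (metis dvdE poly_eq_0_iff_dvd)
  define P where "P = smult (1 / t) R"
  have "degree (T - [:t:]) \<le> m" unfolding T_def using degree_chebyshev_poly by (intro degree_diff_le) auto
  moreover have "degree ([:-\<zeta>, 1:] * R) = Suc (degree R)" if "R \<noteq> 0"
    using that by (subst degree_mult_eq) auto
  ultimately have "R = 0 \<or> degree R < m" unfolding R by fastforce
  then have "P = 0 \<or> degree P < m" by (auto simp: P_def t0)
  moreover have "cmod (1 / (\<zeta> - of_real x) - poly P (of_real x))
      \<le> cauchy_kernel_const \<rho> / \<rho> ^ m" if x: "x \<in> {-1..1}" for x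
  proof -
    have D: "(1 - 1 / \<rho>) / 2 * (\<rho> - 1) \<le> cmod (\<zeta> - of_real x)" unfolding \<zeta>_def
        by (rule ellipse_interval_dist_ge[OF \<rho> v x])
    moreover have D0: "0 < (1 - 1 / \<rho>) / 2 * (\<rho> - 1)" using d \<rho> by simp
    ultimately have nz: "\<zeta> - of_real x \<noteq> 0" by auto
    have "poly T (of_real x) - t = (of_real x - \<zeta>) * poly R (of_real x)"
      using arg_cong[OF R, of "\<lambda>p. poly p (of_real x)"] by (simp add: algebra_simps)
    then have e: "poly R (of_real x) = (t - poly T (of_real x)) / (\<zeta> - of_real x)" using nz
        by (simp add: field_simps)
    have "1 / (\<zeta> - of_real x) - poly P (of_real x) = poly T (of_real x) / (t * (\<zeta> - of_real x))"
    proof -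
      have "1 / D - 1 / t * ((t - q) / D) = q / (t * D)" if "D \<noteq> 0" for D q :: complex
        using that t0 by (simp add: field_simps)
      from this[OF nz] show ?thesis unfolding P_def by (simp add: e)
    qed
    then have "cmod (1 / (\<zeta> - of_real x) - poly P (of_real x))
        = cmod (poly T (of_real x)) / (cmod t * cmod (\<zeta> - of_real x))"
      by (simp add: norm_divide norm_mult)
    also have "\<dots> \<le> 1 / (((1 - 1 / \<rho>) / 2 * \<rho> ^ m) * ((1 - 1 / \<rho>) / 2 * (\<rho> - 1)))"
      using t D D0 d \<rho> chebyshev_poly_interval_bound[OF x, of m] unfolding T_def
      by (intro frac_le mult_mono) auto
    also have "\<dots> = cauchy_kernel_const \<rho> / \<rho> ^ m" by (simp add: cauchy_kernel_const_def mult_ac)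
    finally show ?thesis .
  qed
  ultimately show thesis using that[of P] by (simp add: \<zeta>_def)
qed

lemma poly_map_poly_Re: "poly (map_poly Re P) x = Re (poly P (of_real x))"
  and poly_map_poly_Im: "poly (map_poly Im P) x = Im (poly P (of_real x))"
  by (induction P) (simp_all add: map_poly_pCons)

lemma poly_complex_split:
  "poly P (of_real x) = of_real (poly (map_poly Re P) x) + \<i> * of_real (poly (map_poly Im P) x)"
  unfolding poly_map_poly_Re poly_map_poly_Im using complex_eq by simp

text \<open>The orthonormal polynomials as formal polynomials.\<close>

abbreviation geg_normalized_poly :: "real \<Rightarrow> nat \<Rightarrow> real poly" where
  "geg_normalized_poly s j \<equiv> smult (1 / geg_h s j) (geg_poly s j)"

text \<open>The function of the second kind \<open>q\<^sub>j(\<zeta>) = \<integral> p\<^sub>j(x) (1 - x\<^sup>2)\<^sup>s / (\<zeta> - x) dx\<close> that belongs to the orthonormal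
  polynomial \<open>p\<^sub>j\<close>, for \<open>\<zeta>\<close> off the interval.\<close>

definition geg_second :: "real \<Rightarrow> nat \<Rightarrow> complex \<Rightarrow> complex" where
  "geg_second s j \<zeta> = integral {-1..1} (\<lambda>x. of_real (geg_normalized s j x * (1 - x^2) powr s) /
      (\<zeta> - of_real x))"

context
  fixes s :: real
  assumes s: "0 < s"
begin

lemma poly_geg_normalized_poly: "poly (geg_normalized_poly s j) x = geg_normalized s j x"
  by (simp add: geg_normalized_def)

lemma degree_geg_normalized_poly: "degree (geg_normalized_poly s j) \<le> j"
  using degree_gegenbauer_poly[of "s+1/2" j, where 'a = real] degree_smult_le order_trans by blast

lemma weighted_integral_geg_normalized_square: "weighted_integral s
    (geg_normalized_poly s j * geg_normalized_poly s j) = 1"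
proof -
  have "weighted_integral s (geg_normalized_poly s j * geg_normalized_poly s j)
      = 1 / geg_h s j * (1 / geg_h s j * (geg_h s j)^2)"
    unfolding geg_h_squared[OF s] by (simp add: weighted_integral_smult[OF s])
  then show ?thesis using geg_h_pos[OF s, of j] by (simp add: power2_eq_square)
qed

lemma continuous_on_geg_normalized: "continuous_on A (geg_normalized s j :: real \<Rightarrow> real)"
  unfolding poly_geg_normalized_poly[symmetric, abs_def] by (intro continuous_intros)

lemma has_integral_complex_poly_weight:
  "((\<lambda>x. poly P (of_real x) * of_real (poly Q x * (1 - x^2) powr s)) has_integral
     (of_real (weighted_integral s (map_poly Re P * Q))
         + \<i> * of_real (weighted_integral s (map_poly Im P * Q)))) {-1..1}"
proof -
  have "((\<lambda>x. complex_of_real (poly (map_poly Re P * Q) x * (1 - x^2) powr s)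
      + \<i> * complex_of_real (poly (map_poly Im P * Q) x * (1 - x^2) powr s)) has_integral
     (of_real (weighted_integral s (map_poly Re P * Q))
         + \<i> * of_real (weighted_integral s (map_poly Im P * Q)))) {-1..1}"
    by (intro has_integral_add has_integral_mult_right has_integral_of_real has_integral_weighted_integral s)
  then show ?thesis by (rule has_integral_eq[rotated]) (simp add: poly_complex_split[of P] algebra_simps)
qed

lemma geg_normalized_orthogonal:
  fixes P :: "complex poly"
  assumes "P = 0 \<or> degree P < j"
  shows "((\<lambda>x. poly P (of_real x) * of_real (geg_normalized s j x * (1 - x^2) powr s)) has_integral 0) {-1..1}"
proof (cases "P = 0")
  case False
  then have dP: "degree P < j" using assms by simp
  have 0: "weighted_integral s (p * geg_normalized_poly s j) = 0" if "degree p < j" for p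
    using gegenbauer_orthogonal[OF s that] by (simp add: weighted_integral_smult[OF s])
  have "degree (map_poly Re P) < j" "degree (map_poly Im P) < j"
    using dP map_poly_degree_leq[of Re P] map_poly_degree_leq[of Im P] by auto
  from 0[OF this(1)] 0[OF this(2)] show ?thesis
    using has_integral_complex_poly_weight[of P "geg_normalized_poly s j"]
        by (simp only: poly_geg_normalized_poly) simp
qed simp

lemma integral_abs_geg_normalized_le:
  shows "(\<lambda>x. \<bar>geg_normalized s j x\<bar> * (1 - x^2) powr s) integrable_on {-1..1}"
    "integral {-1..1} (\<lambda>x. \<bar>geg_normalized s j x\<bar> * (1 - x^2) powr s) \<le> weighted_integral s 1 + 1"
proof -
  show int: "(\<lambda>x. \<bar>geg_normalized s j x\<bar> * (1 - x^2) powr s) integrable_on {-1..1}"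
    by (intro integrable_continuous_interval continuous_intros continuous_on_geg_normalized continuous_on_weight s)
  have "((\<lambda>x. poly (1 + geg_normalized_poly s j * geg_normalized_poly s j) x * (1 - x^2) powr s)
      has_integral (weighted_integral s 1 + 1)) {-1..1}"
    using has_integral_weighted_integral[OF s, of "1 + geg_normalized_poly s j * geg_normalized_poly s j"]
    by (simp only: weighted_integral_add[OF s] weighted_integral_geg_normalized_square)
  moreover have "\<bar>geg_normalized s j x\<bar> * (1 - x^2) powr s
      \<le> poly (1 + geg_normalized_poly s j * geg_normalized_poly s j) x * (1 - x^2) powr s" for x
  proof (intro mult_right_mono)
    \<comment> \<open>a bound by a polynomial, whose integral is known\<close>
    have "\<bar>y\<bar> \<le> 1 + y * y" for y :: real
    proof -
      have "0 \<le> (\<bar>y\<bar> - 1)^2" by simp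
      then show ?thesis by (simp add: power2_eq_square algebra_simps)
    qed
    then show "\<bar>geg_normalized s j x\<bar> \<le> poly (1 + geg_normalized_poly s j * geg_normalized_poly s j) x"
        by (simp only: poly_add poly_mult poly_geg_normalized_poly poly_1)
  qed simp
  ultimately show "integral {-1..1} (\<lambda>x. \<bar>geg_normalized s j x\<bar> * (1 - x^2) powr s) \<le> weighted_integral s 1 + 1"
    using has_integral_le[OF integrable_integral[OF int]] by blast
qed

lemma integrable_geg_second:
  assumes "\<zeta> \<notin> complex_of_real ` {-1..1}"
  shows "(\<lambda>x. of_real (geg_normalized s j x * (1 - x^2) powr s) / (\<zeta> - of_real x)) integrable_on {-1..1}"
  using assms by (intro integrable_continuous_interval continuous_intros continuous_on_geg_normalized continuous_on_weight s) auto

lemma joukowski_notin_interval: "1 < cmod v \<Longrightarrow> joukowski v \<notin> complex_of_real ` {-1..1}"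
proof
  assume v: "1 < cmod v" and "joukowski v \<in> complex_of_real ` {-1..1}"
  then obtain x where x: "x \<in> {-1..1}" "joukowski v = of_real x" by auto
  have "(1 - 1 / cmod v) / 2 * (cmod v - 1) \<le> 0" using ellipse_interval_dist_ge[OF v refl x(1)] x(2) by simp
  moreover have "0 < (1 - 1 / cmod v) / 2 * (cmod v - 1)"
  proof -
    have "1 / cmod v < 1" using v by (subst divide_less_eq_1_pos) auto
    then show ?thesis using v by (intro mult_pos_pos) auto
  qed
  ultimately show False by linarith
qed

lemma geg_second_approx:
  assumes \<zeta>: "\<zeta> \<notin> complex_of_real ` {-1..1}"
    and B: "\<And>x. x \<in> {-1..1} \<Longrightarrow> cmod (1 / (\<zeta> - of_real x) - poly P (of_real x)) \<le> B"
    and J: "((\<lambda>x. poly P (of_real x) * of_real (geg_normalized s j x * (1 - x^2) powr s))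
        has_integral J) {-1..1}"
  shows "cmod (geg_second s j \<zeta> - J) \<le> B * (weighted_integral s 1 + 1)"
proof -
  define w where "w x = geg_normalized s j x * (1 - x^2) powr s" for x :: real
  have "0 \<le> cmod (1 / (\<zeta> - of_real 0) - poly P (of_real 0))" by simp
  also have "\<dots> \<le> B" by (rule B) simp
  finally have B0: "0 \<le> B" .
  have "((\<lambda>x. of_real (w x) / (\<zeta> - of_real x)) has_integral geg_second s j \<zeta>) {-1..1}"
    unfolding geg_second_def w_def by (intro integrable_integral integrable_geg_second \<zeta>)
  from has_integral_diff[OF this J]
  have int: "((\<lambda>x. (1 / (\<zeta> - of_real x) - poly P (of_real x)) * of_real (w x))
      has_integral (geg_second s j \<zeta> - J)) {-1..1}"
    by (rule has_integral_eq[rotated]) (simp_all add: w_def algebra_simps)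
  have "cmod (geg_second s j \<zeta> - J) = cmod (integral {-1..1}
      (\<lambda>x. (1 / (\<zeta> - of_real x) - poly P (of_real x)) * of_real (w x)))"
    using int by (simp add: integral_unique)
  also have "\<dots> \<le> integral {-1..1} (\<lambda>x. B * (\<bar>geg_normalized s j x\<bar> * (1 - x^2) powr s))"
  proof (rule integral_norm_bound_integral)
    fix x :: real assume x: "x \<in> {-1..1}"
    have "cmod ((1 / (\<zeta> - of_real x) - poly P (of_real x)) * of_real (w x))
      = cmod (1 / (\<zeta> - of_real x) - poly P (of_real x)) * (\<bar>geg_normalized s j x\<bar> * (1 - x^2) powr s)"
      unfolding norm_mult w_def norm_of_real abs_mult by simp
    also have "\<dots> \<le> B * (\<bar>geg_normalized s j x\<bar> * (1 - x^2) powr s)"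
      using B[OF x] by (rule mult_right_mono) simp
    finally show "cmod ((1 / (\<zeta> - of_real x) - poly P (of_real x)) * of_real (w x))
      \<le> B * (\<bar>geg_normalized s j x\<bar> * (1 - x^2) powr s)" .
  next
    show "(\<lambda>x. B * (\<bar>geg_normalized s j x\<bar> * (1 - x^2) powr s)) integrable_on {-1..1}"
      by (intro integrable_on_mult_right integral_abs_geg_normalized_le)
  qed (use int in auto)
  also have "\<dots> = B * integral {-1..1} (\<lambda>x. \<bar>geg_normalized s j x\<bar> * (1 - x^2) powr s)"
    by simp
  also have "\<dots> \<le> B * (weighted_integral s 1 + 1)"
    using integral_abs_geg_normalized_le B0 by (intro mult_left_mono) auto
  finally show ?thesis .
qed

text \<open>By orthogonality a polynomial of degree less than \<open>j\<close> may be subtracted from the Cauchy kernel.\<close>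

lemma geg_second_bound:
  assumes \<rho>: "1 < \<rho>" and v: "cmod v = \<rho>"
  shows "cmod (geg_second s j (joukowski v)) \<le> cauchy_kernel_const \<rho> / \<rho> ^ j * (weighted_integral s 1 + 1)"
proof -
  obtain P where P: "P = 0 \<or> degree P < j"
    "\<And>x. x \<in> {-1..1} \<Longrightarrow> cmod (1 / (joukowski v - of_real x) - poly P (of_real x))
        \<le> cauchy_kernel_const \<rho> / \<rho> ^ j"
    using cauchy_kernel_approx[OF \<rho> v, of j] by blast
  have "joukowski v \<notin> complex_of_real ` {-1..1}" using joukowski_notin_interval \<rho> v by blast
  from geg_second_approx[OF this P(2) geg_normalized_orthogonal[OF P(1)]] show ?thesis by simp
qed

end

section \<open>The Cauchy integral formula over the Bernstein ellipse\<close>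

text \<open>The Bernstein ellipse, parametrized over \<open>[0, 1]\<close> as the image of a circle under the Joukowski map.\<close>

definition bernstein_path :: "real \<Rightarrow> real \<Rightarrow> complex" where
  "bernstein_path \<rho> = joukowski \<circ> circlepath 0 \<rho>"

text \<open>The derivative of the parametrization divided by \<open>2 \<pi> \<i>\<close>, which absorbs the constant of the Cauchy
  integral formula.\<close>

definition bernstein_speed :: "real \<Rightarrow> real \<Rightarrow> complex" where
  "bernstein_speed \<rho> t = (circlepath 0 \<rho> t - 1 / circlepath 0 \<rho> t) / 2"

lemma norm_circlepath: "0 \<le> \<rho> \<Longrightarrow> cmod (circlepath 0 \<rho> t) = \<rho>"
  by (simp add: circlepath norm_mult norm_exp_eq_Re)

lemma joukowski_has_field_derivative:
  assumes "u \<noteq> 0"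
  shows "(joukowski has_field_derivative (1 - 1 / u^2) / 2) (at u within S)"
  unfolding joukowski_def [abs_def] using assms
  by (auto intro!: derivative_eq_intros simp: field_simps power2_eq_square)

lemma holomorphic_on_joukowski: "joukowski holomorphic_on - {0}"
  unfolding joukowski_def[abs_def] by (intro holomorphic_intros) auto

context
  fixes \<rho> :: real
  assumes \<rho>: "1 < \<rho>"
begin

lemma circlepath_neq_0: "circlepath 0 \<rho> t \<noteq> 0"
  using norm_circlepath[of \<rho> t] \<rho> by auto

lemma valid_path_bernstein_path: "valid_path (bernstein_path \<rho>)"
  unfolding bernstein_path_def
  using valid_path_compose_holomorphic[OF valid_path_circlepath holomorphic_on_joukowski, of 0 \<rho>] circlepath_neq_0
  by (force simp: path_image_def)

lemma bernstein_path_closed: "pathfinish (bernstein_path \<rho>) = pathstart (bernstein_path \<rho>)"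
  using pathstart_circlepath[of 0 \<rho>] pathfinish_circlepath[of 0 \<rho>]
  by (simp add: bernstein_path_def pathfinish_def pathstart_def)

lemma bernstein_path_in_region: "bernstein_path \<rho> t \<in> bernstein_region \<rho>"
  using joukowski_in_bernstein_region_iff[of "circlepath 0 \<rho> t" \<rho>] norm_circlepath[of \<rho> t] \<rho>
  by (simp add: bernstein_path_def)

lemma bernstein_path_vector_derivative:
  "(bernstein_path \<rho> has_vector_derivative 2 * of_real pi * \<i> * bernstein_speed \<rho> t) (at t within S)"
proof -
  let ?u = "circlepath 0 \<rho>"
  have e: "?u = (\<lambda>t. of_real \<rho> * exp (2 * of_real pi * \<i> * of_real t))" by (simp add: circlepath fun_eq_iff)
  have "(?u has_vector_derivative 2 * of_real pi * \<i> * ?u t) (at t within S)"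
    unfolding e by (auto intro!: derivative_eq_intros has_vector_derivative_real_field simp: mult_ac)
  from field_vector_diff_chain_within[OF this joukowski_has_field_derivative[OF circlepath_neq_0]]
  have "(joukowski \<circ> ?u has_vector_derivative 2 * of_real pi * \<i> * ?u t * ((1 - 1 / (?u t)^2) / 2))
      (at t within S)" .
  moreover have "2 * of_real pi * \<i> * ?u t * ((1 - 1 / (?u t)^2) / 2)
      = 2 * of_real pi * \<i> * bernstein_speed \<rho> t"
    using circlepath_neq_0[of t] by (simp add: bernstein_speed_def field_simps power2_eq_square)
  ultimately show ?thesis unfolding bernstein_path_def by (simp only:)
qed

lemma interval_notin_bernstein_path:
  assumes "x \<in> {-1..1}"
  shows "of_real x \<notin> path_image (bernstein_path \<rho>)"
proof
  assume "of_real x \<in> path_image (bernstein_path \<rho>)"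
  then obtain t where t: "of_real x = joukowski (circlepath 0 \<rho> t)"
      by (auto simp: path_image_def bernstein_path_def)
  have "-1 \<le> x" "x \<le> 1" using assms by auto
  then have "joukowski (circlepath 0 \<rho> t) \<in> bernstein_region 1"
    unfolding t[symmetric] by (intro interval_subset_bernstein_region) auto
  then show False using joukowski_in_bernstein_region_iff[of "circlepath 0 \<rho> t" 1] norm_circlepath[of \<rho> t] \<rho> by simp
qed

lemma winding_number_bernstein_path:
  assumes x: "x \<in> {-1..1}"
  shows "winding_number (bernstein_path \<rho>) (of_real x) = 1"
proof -
  have x': "-1 \<le> x" "x \<le> 1" using x by auto
  obtain e where e: "cmod e = 1" "of_real x = joukowski e" using x' by (rule interval_joukowskiE)
  have e0: "e \<noteq> 0" using e by auto
  have wind: "((\<lambda>u. 1 / (u - z)) has_contour_integral 2 * pi * \<i>) (circlepath 0 \<rho>)" if "cmod z \<le> 1" for z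
  proof -
    have "((\<lambda>u. 1 / (u - z)) has_contour_integral 2 * pi * \<i> * winding_number (circlepath 0 \<rho>) z)
        (circlepath 0 \<rho>)"
      using that \<rho> by (intro has_contour_integral_winding_number) (auto simp: path_image_circlepath)
    moreover have "winding_number (circlepath 0 \<rho>) z = 1" using that \<rho> by (intro winding_number_circlepath) auto
    ultimately show ?thesis by simp
  qed
  have "((\<lambda>u. - (1 / (u - 0)) + 1 / (u - e) + 1 / (u - 1 / e)) has_contour_integral
      (- (2 * pi * \<i>) + 2 * pi * \<i> + 2 * pi * \<i>)) (circlepath 0 \<rho>)"
    by (intro has_contour_integral_add has_contour_integral_neg wind) (use e in \<open>auto simp: norm_divide\<close>)
  then have c1: "contour_integral (circlepath 0 \<rho>) (\<lambda>u. - (1 / (u - 0)) + 1 / (u - e) + 1 / (u - 1 / e))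
      = 2 * pi * \<i>"
    by (simp add: contour_integral_unique)
  \<comment> \<open>partial fractions of the pulled-back integrand \<open>J'(u) / (J(u) - J(e))\<close>, with poles \<open>0\<close>, \<open>e\<close> and \<open>1 / e\<close>\<close>
  have c2: "contour_integral (circlepath 0 \<rho>) (\<lambda>u. deriv joukowski u * (1 / (joukowski u - of_real x)))
      = contour_integral (circlepath 0 \<rho>) (\<lambda>u. - (1 / (u - 0)) + 1 / (u - e) + 1 / (u - 1 / e))"
  proof (rule contour_integral_cong)
    fix u assume "u \<in> path_image (circlepath 0 \<rho>)"
    then have u: "cmod u = \<rho>" using \<rho> by (simp add: path_image_circlepath)
    then have "u \<noteq> 0" "u \<noteq> e" "u \<noteq> 1 / e" using \<rho> e by (auto simp: norm_divide)
    then have nz: "u \<noteq> 0" "u - e \<noteq> 0" "u * e - 1 \<noteq> 0" using e0 by (auto simp: field_simps)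
    have d: "deriv joukowski u = (1 - 1 / u^2) / 2"
      using joukowski_has_field_derivative[OF nz(1)] by (rule DERIV_imp_deriv)
    have J: "joukowski u - of_real x = (u - e) * (u * e - 1) / (2 * (u * e))"
      unfolding e(2) joukowski_diff[OF e0 nz(1)] using nz e0 by (simp add: field_simps)
    have i: "1 / (u - 1 / e) = e / (u * e - 1)" using e0 nz by (simp add: field_simps)
    show "deriv joukowski u * (1 / (joukowski u - of_real x)) = - (1 / (u - 0)) + 1 / (u - e) + 1 / (u - 1 / e)"
      unfolding d J i using nz e0 by (simp add: divide_simps) (simp add: algebra_simps power2_eq_square)
  qed simp
  have "joukowski analytic_on - {0}"
    using holomorphic_on_joukowski by (subst analytic_on_open) (auto simp: open_Compl)
  then have "contour_integral (bernstein_path \<rho>) (\<lambda>w. 1 / (w - of_real x)) = 2 * pi * \<i>"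
    unfolding bernstein_path_def
    by (subst contour_integral_comp_analyticW[of joukowski "-{0}"])
      (use \<rho> c1 c2 in \<open>auto simp: path_image_circlepath\<close>)
  then show ?thesis
    using winding_number_valid_path[OF valid_path_bernstein_path interval_notin_bernstein_path[OF x]] by simp
qed

lemma interval_in_interior_bernstein_region:
  assumes "x \<in> {-1..1}"
  shows "complex_of_real x \<in> interior (bernstein_region \<rho>)"
proof (rule interiorI)
  let ?U = "{z. cmod (z - 1) + cmod (z + 1) < \<rho> + 1 / \<rho>}"
  show "open ?U" by (intro open_Collect_less continuous_intros)
  show "?U \<subseteq> bernstein_region \<rho>" by (auto simp: bernstein_region_def)
  have "cmod (of_real x - 1) + cmod (of_real x + 1) = \<bar>x - 1\<bar> + \<bar>x + 1\<bar>"
    by (metis of_real_1 of_real_add of_real_diff norm_of_real)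
  moreover have "2 < \<rho> + 1 / \<rho>"
  proof -
    have "0 < (\<rho> - 1)^2 / \<rho>" using \<rho> by simp
    also have "\<dots> = \<rho> + 1 / \<rho> - 2" using \<rho> by (simp add: field_simps power2_eq_square)
    finally show ?thesis by simp
  qed
  ultimately show "complex_of_real x \<in> ?U" using assms by auto
qed

lemma cauchy_integral_bernstein:
  assumes f: "f \<in> A_space \<rho>" and x: "x \<in> {-1..1}"
  shows "((\<lambda>t. f (bernstein_path \<rho> t) * bernstein_speed \<rho> t / (bernstein_path \<rho> t - of_real x))
      has_integral f (of_real x)) {0..1}"
proof -
  have "f holomorphic_on bernstein_region \<rho>" using f analytic_imp_holomorphic by (auto simp: A_space_def)
  from Cauchy_integral_formula_convex_simple[OF convex_bernstein_region this interval_in_interior_bernstein_region[OF x]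
      valid_path_bernstein_path _ bernstein_path_closed]
  have "((\<lambda>w. f w / (w - of_real x)) has_contour_integral 2 * pi * \<i> * f (of_real x)) (bernstein_path \<rho>)"
    using bernstein_path_in_region interval_notin_bernstein_path[OF x] winding_number_bernstein_path[OF x]
    by (auto simp: path_image_def)
  then have "((\<lambda>t. f (bernstein_path \<rho> t) / (bernstein_path \<rho> t - of_real x) * vector_derivative
      (bernstein_path \<rho>) (at t within {0..1}))
      has_integral 2 * pi * \<i> * f (of_real x)) {0..1}"
    by (simp only: has_contour_integral_def)
  then have "((\<lambda>t. 1 / (2 * pi * \<i>) * (f (bernstein_path \<rho> t) / (bernstein_path \<rho> t - of_real x)
      * vector_derivative (bernstein_path \<rho>) (at t within {0..1})))
      has_integral 1 / (2 * pi * \<i>) * (2 * pi * \<i> * f (of_real x))) {0..1}"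
    by (rule has_integral_mult_right)
  then show ?thesis
  proof (rule has_integral_eq_rhs[OF has_integral_eq[rotated]])
    fix t :: real assume "t \<in> {0..1}"
    then have "vector_derivative (bernstein_path \<rho>) (at t within {0..1})
        = 2 * of_real pi * \<i> * bernstein_speed \<rho> t"
      using bernstein_path_vector_derivative by (intro vector_derivative_within_cbox[of 0 1, simplified]) auto
    moreover have "1 / c * (F / D * (c * S)) = F * S / D" if "c \<noteq> 0" for c F D S :: complex
      using that by simp
    moreover have "2 * complex_of_real pi * \<i> \<noteq> 0" by simp
    moreover have "complex_of_real (2 * pi) = 2 * complex_of_real pi" by simp
    ultimately show "1 / (2 * pi * \<i>) * (f (bernstein_path \<rho> t) / (bernstein_path \<rho> t - of_real x)
        * vector_derivative (bernstein_path \<rho>) (at t within {0..1}))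
        = f (bernstein_path \<rho> t) * bernstein_speed \<rho> t / (bernstein_path \<rho> t - of_real x)" by (simp only:)
  qed simp
qed

lemma continuous_on_bernstein_path: "continuous_on A (bernstein_path \<rho>)"
  unfolding bernstein_path_def joukowski_def comp_def circlepath
  using circlepath_neq_0 by (intro continuous_intros) (auto simp: circlepath)

lemma continuous_on_bernstein_speed: "continuous_on A (bernstein_speed \<rho>)"
  unfolding bernstein_speed_def circlepath
  using circlepath_neq_0 by (intro continuous_intros) (auto simp: circlepath)

lemma norm_bernstein_speed_le: "cmod (bernstein_speed \<rho> t) \<le> \<rho>"
proof -
  have "cmod (circlepath 0 \<rho> t - 1 / circlepath 0 \<rho> t) \<le> cmod (circlepath 0 \<rho> t) + cmod (1 / circlepath 0 \<rho> t)"
    by (rule norm_triangle_ineq4)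
  also have "\<dots> \<le> \<rho> + \<rho>" using \<rho> norm_circlepath[of \<rho> t] less_trans[of "1/\<rho>" 1 \<rho>] by (simp add: norm_divide)
  finally show ?thesis by (simp add: bernstein_speed_def norm_divide)
qed

lemma continuous_on_bernstein_density:
  assumes f: "f \<in> A_space \<rho>"
  shows "continuous_on A (\<lambda>t. f (bernstein_path \<rho> t) * bernstein_speed \<rho> t)"
proof -
  have "continuous_on (bernstein_region \<rho>) f"
    using f analytic_imp_holomorphic holomorphic_on_imp_continuous_on by (auto simp: A_space_def)
  then have "continuous_on A (\<lambda>t. f (bernstein_path \<rho> t))"
    by (rule continuous_on_compose2[OF _ continuous_on_bernstein_path]) (use bernstein_path_in_region in auto)
  then show ?thesis by (intro continuous_intros continuous_on_bernstein_speed)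
qed

lemma norm_bernstein_density_le:
  assumes f: "f \<in> A_space \<rho>"
  shows "cmod (f (bernstein_path \<rho> t) * bernstein_speed \<rho> t) \<le> \<rho> * A_norm \<rho> f"
  unfolding norm_mult mult.commute[of \<rho>] using norm_le_A_norm[OF f bernstein_path_in_region[of t]] norm_bernstein_speed_le
    A_norm_nonneg[OF f] \<rho> by (intro mult_mono) auto

end

section \<open>Exact and numerical coefficients as boundary integrals\<close>

context
  fixes s \<rho> :: real
  assumes s: "0 < s" and \<rho>: "1 < \<rho>"
begin

lemma bernstein_path_neq_interval: "x \<in> {-1..1} \<Longrightarrow> bernstein_path \<rho> t \<noteq> of_real x"
  using joukowski_notin_interval[OF s, of "circlepath 0 \<rho> t"] norm_circlepath[of \<rho> t] \<rho>
  by (auto simp: bernstein_path_def)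

lemma continuous_on_cauchy_kernel:
  "continuous_on ({0..1} \<times> {-1..1})
    (\<lambda>(t, x). of_real (geg_normalized s j x * (1 - x^2) powr s) / (bernstein_path \<rho> t - of_real x))"
proof -
  have "continuous_on ({0..1::real} \<times> {-1..1::real}) (\<lambda>p. geg_normalized s j (snd p) * (1 - (snd p)^2) powr s)"
    by (rule continuous_on_compose2[where f = snd and g = "\<lambda>x. geg_normalized s j x * (1 - x^2) powr s" and t
        = "{-1..1}"])
      (auto intro!: continuous_intros continuous_on_geg_normalized continuous_on_weight s)
  moreover have "continuous_on ({0..1::real} \<times> {-1..1::real}) (\<lambda>p. bernstein_path \<rho> (fst p))"
    by (rule continuous_on_compose2[OF continuous_on_bernstein_path[OF \<rho>, of UNIV]])
        (auto intro!: continuous_intros)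
  ultimately show ?thesis unfolding split_beta
    by (intro continuous_on_divide continuous_on_of_real continuous_on_diff continuous_on_snd continuous_on_id)
      (use bernstein_path_neq_interval in auto)
qed

lemma continuous_on_geg_second_path: "continuous_on {0..1} (\<lambda>t. geg_second s j (bernstein_path \<rho> t))"
  unfolding geg_second_def
  using integral_continuous_on_param[of "{0..1}" "-1" 1 "\<lambda>t x. of_real
      (geg_normalized s j x * (1 - x^2) powr s) / (bernstein_path \<rho> t - of_real x)"]
    continuous_on_cauchy_kernel by simp

text \<open>The coefficient \<open>f\<^sub>j\<close> as an integral of the boundary values of \<open>f\<close> against \<open>q\<^sub>j\<close>: the Cauchy formula is
  inserted into the integral over the interval and the two integrations are interchanged.\<close>

lemma has_integral_geg_coeff:
  assumes f: "f \<in> A_space \<rho>"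
  shows "((\<lambda>t. f (bernstein_path \<rho> t) * bernstein_speed \<rho> t * geg_second s j (bernstein_path \<rho> t))
      has_integral geg_coeff s f j) {0..1}"
proof -
  define F where "F t = f (bernstein_path \<rho> t) * bernstein_speed \<rho> t" for t
  define w where "w x = complex_of_real (geg_normalized s j x * (1 - x^2) powr s)" for x :: real
  define k where "k t x = F t * (w x / (bernstein_path \<rho> t - of_real x))" for t x
  have cF: "continuous_on A F" for A unfolding F_def by (rule continuous_on_bernstein_density[OF \<rho> f])
  have "continuous_on ({0..1} \<times> {-1..1}) (\<lambda>p. F (fst p))"
    by (rule continuous_on_compose2[OF cF[of UNIV]]) (auto intro!: continuous_intros)
  then have "continuous_on (cbox (0, -1) (1, 1)) (\<lambda>(t, x). k t x)"
    using continuous_on_cauchy_kernel[of j] unfolding k_def w_def cbox_Pair_eq split_beta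
    by (simp only: cbox_interval) (intro continuous_on_mult)
  from integral_swap_continuous[OF this]
  have "integral {0..1} (\<lambda>t. integral {-1..1} (k t)) = integral {-1..1} (\<lambda>x. integral {0..1} (\<lambda>t. k t x))"
      by simp
  moreover have "integral {0..1} (\<lambda>t. k t x) = f (of_real x) * w x" if x: "x \<in> {-1..1}" for x
  proof -
    have "((\<lambda>t. F t / (bernstein_path \<rho> t - of_real x) * w x) has_integral f (of_real x) * w x) {0..1}"
      unfolding F_def by (rule has_integral_mult_left[OF cauchy_integral_bernstein[OF \<rho> f x]])
    then show ?thesis unfolding k_def by (simp add: integral_unique)
  qed
  then have "integral {-1..1} (\<lambda>x. integral {0..1} (\<lambda>t. k t x)) = geg_coeff s f j"
    unfolding geg_coeff_def w_def by (intro integral_cong) auto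
  moreover have "integral {-1..1} (k t) = F t * geg_second s j (bernstein_path \<rho> t)" for t
    unfolding k_def w_def geg_second_def by (rule integral_mult_right)
  ultimately have "integral {0..1} (\<lambda>t. F t * geg_second s j (bernstein_path \<rho> t)) = geg_coeff s f j" by simp
  moreover have "(\<lambda>t. F t * geg_second s j (bernstein_path \<rho> t)) integrable_on {0..1}"
    by (intro integrable_continuous_interval continuous_intros cF continuous_on_geg_second_path)
  ultimately show ?thesis unfolding F_def by (metis integrable_integral)
qed

lemma bernstein_density_integral_bound:
  assumes f: "f \<in> A_space \<rho>"
    and I: "((\<lambda>t. f (bernstein_path \<rho> t) * bernstein_speed \<rho> t * k t) has_integral I) {0..1}"
    and k: "\<And>t. t \<in> {0..1} \<Longrightarrow> cmod (k t) \<le> B"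
  shows "cmod I \<le> \<rho> * A_norm \<rho> f * B"
proof -
  have A: "0 \<le> \<rho> * A_norm \<rho> f" using A_norm_nonneg[OF f] \<rho> by simp
  have B: "0 \<le> B" using k[of 0] norm_ge_zero[of "k 0"]
      by (metis atLeastAtMost_iff order_refl order_trans zero_le_one)
  have "cmod I \<le> \<rho> * A_norm \<rho> f * B * measure lborel (cbox 0 (1::real))"
  proof (rule has_integral_bound)
    show "((\<lambda>t. f (bernstein_path \<rho> t) * bernstein_speed \<rho> t * k t) has_integral I) (cbox 0 1)" using I by simp
    show "cmod (f (bernstein_path \<rho> t) * bernstein_speed \<rho> t * k t)
        \<le> \<rho> * A_norm \<rho> f * B" if "t \<in> cbox 0 1" for t
      unfolding norm_mult[of "_ * _"]
      using that by (intro mult_mono norm_bernstein_density_le \<rho> f k A) auto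
  qed (use A B in simp)
  then show ?thesis by simp
qed

lemma geg_second_path_bound:
  "cmod (geg_second s j (bernstein_path \<rho> t)) \<le> cauchy_kernel_const \<rho> / \<rho> ^ j * (weighted_integral s 1 + 1)"
  unfolding bernstein_path_def comp_def using \<rho> norm_circlepath by (intro geg_second_bound s) auto

lemma geg_coeff_bound:
  assumes f: "f \<in> A_space \<rho>"
  shows "cmod (geg_coeff s f j) \<le> \<rho> * A_norm \<rho> f *
      (cauchy_kernel_const \<rho> / \<rho> ^ j * (weighted_integral s 1 + 1))"
  using has_integral_geg_coeff[OF f] geg_second_path_bound by (rule bernstein_density_integral_bound[OF f])

end

context
  fixes s :: real and n :: nat and x w :: "nat \<Rightarrow> real"
  assumes s: "0 < s" and rule: "gauss_jacobi_rule s n x w"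
begin

lemma gauss_node: "i \<le> n \<Longrightarrow> x i \<in> {-1..1}"
  using rule by (fastforce simp: gauss_jacobi_rule_def)

lemma gauss_exact: "degree p \<le> 2 * n + 1 \<Longrightarrow> weighted_integral s p = (\<Sum>i\<le>n. poly p (x i) * w i)"
  using rule unfolding gauss_jacobi_rule_def weighted_integral_def by (auto intro: integral_unique)

text \<open>A Gauss rule integrates the square of a Lagrange polynomial exactly.\<close>

lemma gauss_weight_nonneg:
  assumes i: "i \<le> n"
  shows "0 \<le> w i"
proof -
  define l where "l = (\<Prod>k\<in>{..n} - {i}. [:- x k, 1:])"
  have inj: "inj_on x {..n}" using rule by (simp add: gauss_jacobi_rule_def)
  have pl: "poly l y = (\<Prod>k\<in>{..n} - {i}. y - x k)" for y by (simp add: l_def poly_prod)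
  have "degree l \<le> (\<Sum>k\<in>{..n} - {i}. 1)"
    unfolding l_def by (rule order_trans[OF degree_prod_sum_le]) (auto intro!: sum_mono)
  also have "\<dots> = n" using i by simp
  finally have "degree (l * l) \<le> 2 * n + 1" using degree_mult_le[of l l] by simp
  then have "weighted_integral s (l * l) = (\<Sum>k\<le>n. poly (l * l) (x k) * w k)" by (rule gauss_exact)
  also have "\<dots> = (\<Sum>k\<in>{i}. poly (l * l) (x k) * w k)"
    using i by (intro sum.mono_neutral_right) (auto simp: pl)
  finally have e: "weighted_integral s (l * l) = (poly l (x i))^2 * w i" by (simp add: power2_eq_square)
  have nz: "poly l (x i) \<noteq> 0" using i inj by (auto simp: pl inj_on_def)
  then have "l \<noteq> 0" by auto
  then have "0 < weighted_integral s (l * l)" by (intro weighted_integral_pos s) auto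
  then show ?thesis unfolding e by (simp add: zero_less_mult_iff not_less)
qed

text \<open>For \<open>j \<le> n\<close> the square of \<open>p\<^sub>j\<close> is integrated exactly by the rule.\<close>

lemma gauss_sum_abs_geg_normalized_le:
  assumes j: "j \<le> n"
  shows "(\<Sum>i\<le>n. \<bar>geg_normalized s j (x i)\<bar> * w i) \<le> weighted_integral s 1 + 1"
proof -
  have le: "\<bar>y\<bar> \<le> 1 + y * y" for y :: real
  proof -
    have "0 \<le> (\<bar>y\<bar> - 1)^2" by simp
    then show ?thesis by (simp add: power2_eq_square algebra_simps)
  qed
  have deg: "degree (geg_normalized_poly s j * geg_normalized_poly s j) \<le> 2 * n + 1"
    using degree_mult_le[of "geg_normalized_poly s j" "geg_normalized_poly s j"] degree_geg_normalized_poly[OF s, of j] j by linarith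
  have "(\<Sum>i\<le>n. \<bar>geg_normalized s j (x i)\<bar> * w i)
      \<le> (\<Sum>i\<le>n. poly (1 + geg_normalized_poly s j * geg_normalized_poly s j) (x i) * w i)"
  proof (intro sum_mono mult_right_mono)
    fix i assume "i \<in> {..n}"
    then show "0 \<le> w i" by (intro gauss_weight_nonneg) simp
    show "\<bar>geg_normalized s j (x i)\<bar> \<le> poly (1 + geg_normalized_poly s j * geg_normalized_poly s j) (x i)"
      by (simp only: poly_add poly_mult poly_geg_normalized_poly[OF s] poly_1 le)
  qed
  also have "\<dots> = weighted_integral s (1 + geg_normalized_poly s j * geg_normalized_poly s j)"
    using deg by (intro gauss_exact[symmetric] degree_add_le) auto
  also have "\<dots> = weighted_integral s 1 + 1"
    by (simp only: weighted_integral_add[OF s] weighted_integral_geg_normalized_square[OF s])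
  finally show ?thesis .
qed

lemma gauss_exact_complex:
  fixes P :: "complex poly"
  assumes "degree P + j \<le> 2 * n + 1"
  shows "((\<lambda>y. poly P (of_real y) * of_real (geg_normalized s j y * (1 - y^2) powr s)) has_integral
    (\<Sum>i\<le>n. poly P (of_real (x i)) * of_real (geg_normalized s j (x i) * w i))) {-1..1}"
proof -
  have d: "degree (map_poly Re P * geg_normalized_poly s j)
      \<le> 2 * n + 1" "degree (map_poly Im P * geg_normalized_poly s j) \<le> 2 * n + 1"
    using degree_mult_le[of "map_poly Re P" "geg_normalized_poly s j"] degree_mult_le[of "map_poly Im P" "geg_normalized_poly s j"]
      map_poly_degree_leq[of Re P] map_poly_degree_leq[of Im P] degree_geg_normalized_poly[OF s, of j] assms
          by simp_all
  have "of_real (weighted_integral s (map_poly Re P * geg_normalized_poly s j))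
      + \<i> * of_real (weighted_integral s (map_poly Im P * geg_normalized_poly s j))
     = (\<Sum>i\<le>n. poly P (of_real (x i)) * of_real (geg_normalized s j (x i) * w i))"
    unfolding gauss_exact[OF d(1)] gauss_exact[OF d(2)] of_real_sum sum_distrib_left sum.distrib[symmetric]
    by (intro sum.cong) (simp_all only: poly_complex_split[of P] poly_mult
        poly_geg_normalized_poly[OF s] of_real_mult, simp add: algebra_simps)
  then show ?thesis using has_integral_complex_poly_weight[OF s, of P "geg_normalized_poly s j"]
      by (simp only: poly_geg_normalized_poly[OF s])
qed

text \<open>The quadrature error for \<open>p\<^sub>j(x) / (\<zeta> - x)\<close>: the rule is exact for \<open>p\<^sub>j\<close> times a polynomial of degree at
  most \<open>2 n + 1 - j\<close>, so that the kernel may be replaced by its approximation error of order \<open>2 n + 2 - j\<close>.\<close>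

lemma quadrature_second_kind_bound:
  assumes \<rho>: "1 < \<rho>" and v: "cmod v = \<rho>" and j: "j \<le> n"
  shows "cmod ((\<Sum>i\<le>n. of_real (geg_normalized s j (x i) * w i) / (joukowski v - of_real (x i)))
      - geg_second s j (joukowski v))
    \<le> 2 * (cauchy_kernel_const \<rho> / \<rho> ^ (2 * n + 2 - j) * (weighted_integral s 1 + 1))"
proof -
  define B where "B = cauchy_kernel_const \<rho> / \<rho> ^ (2 * n + 2 - j)"
  define \<zeta> where "\<zeta> = joukowski v"
  obtain P where P: "P = 0 \<or> degree P < 2 * n + 2 - j"
    "\<And>y. y \<in> {-1..1} \<Longrightarrow> cmod (1 / (\<zeta> - of_real y) - poly P (of_real y)) \<le> B"
    unfolding B_def \<zeta>_def using cauchy_kernel_approx[OF \<rho> v, of "2 * n + 2 - j"] by blast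
  have "degree P + j \<le> 2 * n + 1" using P(1) j by auto
  note J = gauss_exact_complex[OF this]
  define J where "J = (\<Sum>i\<le>n. poly P (of_real (x i)) * of_real (geg_normalized s j (x i) * w i))"
  have "\<zeta> \<notin> complex_of_real ` {-1..1}" using joukowski_notin_interval[OF s] \<rho> v unfolding \<zeta>_def by blast
  from geg_second_approx[OF s this P(2) J[folded J_def]]
  have 1: "cmod (geg_second s j \<zeta> - J) \<le> B * (weighted_integral s 1 + 1)" by simp
  have B0: "0 \<le> B" using cauchy_kernel_const_pos[OF \<rho>] \<rho> by (simp add: B_def)
  have "(\<Sum>i\<le>n. of_real (geg_normalized s j (x i) * w i) / (\<zeta> - of_real (x i))) - J
      = (\<Sum>i\<le>n. (1 / (\<zeta> - of_real (x i)) - poly P (of_real (x i))) * of_real (geg_normalized s j (x i) * w i))"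
    unfolding J_def sum_subtractf[symmetric] by (intro sum.cong) (simp_all add: algebra_simps)
  also have "cmod \<dots> \<le> (\<Sum>i\<le>n. B * (\<bar>geg_normalized s j (x i)\<bar> * w i))"
  proof (intro sum_norm_le)
    fix i assume i: "i \<in> {..n}"
    have "cmod ((1 / (\<zeta> - of_real (x i)) - poly P (of_real (x i))) * of_real (geg_normalized s j (x i) * w i))
        = cmod (1 / (\<zeta> - of_real (x i)) - poly P (of_real (x i))) * (\<bar>geg_normalized s j (x i)\<bar> * w i)"
      unfolding norm_mult norm_of_real abs_mult using gauss_weight_nonneg[of i] i by simp
    also have "\<dots> \<le> B * (\<bar>geg_normalized s j (x i)\<bar> * w i)"
      using P(2)[OF gauss_node] gauss_weight_nonneg[of i] i by (intro mult_right_mono) auto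
    finally show "cmod ((1 / (\<zeta> - of_real (x i)) - poly P (of_real (x i))) * of_real
        (geg_normalized s j (x i) * w i))
        \<le> B * (\<bar>geg_normalized s j (x i)\<bar> * w i)" .
  qed
  also have "\<dots> = B * (\<Sum>i\<le>n. \<bar>geg_normalized s j (x i)\<bar> * w i)" by (simp add: sum_distrib_left)
  also have "\<dots> \<le> B * (weighted_integral s 1 + 1)"
    using gauss_sum_abs_geg_normalized_le[OF j] B0 by (intro mult_left_mono) auto
  finally have 2: "cmod ((\<Sum>i\<le>n. of_real (geg_normalized s j (x i) * w i) / (\<zeta> - of_real (x i))) - J)
      \<le> B * (weighted_integral s 1 + 1)" .
  have "cmod ((\<Sum>i\<le>n. of_real (geg_normalized s j (x i) * w i) / (\<zeta> - of_real (x i))) - geg_second s j \<zeta>)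
      \<le> cmod ((\<Sum>i\<le>n. of_real (geg_normalized s j (x i) * w i) / (\<zeta> - of_real (x i))) - J)
          + cmod (J - geg_second s j \<zeta>)"
    using norm_triangle_ineq[of "(\<Sum>i\<le>n. of_real (geg_normalized s j (x i) * w i) / (\<zeta> - of_real (x i)))
        - J" "J - geg_second s j \<zeta>"] by simp
  also have "\<dots> \<le> 2 * (B * (weighted_integral s 1 + 1))" using 1 2 by (simp add: norm_minus_commute)
  finally show ?thesis unfolding B_def \<zeta>_def .
qed

lemma geg_coeff_num_eq:
  "geg_coeff_num s n x w f j = (\<Sum>i\<le>n. f (of_real (x i)) * of_real (geg_normalized s j (x i) * w i))"
  unfolding geg_coeff_num_def sum_distrib_left by (intro sum.cong) (simp_all add: geg_normalized_def)

lemma quadrature_coeff_error: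
  assumes \<rho>: "1 < \<rho>" and f: "f \<in> A_space \<rho>" and j: "j \<le> n"
  shows "cmod (geg_coeff_num s n x w f j - geg_coeff s f j)
    \<le> \<rho> * A_norm \<rho> f * (2 * (cauchy_kernel_const \<rho> / \<rho> ^ (2 * n + 2 - j) * (weighted_integral s 1 + 1)))"
proof (rule bernstein_density_integral_bound[OF s \<rho> f])
  define F where "F t = f (bernstein_path \<rho> t) * bernstein_speed \<rho> t" for t
  let ?k = "\<lambda>t. (\<Sum>i\<le>n. of_real (geg_normalized s j (x i) * w i) / (bernstein_path \<rho> t - of_real (x i)))
      - geg_second s j (bernstein_path \<rho> t)"
  have "((\<lambda>t. \<Sum>i\<le>n. F t / (bernstein_path \<rho> t - of_real (x i)) * of_real (geg_normalized s j (x i) * w i))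
      has_integral geg_coeff_num s n x w f j) {0..1}"
    unfolding geg_coeff_num_eq F_def
    by (intro has_integral_sum has_integral_mult_left cauchy_integral_bernstein \<rho> f gauss_node) auto
  from has_integral_diff[OF this has_integral_geg_coeff[OF s \<rho> f, of j]]
  have "((\<lambda>t. F t * ?k t) has_integral (geg_coeff_num s n x w f j - geg_coeff s f j)) {0..1}"
    by (rule has_integral_eq[rotated]) (simp add: F_def right_diff_distrib sum_distrib_left)
  then show "((\<lambda>t. f (bernstein_path \<rho> t) * bernstein_speed \<rho> t * ?k t)
      has_integral (geg_coeff_num s n x w f j - geg_coeff s f j)) {0..1}"
    by (simp only: F_def)
  show "cmod (?k t) \<le> 2 * (cauchy_kernel_const \<rho> / \<rho> ^ (2 * n + 2 - j) * (weighted_integral s 1 + 1))" for t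
    unfolding bernstein_path_def comp_def by (rule quadrature_second_kind_bound)
        (use \<rho> j norm_circlepath in auto)
qed

end

section \<open>Eigenvalues, summation by parts and the Christoffel--Darboux formula\<close>

lemma geg_eigenvalue_pos: "0 < s \<Longrightarrow> 0 < geg_eigenvalue s j"
  unfolding geg_eigenvalue_def by (intro divide_pos_pos Gamma_real_pos) auto

lemma geg_eigenvalue_Suc:
  assumes "0 < s"
  shows "geg_eigenvalue s (Suc j) = (1 + 2 * s / (real j + 1)) * geg_eigenvalue s j"
proof -
  have "Gamma (2 * s + real j + 1 + 1) = (2 * s + real j + 1) * Gamma (2 * s + real j + 1)"
    using assms by (intro Gamma_plus1) (auto simp: nonpos_Ints_def)
  then have "geg_eigenvalue s (Suc j) = (2 * s + real j + 1) * Gamma (2 * s + real j + 1) /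
      ((real j + 1) * fact j)"
    by (simp add: geg_eigenvalue_def add_ac)
  moreover have "(2 * s + real j + 1) * G / ((real j + 1) * f)
      = (1 + 2 * s / (real j + 1)) * (G / f)" for G f :: real
  proof -
    have "1 + 2 * s / (real j + 1) = (2 * s + real j + 1) / (real j + 1)"
        by (simp add: add_divide_distrib add_ac) (simp add: field_simps)
    then show ?thesis by simp
  qed
  ultimately show ?thesis by (simp only: geg_eigenvalue_def)
qed

lemma geg_eigenvalue_mono: "0 < s \<Longrightarrow> geg_eigenvalue s j \<le> geg_eigenvalue s (Suc j)"
  using geg_eigenvalue_pos[of s j] by (simp add: geg_eigenvalue_Suc mult_le_cancel_right1)

text \<open>The true rate of growth is \<open>j\<^sup>2\<^sup>s\<close>. The exponent \<open>s < 1\<close> is enough for the sequel and follows from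
  Bernoulli's inequality, which fails for \<open>2 s > 1\<close>.\<close>

lemma geg_eigenvalue_lower:
  assumes s: "0 < s" "s < 1"
  shows "geg_eigenvalue s 0 * (real j + 1) powr s \<le> geg_eigenvalue s j"
proof (induction j)
  case (Suc j)
  have "(1 + 1 / (real j + 1)) powr s * 1 powr (1 - s) \<le> s * (1 + 1 / (real j + 1)) + (1 - s) * 1"
    using s by (intro Youngs_inequality_0) (auto intro: add_pos_nonneg)
  also have "\<dots> = 1 + s / (real j + 1)" by (simp add: algebra_simps)
  also have "\<dots> \<le> 1 + 2 * s / (real j + 1)" using s by (simp add: divide_right_mono)
  finally have b: "(1 + 1 / (real j + 1)) powr s \<le> 1 + 2 * s / (real j + 1)" by simp
  have "real (Suc j) + 1 = (real j + 1) * (1 + 1 / (real j + 1))" by (simp add: field_simps)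
  then have "(real (Suc j) + 1) powr s = (real j + 1) powr s * (1 + 1 / (real j + 1)) powr s"
    by (simp only:) (rule powr_mult)
  then have "geg_eigenvalue s 0 * (real (Suc j) + 1) powr s
      = (geg_eigenvalue s 0 * (real j + 1) powr s) * (1 + 1 / (real j + 1)) powr s" by simp
  also have "\<dots> \<le> geg_eigenvalue s j * (1 + 2 * s / (real j + 1))"
    using Suc b geg_eigenvalue_pos[OF s(1)] by (intro mult_mono) (auto simp: less_imp_le)
  finally show ?case by (simp add: geg_eigenvalue_Suc[OF s(1)] mult.commute)
qed simp

text \<open>Summation by parts for a decreasing multiplier \<open>m\<close> of size \<open>j\<^sup>-\<^sup>2\<^sup>\<epsilon>\<close> and partial sums that grow like \<open>j\<^sup>\<epsilon>\<close>.\<close>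

lemma abel_multiplier_bound:
  fixes c :: "nat \<Rightarrow> complex" and m :: "nat \<Rightarrow> real"
  assumes m_pos: "\<And>j. 0 < m j" and m_dec: "\<And>j. m (Suc j) \<le> m j"
    and m_le: "\<And>j. m j * (real j + 1) powr (2 * \<epsilon>) \<le> B^2" and B: "0 \<le> B"
    and c: "\<And>N. cmod (\<Sum>j\<in>{n<..N}. c j) \<le> E * (real N + 1) powr \<epsilon>" and E: "0 \<le> E"
  shows "cmod (\<Sum>j\<in>{n<..N}. of_real (m j) * c j) \<le> 3 * E * B * sqrt (m (Suc n))"
proof (cases "n < N")
  case False
  then show ?thesis using E B m_pos[of "Suc n"] by (simp add: less_imp_le)
next
  case True
  define A where "A N = (\<Sum>j\<in>{n<..N}. c j)" for N
  have growth: "sqrt (m j) * (real j + 1) powr \<epsilon> \<le> B" for j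
  proof -
    have "(sqrt (m j) * (real j + 1) powr \<epsilon>)^2 = m j * (real j + 1) powr (2 * \<epsilon>)"
    proof -
      have "((real j + 1) powr \<epsilon>)^2 = (real j + 1) powr (2 * \<epsilon>)"
        unfolding power2_eq_square mult_2 by (rule powr_add[symmetric])
      then show ?thesis using m_pos[of j] by (simp add: power_mult_distrib)
    qed
    then have "(sqrt (m j) * (real j + 1) powr \<epsilon>)^2 \<le> B^2" using m_le[of j] by (simp only:)
    then show ?thesis using B by (rule power2_le_imp_le)
  qed
  have ins: "{n<..Suc N} = insert (Suc N) {n<..N}" if "n \<le> N" for N using that by auto
  have abel: "(\<Sum>j\<in>{n<..N}. of_real (m j) * c j)
      = (\<Sum>j\<in>{n<..N}. of_real (m j - m (Suc j)) * A j) + of_real (m (Suc N)) * A N" if "n \<le> N" for N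
    using that
  proof (induction N rule: dec_induct)
    case base
    show ?case by (simp add: A_def)
  next
    case (step N)
    have "A (Suc N) = c (Suc N) + A N" unfolding A_def using step by (simp add: ins)
    then show ?case using step by (simp add: ins algebra_simps)
  qed
  have sqrt_dec: "sqrt (m (Suc j)) \<le> sqrt (m j)" for j using m_dec by simp
  have term_le: "cmod (of_real (m j - m (Suc j)) * A j) \<le> 2 * E * B * (sqrt (m j) - sqrt (m (Suc j)))" for j
  proof -
    \<comment> \<open>One factor \<open>sqrt (m j)\<close> compensates the growth of \<open>A j\<close>; what remains telescopes.\<close>
    have "m j - m (Suc j) = (sqrt (m j) - sqrt (m (Suc j))) * (sqrt (m j) + sqrt (m (Suc j)))"
      using m_pos[of j] m_pos[of "Suc j"] by (simp add: algebra_simps)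
    also have "\<dots> \<le> (sqrt (m j) - sqrt (m (Suc j))) * (2 * sqrt (m j))"
      using sqrt_dec[of j] by (intro mult_left_mono) auto
    finally have d: "m j - m (Suc j) \<le> (sqrt (m j) - sqrt (m (Suc j))) * (2 * sqrt (m j))" .
    have "cmod (of_real (m j - m (Suc j)) * A j) = (m j - m (Suc j)) * cmod (A j)"
      unfolding norm_mult norm_of_real using m_dec[of j] by simp
    also have "\<dots> \<le> ((sqrt (m j) - sqrt (m (Suc j))) * (2 * sqrt (m j))) * (E * (real j + 1) powr \<epsilon>)"
      using d c[of j] m_dec[of j] sqrt_dec[of j] m_pos[of j] unfolding A_def[symmetric]
      by (intro mult_mono mult_nonneg_nonneg) (auto simp: less_imp_le)
    also have "\<dots> = (2 * E * (sqrt (m j) - sqrt (m (Suc j)))) * (sqrt (m j) * (real j + 1) powr \<epsilon>)"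
        by (simp add: mult_ac)
    also have "\<dots> \<le> (2 * E * (sqrt (m j) - sqrt (m (Suc j)))) * B"
      using growth[of j] sqrt_dec[of j] E by (intro mult_left_mono) auto
    finally show ?thesis by (simp only: mult_ac)
  qed
  have tele: "(\<Sum>j\<in>{n<..N}. sqrt (m j) - sqrt (m (Suc j))) = sqrt (m (Suc n)) - sqrt (m (Suc N))" if "n
      \<le> N" for N
    using that by (induction N rule: dec_induct) (simp_all add: ins)
  have last: "cmod (of_real (m (Suc N)) * A N) \<le> E * B * sqrt (m (Suc n))"
  proof -
    have mono: "m N \<le> m (Suc n)" using lift_Suc_antimono_le[of m "Suc n" N, OF m_dec] True by simp
    have "cmod (of_real (m (Suc N)) * A N) \<le> m N * (E * (real N + 1) powr \<epsilon>)"
      unfolding norm_mult norm_of_real using m_dec[of N] m_pos[of N] m_pos[of "Suc N"] c[of N] unfolding A_def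
      by (intro mult_mono) auto
    also have "\<dots> = E * (sqrt (m N) * (sqrt (m N) * (real N + 1) powr \<epsilon>))" using m_pos[of N] by simp
    also have "\<dots> \<le> E * (sqrt (m (Suc n)) * B)"
      using growth[of N] mono m_pos[of N] E B by (intro mult_left_mono mult_mono) (auto simp: less_imp_le)
    finally show ?thesis by (simp only: mult_ac)
  qed
  have "cmod (\<Sum>j\<in>{n<..N}. of_real (m j) * c j)
      \<le> cmod (\<Sum>j\<in>{n<..N}. of_real (m j - m (Suc j)) * A j) + cmod (of_real (m (Suc N)) * A N)"
    unfolding abel[OF less_imp_le[OF True]] by (rule norm_triangle_ineq)
  also have "cmod (\<Sum>j\<in>{n<..N}. of_real (m j - m (Suc j)) * A j)
      \<le> (\<Sum>j\<in>{n<..N}. 2 * E * B * (sqrt (m j) - sqrt (m (Suc j))))"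
    by (intro sum_norm_le term_le)
  also have "\<dots> = 2 * E * B * (sqrt (m (Suc n)) - sqrt (m (Suc N)))"
    unfolding sum_distrib_left[symmetric] using tele True by simp
  also have "\<dots> \<le> 2 * E * B * sqrt (m (Suc n))"
    using E B m_pos[of "Suc N"] by (intro mult_left_mono) (auto simp: less_imp_le)
  finally show ?thesis using last by (simp add: algebra_simps)
qed

context
  fixes s :: real
  assumes s: "0 < s" "s < 1"
begin

text \<open>The coefficient \<open>b\<^sub>j\<close> of the orthonormal recurrence \<open>z p\<^sub>j\<^sub>+\<^sub>1 = b\<^sub>j\<^sub>+\<^sub>1 p\<^sub>j\<^sub>+\<^sub>2 + b\<^sub>j p\<^sub>j\<close>.\<close>

definition geg_jacobi_coeff :: "nat \<Rightarrow> real" where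
  "geg_jacobi_coeff j = (real j + 1) / (2 * (real j + (s + 1/2))) * (geg_h s (Suc j) / geg_h s j)"

lemma geg_jacobi_coeff_alt:
  "geg_jacobi_coeff j = (real j + 2 * (s + 1/2)) / (2 * (real j + 1 + (s + 1/2))) *
      (geg_h s j / geg_h s (Suc j))"
proof -
  have h: "geg_h s j \<noteq> 0" "geg_h s (Suc j) \<noteq> 0" using geg_h_pos[OF s(1)] by (metis less_irrefl)+
  have "A / (2 * C) * (h' / h) = D / (2 * F) * (h / h')"
    if "h'^2 = C * D / (A * F) * h^2" "h \<noteq> 0" "h' \<noteq> 0" "A \<noteq> 0" "C \<noteq> 0" "F \<noteq> 0" for A C D F h h' :: real
    using that by (simp add: field_simps power2_eq_square)
  moreover have "real j + 1 \<noteq> 0" "real j + (s + 1/2) \<noteq> 0" "real j + 1 + (s + 1/2) \<noteq> 0" using s by auto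
  ultimately show ?thesis unfolding geg_jacobi_coeff_def using geg_h_Suc_squared[OF s(1), of j] h by blast
qed

lemma geg_jacobi_coeff_bounds: "0 \<le> geg_jacobi_coeff j" "geg_jacobi_coeff j \<le> 1"
proof -
  have h: "0 < geg_h s j" "0 < geg_h s (Suc j)" using geg_h_pos[OF s(1)] by auto
  show "0 \<le> geg_jacobi_coeff j" unfolding geg_jacobi_coeff_def using h s by auto
  have "(geg_jacobi_coeff j)^2 = ((real j + 1) / (2 * (real j + (s + 1/2)))) *
      ((real j + 2 * (s + 1/2)) / (2 * (real j + 1 + (s + 1/2))))"
  proof -
    have "(X * (h' / h)) * (Y * (h / h')) = X * Y" if "0 < h" "0 < h'" for X Y h h' :: real using that by simp
    from this[OF h] show ?thesis unfolding power2_eq_square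
        by (subst (2) geg_jacobi_coeff_alt, subst geg_jacobi_coeff_def)
  qed
  also have "\<dots> \<le> 1 * 1" using s by (intro mult_mono) (auto simp: divide_le_eq_1)
  finally have "(geg_jacobi_coeff j)^2 \<le> 1^2" by simp
  then show "geg_jacobi_coeff j \<le> 1" by (rule power2_le_imp_le) simp
qed

lemma geg_normalized_recurrence:
  fixes z :: "'a :: real_normed_field"
  shows "z * geg_normalized s (Suc j) z
    = of_real (geg_jacobi_coeff (Suc j)) * geg_normalized s (Suc (Suc j)) z
        + of_real (geg_jacobi_coeff j) * geg_normalized s j z"
proof -
  have h: "geg_h s j \<noteq> 0" for j using geg_h_pos[OF s(1)] by (metis less_irrefl)
  have a: "0 < s + 1/2" using s by simp
  have 1: "geg_jacobi_coeff (Suc j) = (real j + 2) / (2 * (real j + 1 + (s + 1/2))) *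
      (geg_h s (Suc (Suc j)) / geg_h s (Suc j))"
    unfolding geg_jacobi_coeff_def by (simp add: add_ac)
  have "(of_real X * U + of_real Y * V) / of_real h1
      = of_real (X * (h2 / h1)) * (U / of_real h2) + of_real (Y * (h0 / h1)) * (V / of_real h0)"
    if "h0 \<noteq> 0" "h2 \<noteq> 0" for X Y h0 h1 h2 :: real and U V :: 'a
    using that by (simp add: add_divide_distrib)
  from this[OF h[of j] h[of "Suc (Suc j)"]]
  have "(z * gegenbauer (s + 1/2) (Suc j) z) / of_real (geg_h s (Suc j))
    = of_real (geg_jacobi_coeff (Suc j)) * (gegenbauer (s + 1/2) (Suc (Suc j)) z / of_real
        (geg_h s (Suc (Suc j))))
      + of_real (geg_jacobi_coeff j) * (gegenbauer (s + 1/2) j z / of_real (geg_h s j))"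
    unfolding gegenbauer_times_x[OF a] 1 geg_jacobi_coeff_alt[of j] .
  then show ?thesis by (simp only: geg_normalized_def times_divide_eq_right)
qed

text \<open>The functions of the second kind satisfy the same recurrence as the orthonormal polynomials.\<close>

lemma geg_second_recurrence:
  assumes \<zeta>: "\<zeta> \<notin> complex_of_real ` {-1..1}"
  shows "\<zeta> * geg_second s (Suc j) \<zeta>
    = of_real (geg_jacobi_coeff (Suc j)) * geg_second s (Suc (Suc j)) \<zeta>
        + of_real (geg_jacobi_coeff j) * geg_second s j \<zeta>"
proof -
  define w where "w x = (1 - x^2) powr s" for x :: real
  have q: "((\<lambda>x. of_real (geg_normalized s j x * w x) / (\<zeta> - of_real x))
      has_integral geg_second s j \<zeta>) {-1..1}" for j
    unfolding geg_second_def w_def by (intro integrable_integral integrable_geg_second s \<zeta>)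
  have o: "((\<lambda>x. poly 1 (of_real x) * complex_of_real (geg_normalized s (Suc j) x * w x))
      has_integral 0) {-1..1}"
    unfolding w_def by (rule geg_normalized_orthogonal[OF s(1)]) simp
  have "((\<lambda>x. \<zeta> * (of_real (geg_normalized s (Suc j) x * w x) / (\<zeta> - of_real x))
      - poly 1 (of_real x) * complex_of_real (geg_normalized s (Suc j) x * w x))
      has_integral (\<zeta> * geg_second s (Suc j) \<zeta> - 0)) {-1..1}"
    by (intro has_integral_diff has_integral_mult_right q o)
  moreover have "((\<lambda>x. of_real (geg_jacobi_coeff (Suc j)) *
      (of_real (geg_normalized s (Suc (Suc j)) x * w x) / (\<zeta> - of_real x))
      + of_real (geg_jacobi_coeff j) * (of_real (geg_normalized s j x * w x) / (\<zeta> - of_real x)))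
     has_integral (of_real (geg_jacobi_coeff (Suc j)) * geg_second s (Suc (Suc j)) \<zeta>
         + of_real (geg_jacobi_coeff j) * geg_second s j \<zeta>)) {-1..1}"
    by (intro has_integral_add has_integral_mult_right q)
  moreover have "\<zeta> * (of_real (geg_normalized s (Suc j) x * w x) / (\<zeta> - of_real x))
      - poly 1 (of_real x) * complex_of_real (geg_normalized s (Suc j) x * w x)
     = of_real (geg_jacobi_coeff (Suc j)) * (of_real (geg_normalized s (Suc (Suc j)) x * w x) / (\<zeta> - of_real x))
      + of_real (geg_jacobi_coeff j) * (of_real (geg_normalized s j x * w x) / (\<zeta> - of_real x))" if "x
          \<in> {-1..1}" for x
  proof -
    have nz: "\<zeta> - of_real x \<noteq> 0" using \<zeta> that by auto
    have "\<zeta> * (of_real (P * W) / D) - 1 * of_real (P * W)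
        = of_real A * (of_real (P2 * W) / D) + of_real C * (of_real (P0 * W) / D)"
      if "x * P = A * P2 + C * P0" "D = \<zeta> - of_real x" for P P2 P0 A C W and D :: complex
    proof -
      have "\<zeta> * (of_real (P * W) / D) - 1 * of_real (P * W) = (\<zeta> - D) * of_real (P * W) / D"
      proof -
        have "D \<noteq> 0" using nz that(2) by simp
        then show ?thesis by (simp add: left_diff_distrib diff_divide_distrib)
      qed
      also have "\<dots> = of_real ((x * P) * W) / D" using that(2) by simp
      also have "\<dots> = of_real A * (of_real (P2 * W) / D) + of_real C * (of_real (P0 * W) / D)"
        unfolding that(1) by (simp add: add_divide_distrib algebra_simps)
      finally show ?thesis .
    qed
    from this[OF _ refl] show ?thesis using geg_normalized_recurrence[of x j] by simp
  qed
  ultimately have "((\<lambda>x. of_real (geg_jacobi_coeff (Suc j)) *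
      (of_real (geg_normalized s (Suc (Suc j)) x * w x) / (\<zeta> - of_real x))
      + of_real (geg_jacobi_coeff j) * (of_real (geg_normalized s j x * w x) / (\<zeta> - of_real x)))
     has_integral (\<zeta> * geg_second s (Suc j) \<zeta> - 0)) {-1..1}"
    by (subst has_integral_cong[symmetric]) auto
  then show ?thesis
    using \<open>((\<lambda>x. of_real (geg_jacobi_coeff (Suc j)) *
        (of_real (geg_normalized s (Suc (Suc j)) x * w x) / (\<zeta> - of_real x))
      + of_real (geg_jacobi_coeff j) * (of_real (geg_normalized s j x * w x) / (\<zeta> - of_real x)))
     has_integral (of_real (geg_jacobi_coeff (Suc j)) * geg_second s (Suc (Suc j)) \<zeta>
         + of_real (geg_jacobi_coeff j) * geg_second s j \<zeta>)) {-1..1}\<close>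
    by (simp add: has_integral_unique)
qed

text \<open>The mixed Christoffel--Darboux formula. It controls partial sums of \<open>p\<^sub>j(z) q\<^sub>j(\<zeta>)\<close> by \<open>1 / |\<zeta> - z|\<close> when
  \<open>z\<close> and \<open>\<zeta>\<close> lie on the same ellipse and the terms do not decay.\<close>

lemma christoffel_darboux:
  fixes z \<zeta> :: complex
  assumes \<zeta>: "\<zeta> \<notin> complex_of_real ` {-1..1}" and nN: "n \<le> N"
  defines "W \<equiv> \<lambda>j. of_real (geg_jacobi_coeff j) *
    (geg_normalized s j z * geg_second s (Suc j) \<zeta> - geg_normalized s (Suc j) z * geg_second s j \<zeta>)"
  shows "(\<zeta> - z) * (\<Sum>j\<in>{n<..N}. geg_normalized s j z * geg_second s j \<zeta>) = W N - W n"
  using nN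
proof (induction N rule: dec_induct)
  case (step N)
  have ins: "{n<..Suc N} = insert (Suc N) {n<..N}" using step by auto
  have "(\<zeta> - z) * (geg_normalized s (Suc N) z * geg_second s (Suc N) \<zeta>)
      = geg_normalized s (Suc N) z * (\<zeta> * geg_second s (Suc N) \<zeta>)
          - (z * geg_normalized s (Suc N) z) * geg_second s (Suc N) \<zeta>"
    by (simp add: algebra_simps)
  also have "\<dots> = W (Suc N) - W N"
    unfolding geg_second_recurrence[OF \<zeta>] geg_normalized_recurrence W_def by (simp add: algebra_simps)
  finally show ?case using step by (simp add: ins distrib_left)
qed simp

end

section \<open>The tail of the exact inverse in the norm of its own region\<close>

text \<open>Jordan's inequality.\<close>

lemma sin_lower_linear:
  assumes "0 \<le> t" "t \<le> 1"
  shows "t \<le> sin (pi / 2 * t)"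
proof -
  have "convex_on {0..pi/2} (\<lambda>x. - sin x)"
    by (rule f''_ge0_imp_convex[where f' = "\<lambda>x. - cos x" and f'' = sin])
      (auto intro!: derivative_eq_intros sin_ge_zero)
  from convex_onD[OF this assms, of 0 "pi/2"] show ?thesis by (simp add: mult.commute)
qed

lemma dist_unit_circle_ge:
  fixes a b :: real
  assumes "\<bar>a - b\<bar> \<le> 1"
  shows "4 * min \<bar>a - b\<bar> (1 - \<bar>a - b\<bar>)
    \<le> cmod (exp (2 * of_real pi * \<i> * of_real a) - exp (2 * of_real pi * \<i> * of_real b))"
proof -
  define d where "d = \<bar>a - b\<bar>"
  define \<theta> where "\<theta> = pi * (a - b)"
  have "exp (2 * of_real pi * \<i> * of_real a) - exp (2 * of_real pi * \<i> * of_real b)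
      = exp (\<i> * of_real (2 * pi * b)) * (exp (\<i> * of_real (2 * \<theta>)) - 1)"
    by (simp add: algebra_simps \<theta>_def flip: exp_add)
  then have "cmod (exp (2 * of_real pi * \<i> * of_real a) - exp (2 * of_real pi * \<i> * of_real b))
      = cmod (exp (\<i> * of_real (2 * \<theta>)) - 1)"
    by (simp only: norm_mult norm_exp_i_times mult_1)
  also have "\<dots> = 2 * \<bar>sin \<theta>\<bar>"
  proof -
    have "(cmod (exp (\<i> * of_real (2 * \<theta>)) - 1))^2 = (cos (2 * \<theta>) - 1)^2 + (sin (2 * \<theta>))^2"
      unfolding cmod_power2 by (simp only: cis_conv_exp[symmetric]) simp
    also have "\<dots> = 2 - 2 * cos (2 * \<theta>)"
      using sin_cos_squared_add[of "2 * \<theta>"] by (simp add: power2_eq_square algebra_simps)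
    also have "\<dots> = (2 * \<bar>sin \<theta>\<bar>)^2" by (simp add: cos_double_sin power_mult_distrib)
    finally have "(cmod (exp (\<i> * of_real (2 * \<theta>)) - 1))^2 = (2 * \<bar>sin \<theta>\<bar>)^2" .
    then show ?thesis by (rule power2_eq_imp_eq) simp_all
  qed
  also have "\<bar>sin \<theta>\<bar> = \<bar>sin (pi * d)\<bar>" 
  proof -
    have "pi * d = \<theta> \<or> pi * d = - \<theta>" unfolding \<theta>_def d_def by (auto simp: abs_if algebra_simps)
    then show ?thesis by auto
  qed
  also have "2 * min d (1 - d) \<le> \<bar>sin (pi * d)\<bar>"
  proof (cases "d \<le> 1/2")
    case True
    then show ?thesis using sin_lower_linear[of "2 * d"] by (simp add: d_def)
  next
    case False
    have "sin (pi * d) = sin (pi / 2 * (2 * (1 - d)))" by (simp add: right_diff_distrib)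
    then show ?thesis using sin_lower_linear[of "2 * (1 - d)"] False assms by (simp add: d_def)
  qed
  then have "4 * min d (1 - d) \<le> 2 * \<bar>sin (pi * d)\<bar>" by simp
  finally show ?thesis by (simp add: d_def)
qed

text \<open>The distance of a point of the region from the ellipse, in terms of the periodic distance of the
  parameter from the angular parameter \<open>t0\<close> of a preimage.\<close>

lemma bernstein_path_dist_ge:
  assumes \<rho>: "1 < \<rho>" and z: "z \<in> bernstein_region \<rho>"
  obtains t0 where "0 \<le> t0" "t0 \<le> 1"
    "\<And>t. t \<in> {0..1} \<Longrightarrow> (\<rho> - 1) * min \<bar>t - t0\<bar> (1 - \<bar>t - t0\<bar>) \<le> cmod (bernstein_path \<rho> t - z)"
proof -
  have "1 \<le> \<rho>" using \<rho> by simp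
  with z obtain u where u: "1 \<le> cmod u" "cmod u \<le> \<rho>" "z = joukowski u" by (rule bernstein_regionE)
  define t0 where "t0 = Arg2pi u / (2 * pi)"
  define e where "e = exp (2 * of_real pi * \<i> * of_real t0)"
  have t0: "0 \<le> t0" "t0 \<le> 1" using Arg2pi[of u] by (simp_all add: t0_def)
  have ue: "u = of_real (cmod u) * e" using Arg2pi_eq[of u] by (simp add: e_def t0_def)
  have ne: "cmod e = 1" unfolding e_def by (simp add: norm_exp_eq_Re)
  have "(\<rho> - 1) * min \<bar>t - t0\<bar> (1 - \<bar>t - t0\<bar>) \<le> cmod (bernstein_path \<rho> t - z)" if t: "t \<in> {0..1}" for t
  proof -
    define v where "v = circlepath 0 \<rho> t"
    have v: "cmod v = \<rho>" "v = of_real \<rho> * exp (2 * of_real pi * \<i> * of_real t)"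
      using norm_circlepath[of \<rho> t] \<rho> by (simp_all add: v_def circlepath)
    have "4 * min \<bar>t - t0\<bar> (1 - \<bar>t - t0\<bar>) \<le> cmod (exp (2 * of_real pi * \<i> * of_real t) - e)"
      unfolding e_def using t t0 by (intro dist_unit_circle_ge) auto
    then have "\<rho> * (4 * min \<bar>t - t0\<bar> (1 - \<bar>t - t0\<bar>)) \<le> \<rho> * cmod (exp (2 * of_real pi * \<i> * of_real t) - e)"
      using \<rho> by (intro mult_left_mono) auto
    also have "\<dots> = cmod (of_real \<rho> * (exp (2 * of_real pi * \<i> * of_real t) - e))" using \<rho>
        by (simp add: norm_mult)
    \<comment> \<open>Moving \<open>u\<close> radially onto the circle at most doubles its distance from \<open>v\<close>.\<close>
    also have "\<dots> = cmod ((v - u) + (u - of_real \<rho> * e))" unfolding v(2) by (simp add: algebra_simps)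
    also have "\<dots> \<le> cmod (v - u) + cmod (u - of_real \<rho> * e)" by (rule norm_triangle_ineq)
    also have "cmod (u - of_real \<rho> * e) = \<rho> - cmod u"
    proof -
      have "u - of_real \<rho> * e = of_real (cmod u - \<rho>) * e" by (subst ue) (simp add: algebra_simps)
      then have "cmod (u - of_real \<rho> * e) = \<bar>cmod u - \<rho>\<bar>" by (simp only: norm_mult norm_of_real ne mult_1_right)
      then show ?thesis using u(2) by simp
    qed
    also have "\<rho> - cmod u \<le> cmod (v - u)" using norm_triangle_ineq2[of v u] v(1) by simp
    finally have "2 * \<rho> * min \<bar>t - t0\<bar> (1 - \<bar>t - t0\<bar>) \<le> cmod (v - u)" by simp
    then have "(1 - 1 / \<rho>) / 2 * (2 * \<rho> * min \<bar>t - t0\<bar> (1 - \<bar>t - t0\<bar>)) \<le> (1 - 1 / \<rho>) / 2 * cmod (v - u)"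
      using \<rho> by (intro mult_left_mono) auto
    also have "\<dots> \<le> cmod (joukowski v - joukowski u)" using \<rho> v(1) u(1) by (rule joukowski_dist_ge)
    also have "(1 - 1 / \<rho>) / 2 * (2 * \<rho> * min \<bar>t - t0\<bar> (1 - \<bar>t - t0\<bar>)) = (\<rho> - 1) * min \<bar>t - t0\<bar> (1 - \<bar>t - t0\<bar>)"
    proof -
      have "(1 - 1 / \<rho>) / 2 * (2 * \<rho> * X) = (\<rho> - 1) * X" for X using \<rho> by (simp add: field_simps)
      then show ?thesis .
    qed
    finally show ?thesis by (simp add: v_def u(3) bernstein_path_def)
  qed
  then show thesis using that t0 by blast
qed

lemma has_integral_abs_powr:
  fixes a \<epsilon> :: real
  assumes \<epsilon>: "0 < \<epsilon>"
  shows "((\<lambda>t. \<bar>t - a\<bar> powr (\<epsilon> - 1)) has_integral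
    ((max 0 (1 - a) powr \<epsilon> - max 0 (a - 1) powr \<epsilon>) / \<epsilon>
        - (max 0 (0 - a) powr \<epsilon> - max 0 (a - 0) powr \<epsilon>) / \<epsilon>)) {0..1}"
proof (rule fundamental_theorem_of_calculus_interior_strong[where S = "{a}"])
  show "continuous_on {0..1} (\<lambda>t. (max 0 (t - a) powr \<epsilon> - max 0 (a - t) powr \<epsilon>) / \<epsilon>)"
    using \<epsilon> by (intro continuous_intros continuous_on_powr') auto
  fix t :: real assume t: "t \<in> {0<..<1} - {a}"
  let ?F = "\<lambda>t. (max 0 (t - a) powr \<epsilon> - max 0 (a - t) powr \<epsilon>) / \<epsilon>"
  have "(?F has_real_derivative \<bar>t - a\<bar> powr (\<epsilon> - 1)) (at t)"
  proof (cases "t < a")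
    case True
    have d: "((\<lambda>z. z powr \<epsilon>) has_real_derivative \<epsilon> * (a - t) powr (\<epsilon> - 1)) (at (a - t))"
      using True by (intro has_real_derivative_powr) simp
    have "((\<lambda>t. (a - t) powr \<epsilon>) has_real_derivative \<epsilon> * (a - t) powr (\<epsilon> - 1) * (-1)) (at t)"
      by (rule DERIV_chain2[where f = "\<lambda>z. z powr \<epsilon>" and g = "\<lambda>t. a - t", OF d])
          (auto intro!: derivative_eq_intros)
    from DERIV_cdivide[OF DERIV_minus[OF this], of \<epsilon>]
    have "((\<lambda>t. - ((a - t) powr \<epsilon>) / \<epsilon>) has_real_derivative \<bar>t - a\<bar> powr (\<epsilon> - 1)) (at t)"
      using \<epsilon> True by simp
    then show ?thesis
      by (rule has_field_derivative_transform_within_open[where S = "{..<a}"]) (use True \<epsilon> in auto)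
  next
    case False
    then have ta: "a < t" using t by auto
    have d: "((\<lambda>z. z powr \<epsilon>) has_real_derivative \<epsilon> * (t - a) powr (\<epsilon> - 1)) (at (t - a))"
      using ta by (intro has_real_derivative_powr) simp
    have "((\<lambda>t. (t - a) powr \<epsilon>) has_real_derivative \<epsilon> * (t - a) powr (\<epsilon> - 1) * 1) (at t)"
      by (rule DERIV_chain2[where f = "\<lambda>z. z powr \<epsilon>" and g = "\<lambda>t. t - a", OF d])
          (auto intro!: derivative_eq_intros)
    from DERIV_cdivide[OF this, of \<epsilon>]
    have "((\<lambda>t. (t - a) powr \<epsilon> / \<epsilon>) has_real_derivative \<bar>t - a\<bar> powr (\<epsilon> - 1)) (at t)"
      using \<epsilon> ta by simp
    then show ?thesis
      by (rule has_field_derivative_transform_within_open[where S = "{a<..}"]) (use ta \<epsilon> in auto)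
  qed
  then show "(?F has_vector_derivative \<bar>t - a\<bar> powr (\<epsilon> - 1)) (at t)"
    by (simp add: has_real_derivative_iff_has_vector_derivative)
qed auto

text \<open>An integrable majorant of \<open>d\<^sup>\<epsilon>\<^sup>-\<^sup>1\<close>, where \<open>d\<close> is the distance of \<open>t\<close> and \<open>t0\<close> modulo \<open>1\<close>. At the singular points
  a summand has the default value \<open>0\<close>.\<close>

definition periodic_singularity :: "real \<Rightarrow> real \<Rightarrow> real \<Rightarrow> real" where
  "periodic_singularity \<epsilon> t0 t = \<bar>t - t0\<bar> powr (\<epsilon> - 1) + \<bar>t - (t0 - 1)\<bar> powr (\<epsilon> - 1) + \<bar>t
      - (t0 + 1)\<bar> powr (\<epsilon> - 1)"

lemma periodic_singularity_integral:
  assumes \<epsilon>: "0 < \<epsilon>" "\<epsilon> < 1" and t0: "0 \<le> t0" "t0 \<le> 1"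
  obtains J where "(periodic_singularity \<epsilon> t0 has_integral J) {0..1}" "J \<le> 12 / \<epsilon>"
proof -
  have one: "\<exists>J. ((\<lambda>t. \<bar>t - a\<bar> powr (\<epsilon> - 1)) has_integral J) {0..1} \<and> J \<le> 4 / \<epsilon>" if a: "-1 \<le> a" "a \<le> 2" for a
  proof -
    have p: "y powr \<epsilon> \<le> 2" if "0 \<le> y" "y \<le> 2" for y :: real
    proof -
      have "y powr \<epsilon> \<le> 2 powr \<epsilon>" using that \<epsilon> by (intro powr_mono2) auto
      also have "\<dots> \<le> 2 powr 1" using \<epsilon> by (intro powr_mono) auto
      finally show ?thesis by simp
    qed
    have "max 0 (1 - a) powr \<epsilon> - max 0 (a - 1) powr \<epsilon> \<le> 2"
        using p[of "max 0 (1 - a)"] a powr_ge_zero[of "max 0 (a - 1)" \<epsilon>] by linarith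
    moreover have "- (max 0 (0 - a) powr \<epsilon> - max 0 (a - 0) powr \<epsilon>) \<le> 2"
        using p[of "max 0 (a - 0)"] a powr_ge_zero[of "max 0 (0 - a)" \<epsilon>] by linarith
    ultimately have "((max 0 (1 - a) powr \<epsilon> - max 0 (a - 1) powr \<epsilon>)
        - (max 0 (0 - a) powr \<epsilon> - max 0 (a - 0) powr \<epsilon>)) / \<epsilon> \<le> 4 / \<epsilon>"
      using \<epsilon> by (intro divide_right_mono) auto
    then show ?thesis using has_integral_abs_powr[OF \<epsilon>(1), of a] unfolding diff_divide_distrib[symmetric]
        by blast
  qed
  obtain J1 J2 J3 where
    "((\<lambda>t. \<bar>t - t0\<bar> powr (\<epsilon> - 1)) has_integral J1) {0..1}" "J1 \<le> 4 / \<epsilon>"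
    "((\<lambda>t. \<bar>t - (t0 - 1)\<bar> powr (\<epsilon> - 1)) has_integral J2) {0..1}" "J2 \<le> 4 / \<epsilon>"
    "((\<lambda>t. \<bar>t - (t0 + 1)\<bar> powr (\<epsilon> - 1)) has_integral J3) {0..1}" "J3 \<le> 4 / \<epsilon>"
    using one[of t0] one[of "t0 - 1"] one[of "t0 + 1"] t0 by auto
  note J = this
  have "((\<lambda>t. \<bar>t - t0\<bar> powr (\<epsilon> - 1) + \<bar>t - (t0 - 1)\<bar> powr (\<epsilon> - 1) + \<bar>t - (t0 + 1)\<bar> powr (\<epsilon> - 1))
      has_integral (J1 + J2 + J3)) {0..1}"
    by (intro has_integral_add J)
  then have "(periodic_singularity \<epsilon> t0 has_integral (J1 + J2 + J3)) {0..1}"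
    unfolding periodic_singularity_def[abs_def] .
  moreover have "J1 + J2 + J3 \<le> 4 / \<epsilon> + 4 / \<epsilon> + 4 / \<epsilon>"
    using J(2,4,6) by linarith
  moreover have "4 / \<epsilon> + 4 / \<epsilon> + 4 / \<epsilon> = 12 / \<epsilon>" by simp
  ultimately show thesis using that by simp
qed

lemma min_dist_powr_le:
  assumes "0 < min \<bar>t - t0\<bar> (1 - \<bar>t - t0\<bar>)"
  shows "min \<bar>t - t0\<bar> (1 - \<bar>t - t0\<bar>) powr (\<epsilon> - 1) \<le> periodic_singularity \<epsilon> t0 t"
proof -
  let ?\<mu> = "min \<bar>t - t0\<bar> (1 - \<bar>t - t0\<bar>)"
  have "?\<mu> = \<bar>t - t0\<bar> \<or> ?\<mu> = \<bar>t - (t0 - 1)\<bar> \<or> ?\<mu> = \<bar>t - (t0 + 1)\<bar>"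
    using assms by (auto simp: min_def abs_if)
  then have "?\<mu> powr (\<epsilon> - 1) \<in> {\<bar>t - t0\<bar> powr (\<epsilon> - 1), \<bar>t - (t0 - 1)\<bar> powr (\<epsilon> - 1), \<bar>t
      - (t0 + 1)\<bar> powr (\<epsilon> - 1)}"
    by (metis insertI1 insertI2)
  moreover have "x \<le> a + b + c" if "x \<in> {a, b, c}" "0 \<le> a" "0 \<le> b" "0 \<le> c" for x a b c :: real
    using that by auto
  ultimately show ?thesis unfolding periodic_singularity_def using powr_ge_zero by blast
qed

lemma interpolation_bound:
  fixes X E a b \<epsilon> :: real
  assumes "X \<le> E * a" "X \<le> E * b" "0 \<le> X" "0 < E" "0 < a" "0 < b" "0 \<le> \<epsilon>" "\<epsilon> \<le> 1"
  shows "X \<le> E * (a powr \<epsilon> * b powr (1 - \<epsilon>))"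
proof -
  define Y where "Y = X / E"
  have Y: "0 \<le> Y" "Y \<le> a" "Y \<le> b" using assms by (simp_all add: Y_def field_simps)
  have "Y = Y powr \<epsilon> * Y powr (1 - \<epsilon>)" using Y by (simp flip: powr_add)
  also have "\<dots> \<le> a powr \<epsilon> * b powr (1 - \<epsilon>)" using Y assms by (intro mult_mono powr_mono2) auto
  finally show ?thesis using assms by (simp add: Y_def field_simps)
qed

text \<open>Finitely many points are excepted because the majorants in use do not bound the kernel at their
  singularities.\<close>

lemma bernstein_density_singular_bound:
  assumes \<rho>: "1 < \<rho>" and f: "f \<in> A_space \<rho>"
    and I: "((\<lambda>t. f (bernstein_path \<rho> t) * bernstein_speed \<rho> t * k t) has_integral I) {0..1}"
    and S: "finite S" and k: "\<And>t. t \<in> {0..1} - S \<Longrightarrow> cmod (k t) \<le> g t"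
    and g: "(g has_integral J) {0..1}" "\<And>t. 0 \<le> g t"
  shows "cmod I \<le> \<rho> * A_norm \<rho> f * J"
proof -
  let ?F = "\<lambda>t. f (bernstein_path \<rho> t) * bernstein_speed \<rho> t * k t"
  have A: "0 \<le> \<rho> * A_norm \<rho> f" using A_norm_nonneg[OF f] \<rho> by simp
  have I': "((\<lambda>t. if t \<in> S then 0 else ?F t) has_integral I) {0..1}"
    by (rule has_integral_spike_finite[OF S _ I]) simp
  have "cmod (integral {0..1} (\<lambda>t. if t \<in> S then 0 else ?F t)) \<le> integral {0..1} (\<lambda>t. \<rho> * A_norm \<rho> f * g t)"
  proof (rule integral_norm_bound_integral)
    fix t :: real assume t: "t \<in> {0..1}"
    show "cmod (if t \<in> S then 0 else ?F t) \<le> \<rho> * A_norm \<rho> f * g t"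
    proof (cases "t \<in> S")
      case True
      then show ?thesis using A g(2) by simp
    next
      case False
      have "cmod (?F t) \<le> \<rho> * A_norm \<rho> f * g t"
        unfolding norm_mult[of "_ * _"] using k[of t] t False
        by (intro mult_mono norm_bernstein_density_le \<rho> f A) auto
      then show ?thesis using False by simp
    qed
  next
    show "(\<lambda>t. \<rho> * A_norm \<rho> f * g t) integrable_on {0..1}" using g(1) by (intro integrable_on_mult_right) auto
  qed (use I' in auto)
  also have "integral {0..1} (\<lambda>t. \<rho> * A_norm \<rho> f * g t) = \<rho> * A_norm \<rho> f * J" using g(1)
      by (simp add: integral_unique)
  finally show ?thesis using I' by (simp add: integral_unique)
qed

context
  fixes s \<rho> :: real
  assumes s: "0 < s" "s < 1" and \<rho>: "1 < \<rho>"
begin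

text \<open>The number of terms and the Christoffel--Darboux formula give two bounds, neither of which is good
  enough: the former is not small, the latter is not integrable over the ellipse. Their geometric mean with
  exponents \<open>s / 2\<close> and \<open>1 - s / 2\<close> is integrable and grows more slowly than the square root of the eigenvalues.\<close>

lemma kernel_partial_sum_bound:
  obtains E where "0 < E"
    "\<And>n N z t. z \<in> bernstein_region \<rho> \<Longrightarrow> bernstein_path \<rho> t \<noteq> z \<Longrightarrow>
      cmod (\<Sum>j\<in>{n<..N}. geg_normalized s j z * geg_second s j (bernstein_path \<rho> t))
      \<le> E * ((real N + 1) powr (s/2) * (1 / cmod (bernstein_path \<rho> t - z)) powr (1 - s/2))"
proof -
  obtain K where K: "0 < K" "\<And>n z. z \<in> bernstein_region \<rho> \<Longrightarrow> cmod (geg_normalized s n z) \<le> K * \<rho> ^ n"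
    using geg_normalized_growth[OF s \<rho>] by blast
  define M where "M = cauchy_kernel_const \<rho> * (weighted_integral s 1 + 1)"
  have M: "0 < M" using cauchy_kernel_const_pos[OF \<rho>] weighted_integral_pos[OF s(1), of 1] by (simp add: M_def)
  have q: "cmod (geg_second s j (bernstein_path \<rho> t)) \<le> M / \<rho> ^ j" for j t
    using geg_second_path_bound[OF s(1) \<rho>, of j t] by (simp add: M_def)
  define E where "E = 4 * K * M * \<rho>"
  have E: "0 < E" "K * M \<le> E" using K M \<rho> by (simp_all add: E_def)
  have "cmod (\<Sum>j\<in>{n<..N}. geg_normalized s j z * geg_second s j (bernstein_path \<rho> t))
      \<le> E * ((real N + 1) powr (s/2) * (1 / cmod (bernstein_path \<rho> t - z)) powr (1 - s/2))"
    if z: "z \<in> bernstein_region \<rho>" and ne: "bernstein_path \<rho> t \<noteq> z" for n N z t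
  proof -
    define \<zeta> where "\<zeta> = bernstein_path \<rho> t"
    let ?p = "\<lambda>j. geg_normalized s j z" and ?q = "\<lambda>j. geg_second s j \<zeta>"
    let ?S = "\<Sum>j\<in>{n<..N}. ?p j * ?q j"
    have pos: "0 < cmod (\<zeta> - z)" using ne by (simp add: \<zeta>_def)
    have pq: "cmod (?p i * ?q j) \<le> K * M * (\<rho> ^ i / \<rho> ^ j)" for i j
    proof -
      have "cmod (?p i * ?q j) \<le> (K * \<rho> ^ i) * (M / \<rho> ^ j)"
        unfolding norm_mult using K M z q[of j t] \<rho> by (intro mult_mono) (auto simp: \<zeta>_def)
      then show ?thesis by (simp add: mult_ac)
    qed
    have "cmod ?S \<le> (\<Sum>j\<in>{n<..N}. K * M)"
      using pq[of j j for j] \<rho> by (intro sum_norm_le) auto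
    also have "\<dots> \<le> E * (real N + 1)"
    proof -
      have "real (N - n) * (K * M) \<le> (real N + 1) * E" using E K M by (intro mult_mono) auto
      then show ?thesis by (simp add: mult.commute)
    qed
    finally have 1: "cmod ?S \<le> E * (real N + 1)" .
    have 2: "cmod ?S \<le> E * (1 / cmod (\<zeta> - z))"
    proof (cases "n \<le> N")
      case False
      then show ?thesis using E by simp
    next
      case True
      define W where "W j = of_real (geg_jacobi_coeff s j) * (?p j * ?q (Suc j) - ?p (Suc j) * ?q j)" for j
      have Wb: "cmod (W j) \<le> 2 * K * M * \<rho>" for j
      proof -
        have "cmod (?p j * ?q (Suc j)) \<le> K * M * (1 / \<rho>)" using pq[of j "Suc j"] \<rho> by simp
        also have "\<dots> \<le> K * M * \<rho>"
          using K M \<rho> less_trans[of "1 / \<rho>" 1 \<rho>] by (intro mult_left_mono) auto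
        finally have a: "cmod (?p j * ?q (Suc j)) \<le> K * M * \<rho>" .
        have b: "cmod (?p (Suc j) * ?q j) \<le> K * M * \<rho>" using pq[of "Suc j" j] \<rho> by simp
        have "cmod (W j) \<le> 1 * (cmod (?p j * ?q (Suc j)) + cmod (?p (Suc j) * ?q j))"
          unfolding W_def norm_mult[of "of_real _"] norm_of_real using geg_jacobi_coeff_bounds[OF s]
          by (intro mult_mono norm_triangle_ineq4) auto
        then show ?thesis using a b by simp
      qed
      have "\<zeta> \<notin> complex_of_real ` {-1..1}" using bernstein_path_neq_interval[OF s(1) \<rho>] by (auto simp: \<zeta>_def)
      from christoffel_darboux[OF s this True, of z] have "(\<zeta> - z) * ?S = W N - W n" by (simp only: W_def)
      then have "cmod (\<zeta> - z) * cmod ?S = cmod (W N - W n)" by (simp only: norm_mult[symmetric])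
      also have "\<dots> \<le> cmod (W N) + cmod (W n)" by (rule norm_triangle_ineq4)
      also have "\<dots> \<le> E" using Wb[of N] Wb[of n] by (simp add: E_def)
      finally show ?thesis using pos by (simp add: field_simps)
    qed
    show ?thesis using interpolation_bound[OF 1 2] E pos s by (simp add: \<zeta>_def)
  qed
  then show thesis using that E by blast
qed

text \<open>The sections of the series of the exact inverse are small in the norm of the same region. Individual
  terms are only of size \<open>1 / \<lambda>\<^sub>j\<close> there, which need not be summable.\<close>

lemma Ks_inv_tail_bound:
  obtains D where "0 < D"
    "\<And>f z n N. f \<in> A_space \<rho> \<Longrightarrow> z \<in> bernstein_region \<rho> \<Longrightarrow>
      cmod (\<Sum>j\<in>{n<..N}. Ks_inv_term s f z j) \<le> D * A_norm \<rho> f / sqrt (geg_eigenvalue s (Suc n))"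
proof -
  obtain E where E: "0 < E" "\<And>n N z t. z \<in> bernstein_region \<rho> \<Longrightarrow> bernstein_path \<rho> t \<noteq> z \<Longrightarrow>
      cmod (\<Sum>j\<in>{n<..N}. geg_normalized s j z * geg_second s j (bernstein_path \<rho> t))
      \<le> E * ((real N + 1) powr (s/2) * (1 / cmod (bernstein_path \<rho> t - z)) powr (1 - s/2))"
    using kernel_partial_sum_bound by blast
  define m where "m j = 1 / geg_eigenvalue s j" for j
  define B where "B = 1 / sqrt (geg_eigenvalue s 0)"
  have ev: "0 < geg_eigenvalue s j" for j using geg_eigenvalue_pos[OF s(1)] .
  have B: "0 < B" "B^2 = 1 / geg_eigenvalue s 0" using ev[of 0] by (simp_all add: B_def power_divide)
  have m_pos: "0 < m j" for j using ev by (simp add: m_def)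
  have m_dec: "m (Suc j) \<le> m j" for j
    unfolding m_def using ev geg_eigenvalue_mono[OF s(1), of j]
        by (intro divide_left_mono) (auto intro: mult_pos_pos)
  have m_le: "m j * (real j + 1) powr (2 * (s/2)) \<le> B^2" for j
    unfolding B(2) m_def using geg_eigenvalue_lower[OF s, of j] ev[of 0] ev[of j] by (simp add: field_simps)
  define D where "D = \<rho> * (3 * (E * (1 / (\<rho> - 1)) powr (1 - s/2)) * B * (12 / (s/2)))"
  have D: "0 < D" using \<rho> E B s by (simp add: D_def)
  have "cmod (\<Sum>j\<in>{n<..N}. Ks_inv_term s f z j) \<le> D * A_norm \<rho> f / sqrt (geg_eigenvalue s (Suc n))"
    if f: "f \<in> A_space \<rho>" and z: "z \<in> bernstein_region \<rho>" for f z n N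
  proof -
    obtain t0 where t0: "0 \<le> t0" "t0 \<le> 1"
      "\<And>t. t \<in> {0..1} \<Longrightarrow> (\<rho> - 1) * min \<bar>t - t0\<bar> (1 - \<bar>t - t0\<bar>) \<le> cmod (bernstein_path \<rho> t - z)"
      using bernstein_path_dist_ge[OF \<rho> z] by blast
    obtain J where J: "(periodic_singularity (s/2) t0 has_integral J) {0..1}" "J \<le> 12 / (s/2)"
      using periodic_singularity_integral[of "s/2" t0] s t0 by auto
    define k where "k t = (\<Sum>j\<in>{n<..N}. of_real (m j) *
        (geg_normalized s j z * geg_second s j (bernstein_path \<rho> t)))" for t
    define c where "c = 3 * (E * (1 / (\<rho> - 1)) powr (1 - s/2)) * B * sqrt (m (Suc n))"
    have c: "0 \<le> c" using E B m_pos[of "Suc n"] by (simp add: c_def less_imp_le)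
    have "((\<lambda>t. \<Sum>j\<in>{n<..N}. of_real (m j) * geg_normalized s j z *
        (f (bernstein_path \<rho> t) * bernstein_speed \<rho> t * geg_second s j (bernstein_path \<rho> t)))
        has_integral (\<Sum>j\<in>{n<..N}. of_real (m j) * geg_normalized s j z * geg_coeff s f j)) {0..1}"
      by (intro has_integral_sum has_integral_mult_right has_integral_geg_coeff s \<rho> f) auto
    then have I: "((\<lambda>t. f (bernstein_path \<rho> t) * bernstein_speed \<rho> t * k t) has_integral
        (\<Sum>j\<in>{n<..N}. of_real (m j) * geg_normalized s j z * geg_coeff s f j)) {0..1}"
      by (rule has_integral_eq[rotated]) (simp add: k_def sum_distrib_left mult_ac)
    have sum_eq: "(\<Sum>j\<in>{n<..N}. of_real (m j) * geg_normalized s j z * geg_coeff s f j)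
        = (\<Sum>j\<in>{n<..N}. Ks_inv_term s f z j)"
      by (intro sum.cong) (simp_all add: Ks_inv_term_def m_def field_simps)
    have kb: "cmod (k t) \<le> c * periodic_singularity (s/2) t0 t" if t: "t \<in> {0..1} - {t0, t0 - 1, t0 + 1}" for t
    proof -
      let ?\<mu> = "min \<bar>t - t0\<bar> (1 - \<bar>t - t0\<bar>)"
      have \<mu>: "0 < ?\<mu>" using t t0(1,2) by (auto simp: min_def abs_if)
      then have "0 < (\<rho> - 1) * ?\<mu>" using \<rho> by (intro mult_pos_pos) auto
      moreover have le: "(\<rho> - 1) * ?\<mu> \<le> cmod (bernstein_path \<rho> t - z)" using t0(3) t by blast
      ultimately have pos: "0 < cmod (bernstein_path \<rho> t - z)" by linarith
      then have ne: "bernstein_path \<rho> t \<noteq> z" by auto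
      let ?R = "(1 / cmod (bernstein_path \<rho> t - z)) powr (1 - s/2)"
      have "cmod (k t) \<le> 3 * (E * ?R) * B * sqrt (m (Suc n))"
        unfolding k_def
      proof (rule abel_multiplier_bound[OF m_pos m_dec m_le])
        show "cmod (\<Sum>j\<in>{n<..N}. geg_normalized s j z * geg_second s j (bernstein_path \<rho> t))
            \<le> E * ?R * (real N + 1) powr (s/2)" for N
          using E(2)[OF z ne, of n N] by (simp add: mult_ac)
      qed (use E B in auto)
      also have "?R \<le> (1 / (\<rho> - 1)) powr (1 - s/2) * periodic_singularity (s/2) t0 t"
      proof -
        have "?R \<le> (1 / ((\<rho> - 1) * ?\<mu>)) powr (1 - s/2)"
          using le \<open>0 < (\<rho> - 1) * ?\<mu>\<close> s by (intro powr_mono2 divide_left_mono[OF le] mult_pos_pos[OF pos]) auto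
        also have "\<dots> = (1 / (\<rho> - 1)) powr (1 - s/2) * (1 / ?\<mu>) powr (1 - s/2)"
          by (subst powr_mult[symmetric]) simp
        also have "(1 / ?\<mu>) powr (1 - s/2) = ?\<mu> powr (s/2 - 1)"
          using \<mu> by (simp add: powr_divide powr_minus_divide[symmetric] flip: powr_minus_divide)
        also have "\<dots> \<le> periodic_singularity (s/2) t0 t" by (rule min_dist_powr_le[OF \<mu>])
        finally show ?thesis by (simp add: mult_left_mono)
      qed
      finally show ?thesis using E B m_pos[of "Suc n"] unfolding c_def by (simp add: mult_ac mult_left_mono)
    qed
    have "cmod (\<Sum>j\<in>{n<..N}. Ks_inv_term s f z j) \<le> \<rho> * A_norm \<rho> f * (c * J)"
      unfolding sum_eq[symmetric]
    proof (rule bernstein_density_singular_bound[where S = "{t0, t0 - 1, t0 + 1}"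
          and g = "\<lambda>t. c * periodic_singularity (s/2) t0 t", OF \<rho> f I])
      show "((\<lambda>t. c * periodic_singularity (s/2) t0 t) has_integral (c * J)) {0..1}"
          by (rule has_integral_mult_right[OF J(1)])
      show "0 \<le> c * periodic_singularity (s/2) t0 t" for t using c by (simp add: periodic_singularity_def)
      show "cmod (k t) \<le> c * periodic_singularity (s/2) t0 t" if "t \<in> {0..1} - {t0, t0 - 1, t0 + 1}" for t
        using that by (rule kb)
    qed auto
    also have "\<dots> \<le> \<rho> * A_norm \<rho> f * (c * (12 / (s/2)))"
      using J(2) c \<rho> A_norm_nonneg[OF f] by (intro mult_left_mono) auto
    also have "\<dots> = D * A_norm \<rho> f * sqrt (m (Suc n))" by (simp add: D_def c_def mult_ac)
    also have "\<dots> = D * A_norm \<rho> f / sqrt (geg_eigenvalue s (Suc n))" by (simp add: m_def real_sqrt_divide)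
    finally show ?thesis .
  qed
  then show thesis using that D by blast
qed

end

section \<open>Error bounds and convergence in operator norm\<close>

lemma sum_powers_tail_le:
  fixes r :: real
  assumes "0 \<le> r" "r < 1"
  shows "(\<Sum>j\<in>{n<..N}. r ^ j) \<le> r ^ n / (1 - r)"
proof (cases "n \<le> N")
  case True
  then have "(\<Sum>j\<in>{n<..N}. r ^ j) = (r ^ Suc n - r ^ Suc N) / (1 - r)"
  proof (induction N rule: dec_induct)
    case (step N)
    have "{n<..Suc N} = insert (Suc N) {n<..N}" using step by auto
    then have "(\<Sum>j\<in>{n<..Suc N}. r ^ j) = r ^ Suc N + (r ^ Suc n - r ^ Suc N) / (1 - r)"
      using step by simp
    also have "\<dots> = (r ^ Suc N * (1 - r) + (r ^ Suc n - r ^ Suc N)) / (1 - r)"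
      using assms by (simp add: add_divide_distrib)
    also have "\<dots> = (r ^ Suc n - r ^ Suc (Suc N)) / (1 - r)" by (simp add: algebra_simps)
    finally show ?case .
  qed simp
  also have "\<dots> \<le> r ^ n / (1 - r)"
  proof (rule divide_right_mono)
    have "r ^ Suc n \<le> r ^ n" using assms by (simp add: mult_le_cancel_right2)
    then show "r ^ Suc n - r ^ Suc N \<le> r ^ n" using assms zero_le_power[of r "Suc N"] by linarith
  qed (use assms in simp)
  finally show ?thesis .
qed (use assms in simp)

lemma suminf_tail_bound:
  fixes t :: "nat \<Rightarrow> complex"
  assumes t: "summable t" and B: "\<And>N. cmod (\<Sum>j\<in>{n<..N}. t j) \<le> B"
  shows "cmod (suminf t - (\<Sum>j\<le>n. t j)) \<le> B"
proof -
  have "(\<lambda>N. cmod ((\<Sum>j\<le>N. t j) - (\<Sum>j\<le>n. t j))) \<longlonglongrightarrow> cmod (suminf t - (\<Sum>j\<le>n. t j))"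
    by (intro tendsto_intros summable_LIMSEQ' t)
  moreover have "\<exists>M. \<forall>N\<ge>M. cmod ((\<Sum>j\<le>N. t j) - (\<Sum>j\<le>n. t j)) \<le> B"
  proof (intro exI allI impI)
    fix N assume "n \<le> N"
    then have "{..N} = {..n} \<union> {n<..N}" by auto
    then have "(\<Sum>j\<le>N. t j) = (\<Sum>j\<le>n. t j) + (\<Sum>j\<in>{n<..N}. t j)"
      by (simp only:) (rule sum.union_disjoint; auto)
    then show "cmod ((\<Sum>j\<le>N. t j) - (\<Sum>j\<le>n. t j)) \<le> B" using B[of N] by simp
  qed
  ultimately show ?thesis by (rule LIMSEQ_le_const2)
qed

lemma geg_normalized_holomorphic: "(geg_normalized s j :: complex \<Rightarrow> complex) holomorphic_on A"
proof -
  have "(geg_normalized s j :: complex \<Rightarrow> complex)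
      = (\<lambda>z. poly (gegenbauer_poly (s + 1/2) j) z / of_real (geg_h s j))"
    by (simp add: geg_normalized_def fun_eq_iff)
  moreover have "(\<lambda>z. poly (gegenbauer_poly (s + 1/2) j) z * (1 / of_real (geg_h s j))) holomorphic_on A"
    by (intro holomorphic_intros)
  ultimately show ?thesis by simp
qed

lemma geg_eigenvalue_ge_0:
  assumes "0 < s" "s < 1"
  shows "geg_eigenvalue s 0 \<le> geg_eigenvalue s j"
  using lift_Suc_mono_le[of "geg_eigenvalue s" 0 j, OF geg_eigenvalue_mono] assms by simp

lemma Ks_inv_num_eq:
  "Ks_inv_num s n x w f z
    = (\<Sum>j\<le>n. inverse (of_real (geg_eigenvalue s j)) * geg_coeff_num s n x w f j * geg_normalized s j z)"
  unfolding Ks_inv_num_def geg_normalized_def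
  by (intro sum.cong) (simp_all only: of_real_mult divide_inverse inverse_mult_distrib mult_ac)

context
  fixes s \<rho> :: real
  assumes s: "0 < s" "s < 1" and \<rho>: "1 < \<rho>"
begin

text \<open>The terms decay geometrically on every region that is smaller than the one where \<open>f\<close> is analytic.\<close>

lemma Ks_inv_term_bound:
  assumes \<nu>: "1 < \<nu>"
  obtains C where "0 \<le> C" "\<And>f z j. f \<in> A_space \<rho> \<Longrightarrow> z \<in> bernstein_region \<nu> \<Longrightarrow>
    cmod (Ks_inv_term s f z j) \<le> C * A_norm \<rho> f * (\<nu> / \<rho>) ^ j"
proof -
  obtain K where K: "0 < K" "\<And>n z. z \<in> bernstein_region \<nu> \<Longrightarrow> cmod (geg_normalized s n z) \<le> K * \<nu> ^ n"
    using geg_normalized_growth[OF s \<nu>] by blast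
  define M where "M = cauchy_kernel_const \<rho> * (weighted_integral s 1 + 1)"
  have M: "0 < M" using cauchy_kernel_const_pos[OF \<rho>] weighted_integral_pos[OF s(1), of 1] by (simp add: M_def)
  define l where "l = geg_eigenvalue s 0"
  have l: "0 < l" "\<And>j. l \<le> geg_eigenvalue s j"
    using geg_eigenvalue_pos[OF s(1)] geg_eigenvalue_ge_0[OF s] by (simp_all add: l_def)
  define C where "C = 1 / l * (\<rho> * M) * K"
  have "cmod (Ks_inv_term s f z j) \<le> C * A_norm \<rho> f * (\<nu> / \<rho>) ^ j"
    if f: "f \<in> A_space \<rho>" and z: "z \<in> bernstein_region \<nu>" for f z j
  proof -
    have A: "0 \<le> A_norm \<rho> f" using A_norm_nonneg[OF f] \<rho> by simp
    have "cmod (inverse (of_real (geg_eigenvalue s j))) \<le> 1 / l"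
      unfolding norm_inverse norm_of_real using l(1) l(2)[of j]
          by (simp add: inverse_eq_divide divide_left_mono)
    moreover have "cmod (geg_coeff s f j) \<le> \<rho> * A_norm \<rho> f * (M / \<rho> ^ j)"
      using geg_coeff_bound[OF s(1) \<rho> f, of j] by (simp add: M_def)
    ultimately have "cmod (Ks_inv_term s f z j) \<le> (1 / l * (\<rho> * A_norm \<rho> f * (M / \<rho> ^ j))) * (K * \<nu> ^ j)"
      unfolding Ks_inv_term_def norm_mult using K(2)[OF z] l(1) A M \<rho> by (intro mult_mono) auto
    then show ?thesis by (simp add: C_def power_divide mult_ac)
  qed
  moreover have "0 \<le> C" using l M K \<rho> by (simp add: C_def)
  ultimately show thesis using that by blast
qed

text \<open>The contribution of the quadrature errors. Since the error of the coefficient of index \<open>j\<close> is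
  \<open>O(\<rho>\<^sup>-\<^sup>(\<^sup>2\<^sup>n\<^sup>+\<^sup>2\<^sup>-\<^sup>j\<^sup>))\<close>, the sum is dominated by indices near \<open>n\<close>, and the inverse eigenvalues there
  provide the factor \<open>(n + 1)\<^sup>-\<^sup>s\<close>, which makes the bound useful even for \<open>\<nu> = \<rho>\<close>.\<close>

lemma aliasing_bound:
  assumes \<nu>: "1 < \<nu>"
  obtains C where "0 \<le> C" "\<And>n x w f z. gauss_jacobi_rule s n x w \<Longrightarrow> f \<in> A_space \<rho> \<Longrightarrow> z \<in> bernstein_region \<nu> \<Longrightarrow>
    cmod (\<Sum>j\<le>n. inverse (of_real (geg_eigenvalue s j)) * (geg_coeff_num s n x w f j - geg_coeff s f j)
        * geg_normalized s j z)
      \<le> C * A_norm \<rho> f * (\<nu> / \<rho>) ^ n * (real n + 1) powr (- s)"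
proof -
  obtain K where K: "0 < K" "\<And>n z. z \<in> bernstein_region \<nu> \<Longrightarrow> cmod (geg_normalized s n z) \<le> K * \<nu> ^ n"
    using geg_normalized_growth[OF s \<nu>] by blast
  define M where "M = cauchy_kernel_const \<rho> * (weighted_integral s 1 + 1)"
  have M: "0 < M" using cauchy_kernel_const_pos[OF \<rho>] weighted_integral_pos[OF s(1), of 1] by (simp add: M_def)
  define l where "l = geg_eigenvalue s 0"
  have l: "0 < l" using geg_eigenvalue_pos[OF s(1)] by (simp add: l_def)
  define q where "q = 1 / \<rho>"
  have q: "0 < q" "q < 1" using \<rho> by (simp_all add: q_def)
  define H where "H = 1 / l * (2 * \<rho> * M) * K"
  have H: "0 \<le> H" using l M K \<rho> by (simp add: H_def)
  define C where "C = H * (1 / (1 - q)^2)"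
  have "cmod (\<Sum>j\<le>n. inverse (of_real (geg_eigenvalue s j)) * (geg_coeff_num s n x w f j - geg_coeff s f j)
      * geg_normalized s j z)
      \<le> C * A_norm \<rho> f * (\<nu> / \<rho>) ^ n * (real n + 1) powr (- s)"
    if rule: "gauss_jacobi_rule s n x w" and f: "f \<in> A_space \<rho>" and z: "z \<in> bernstein_region \<nu>" for n x w f z
  proof -
    have A: "0 \<le> A_norm \<rho> f" using A_norm_nonneg[OF f] \<rho> by simp
    define R where "R = A_norm \<rho> f * (\<nu> / \<rho>) ^ n * (real n + 1) powr (- s)"
    have R: "0 \<le> R" using A \<nu> \<rho> by (simp add: R_def)
    have t: "cmod (inverse (of_real (geg_eigenvalue s j)) * (geg_coeff_num s n x w f j - geg_coeff s f j)
        * geg_normalized s j z)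
        \<le> H * R * (real (Suc (n - j)) * q ^ (n - j))" if j: "j \<le> n" for j
    proof -
      have "cmod (inverse (of_real (geg_eigenvalue s j))) = 1 / geg_eigenvalue s j"
        unfolding norm_inverse norm_of_real using geg_eigenvalue_pos[OF s(1), of j]
            by (simp add: inverse_eq_divide)
      also have "\<dots> \<le> 1 / (l * (real j + 1) powr s)"
        using geg_eigenvalue_lower[OF s, of j] l geg_eigenvalue_pos[OF s(1), of j] unfolding l_def
        by (intro divide_left_mono mult_pos_pos) auto
      also have "\<dots> = 1 / l * (real j + 1) powr (- s)" by (simp add: powr_minus_divide)
      also have "(real j + 1) powr (- s) \<le> (real n + 1) powr (- s) * real (Suc (n - j))"
      proof -
        \<comment> \<open>\<open>(j + 1) (n - j + 1) \<ge> n + 1\<close> trades \<open>(j + 1)\<^sup>-\<^sup>s\<close> for a factor that the geometric decay absorbs\<close>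
        have "0 \<le> real j * (real n - real j)" using j by simp
        then have "real n + 1 \<le> (real j + 1) * real (Suc (n - j))" using j
            by (simp add: of_nat_diff algebra_simps)
        then have "(real n + 1) powr s \<le> ((real j + 1) * real (Suc (n - j))) powr s" using s
            by (intro powr_mono2) auto
        also have "\<dots> = (real j + 1) powr s * real (Suc (n - j)) powr s" by (rule powr_mult)
        also have "real (Suc (n - j)) powr s \<le> real (Suc (n - j)) powr 1" using s by (intro powr_mono) auto
        finally have "(real n + 1) powr s \<le> (real j + 1) powr s * real (Suc (n - j))"
            by (simp add: mult_left_mono)
        then show ?thesis by (simp add: powr_minus_divide field_simps)
      qed
      finally have 1: "cmod (inverse (of_real (geg_eigenvalue s j)))
          \<le> 1 / l * ((real n + 1) powr (- s) * real (Suc (n - j)))"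
        using l by (simp add: divide_right_mono)
      have 2: "cmod (geg_coeff_num s n x w f j - geg_coeff s f j)
          \<le> 2 * \<rho> * M * A_norm \<rho> f * (q ^ n * q ^ (n - j))"
      proof -
        have "cmod (geg_coeff_num s n x w f j - geg_coeff s f j) \<le> 2 * \<rho> * M * A_norm \<rho> f * q ^ (2 * n + 2 - j)"
          using quadrature_coeff_error[OF s(1) rule \<rho> f j] by (simp add: M_def q_def power_divide mult_ac)
        also have "q ^ (2 * n + 2 - j) \<le> q ^ (n + (n - j))" using q j by (intro power_decreasing) auto
        finally show ?thesis using \<rho> M A by (simp add: power_add mult_left_mono)
      qed
      have "cmod (geg_normalized s j z) \<le> K * \<nu> ^ j" by (rule K(2)[OF z])
      also have "\<dots> \<le> K * \<nu> ^ n" using K(1) \<nu> j by (intro mult_left_mono power_increasing) auto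
      finally have 3: "cmod (geg_normalized s j z) \<le> K * \<nu> ^ n" .
      have "cmod (inverse (of_real (geg_eigenvalue s j)) * (geg_coeff_num s n x w f j - geg_coeff s f j)
          * geg_normalized s j z)
          \<le> (1 / l * ((real n + 1) powr (- s) * real (Suc (n - j)))) *
              (2 * \<rho> * M * A_norm \<rho> f * (q ^ n * q ^ (n - j))) * (K * \<nu> ^ n)"
        unfolding norm_mult using 1 2 3 l M A q K(1) \<nu> \<rho> by (intro mult_mono mult_nonneg_nonneg) auto
      also have "\<dots> = H * R * (real (Suc (n - j)) * q ^ (n - j))"
      proof -
        have "(\<nu> / \<rho>) ^ n = q ^ n * \<nu> ^ n" by (simp add: q_def power_divide)
        then show ?thesis by (simp only: H_def R_def mult_ac)
      qed
      finally show ?thesis .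
    qed
    have g: "(\<lambda>k. real (Suc k) * q ^ k) sums (1 / (1 - q)^2)" using geometric_deriv_sums[of q] q by simp
    have "cmod (\<Sum>j\<le>n. inverse (of_real (geg_eigenvalue s j)) * (geg_coeff_num s n x w f j - geg_coeff s f j)
        * geg_normalized s j z)
        \<le> (\<Sum>j\<le>n. H * R * (real (Suc (n - j)) * q ^ (n - j)))"
      by (intro sum_norm_le t) auto
    also have "\<dots> = H * R * (\<Sum>k\<le>n. real (Suc k) * q ^ k)"
      unfolding sum_distrib_left[symmetric] using sum.nat_diff_reindex[of "\<lambda>k. real (Suc k) * q ^ k" "Suc n"]
      by (simp only: lessThan_Suc_atMost diff_Suc_Suc)
    also have "\<dots> \<le> H * R * (1 / (1 - q)^2)"
    proof (rule mult_left_mono)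
      show "(\<Sum>k\<le>n. real (Suc k) * q ^ k) \<le> 1 / (1 - q)^2"
        unfolding sums_unique[OF g] using q by (intro sum_le_suminf sums_summable[OF g]) auto
    qed (use H R in simp)
    finally show ?thesis unfolding C_def R_def by (simp only: mult_ac)
  qed
  moreover have "0 \<le> C" using H by (simp add: C_def)
  ultimately show thesis using that by blast
qed

text \<open>The error is the truncation error minus the aliasing error.\<close>

lemma Ks_error_decomposition:
  "Ks_error s n x w f z = (Ks_inv s f z - (\<Sum>j\<le>n. Ks_inv_term s f z j))
    - (\<Sum>j\<le>n. inverse (of_real (geg_eigenvalue s j)) * (geg_coeff_num s n x w f j - geg_coeff s f j)
        * geg_normalized s j z)"
proof -
  have "(\<Sum>j\<le>n. Ks_inv_term s f z j)
    + (\<Sum>j\<le>n. inverse (of_real (geg_eigenvalue s j)) * (geg_coeff_num s n x w f j - geg_coeff s f j)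
        * geg_normalized s j z)
    = Ks_inv_num s n x w f z"
    unfolding Ks_inv_num_eq sum.distrib[symmetric] Ks_inv_term_def
        by (intro sum.cong) (simp_all add: algebra_simps)
  then show ?thesis unfolding Ks_error_def by (simp add: algebra_simps)
qed

lemma summable_Ks_inv_term_interior:
  assumes f: "f \<in> A_space \<rho>" and \<nu>: "1 < \<nu>" "\<nu> < \<rho>" and z: "z \<in> bernstein_region \<nu>"
  shows "summable (Ks_inv_term s f z)"
proof -
  obtain C where C: "0 \<le> C" "\<And>f z j. f \<in> A_space \<rho> \<Longrightarrow> z \<in> bernstein_region \<nu> \<Longrightarrow>
    cmod (Ks_inv_term s f z j) \<le> C * A_norm \<rho> f * (\<nu> / \<rho>) ^ j"
    using Ks_inv_term_bound[OF \<nu>(1)] by blast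
  have "summable (\<lambda>j. C * A_norm \<rho> f * (\<nu> / \<rho>) ^ j)" using \<nu> by (intro summable_mult summable_geometric) auto
  then show ?thesis by (rule summable_comparison_test') (rule C(2)[OF f z])
qed

end

context
  fixes s \<rho> :: real
  assumes s: "0 < s" "s < 1" and \<rho>: "1 < \<rho>"
begin

lemma summable_Ks_inv_term:
  assumes f: "f \<in> A_space \<rho>" and z: "z \<in> bernstein_region \<rho>"
  shows "summable (Ks_inv_term s f z)"
proof -
  obtain \<rho>' where "\<rho> < \<rho>'" "f \<in> A_space \<rho>'" using A_space_extends[OF f \<rho>] by blast
  then show ?thesis using \<rho> z by (intro summable_Ks_inv_term_interior[OF s, of \<rho>' f \<rho>]) auto
qed

lemma Ks_error_bound_smaller_region:
  assumes \<nu>: "1 < \<nu>" "\<nu> < \<rho>"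
  obtains C where "\<And>n x w f. 1 \<le> n \<Longrightarrow> gauss_jacobi_rule s n x w \<Longrightarrow> f \<in> A_space \<rho> \<Longrightarrow>
    A_norm \<nu> (Ks_error s n x w f) \<le> C * real n powr s * (\<nu> / \<rho>) ^ n * A_norm \<rho> f"
proof -
  obtain C1 where C1: "0 \<le> C1" "\<And>f z j. f \<in> A_space \<rho> \<Longrightarrow> z \<in> bernstein_region \<nu> \<Longrightarrow>
    cmod (Ks_inv_term s f z j) \<le> C1 * A_norm \<rho> f * (\<nu> / \<rho>) ^ j"
    using Ks_inv_term_bound[OF s \<rho> \<nu>(1)] by blast
  obtain C2 where C2: "0 \<le> C2" "\<And>n x w f z. gauss_jacobi_rule s n x w \<Longrightarrow> f \<in> A_space \<rho> \<Longrightarrow> z \<in> bernstein_region \<nu> \<Longrightarrow>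
    cmod (\<Sum>j\<le>n. inverse (of_real (geg_eigenvalue s j)) * (geg_coeff_num s n x w f j - geg_coeff s f j)
        * geg_normalized s j z)
      \<le> C2 * A_norm \<rho> f * (\<nu> / \<rho>) ^ n * (real n + 1) powr (- s)"
    using aliasing_bound[OF s \<rho> \<nu>(1)] by blast
  define r where "r = \<nu> / \<rho>"
  have r: "0 < r" "r < 1" using \<nu> \<rho> by (simp_all add: r_def)
  define C where "C = C1 / (1 - r) + C2"
  have C: "0 \<le> C" using C1 C2 r by (simp add: C_def)
  have "A_norm \<nu> (Ks_error s n x w f) \<le> C * real n powr s * (\<nu> / \<rho>) ^ n * A_norm \<rho> f"
    if n: "1 \<le> n" and rule: "gauss_jacobi_rule s n x w" and f: "f \<in> A_space \<rho>" for n x w f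
  proof (rule A_norm_le)
    fix z assume z: "z \<in> bernstein_region \<nu>"
    have A: "0 \<le> A_norm \<rho> f" using A_norm_nonneg[OF f] \<rho> by simp
    have 1: "cmod (Ks_inv s f z - (\<Sum>j\<le>n. Ks_inv_term s f z j)) \<le> C1 * A_norm \<rho> f * (r ^ n / (1 - r))"
      unfolding Ks_inv_def
    proof (rule suminf_tail_bound)
      show "summable (Ks_inv_term s f z)" by (rule summable_Ks_inv_term_interior[OF s \<rho> f \<nu> z])
      fix N
      have "cmod (\<Sum>j\<in>{n<..N}. Ks_inv_term s f z j) \<le> (\<Sum>j\<in>{n<..N}. C1 * A_norm \<rho> f * r ^ j)"
        unfolding r_def by (intro sum_norm_le C1(2) f z)
      also have "\<dots> = C1 * A_norm \<rho> f * (\<Sum>j\<in>{n<..N}. r ^ j)" by (simp add: sum_distrib_left)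
      also have "\<dots> \<le> C1 * A_norm \<rho> f * (r ^ n / (1 - r))"
        using C1(1) A r by (intro mult_left_mono sum_powers_tail_le) auto
      finally show "cmod (\<Sum>j\<in>{n<..N}. Ks_inv_term s f z j) \<le> C1 * A_norm \<rho> f * (r ^ n / (1 - r))" .
    qed
    have "C2 * A_norm \<rho> f * r ^ n * (real n + 1) powr (- s) \<le> C2 * A_norm \<rho> f * r ^ n * 1"
    proof (intro mult_left_mono)
      have "(real n + 1) powr (- s) \<le> (real n + 1) powr 0" using s by (intro powr_mono) auto
      then show "(real n + 1) powr (- s) \<le> 1" by simp
    qed (use C2(1) A r in auto)
    with C2(2)[OF rule f z]
    have 2: "cmod (\<Sum>j\<le>n. inverse (of_real (geg_eigenvalue s j)) *
        (geg_coeff_num s n x w f j - geg_coeff s f j) * geg_normalized s j z)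
      \<le> C2 * A_norm \<rho> f * r ^ n * 1"
      unfolding r_def by (rule order_trans)
    have "cmod (Ks_error s n x w f z) \<le> C1 * A_norm \<rho> f * (r ^ n / (1 - r)) + C2 * A_norm \<rho> f * r ^ n * 1"
      unfolding Ks_error_decomposition[OF s \<rho>] by (intro order_trans[OF norm_triangle_ineq4] add_mono 1 2)
    also have "\<dots> = C * 1 * r ^ n * A_norm \<rho> f" by (simp add: C_def algebra_simps)
    also have "\<dots> \<le> C * real n powr s * r ^ n * A_norm \<rho> f"
      using C A r n s by (intro mult_right_mono mult_left_mono ge_one_powr_ge_zero) auto
    finally show "cmod (Ks_error s n x w f z) \<le> C * real n powr s * (\<nu> / \<rho>) ^ n * A_norm \<rho> f" unfolding r_def .
  qed (use \<nu> in auto)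
  then show thesis using that by blast
qed

text \<open>In the norm of the region itself there is no geometric factor, but a rate \<open>n\<^sup>-\<^sup>s\<^sup>/\<^sup>2\<close> remains.\<close>

lemma Ks_error_bound_same_region:
  obtains C where "0 \<le> C" "\<And>n x w f. gauss_jacobi_rule s n x w \<Longrightarrow> f \<in> A_space \<rho> \<Longrightarrow>
    A_norm \<rho> (Ks_error s n x w f) \<le> C * (real n + 1) powr (- (s/2)) * A_norm \<rho> f"
proof -
  obtain D where D: "0 < D" "\<And>f z n N. f \<in> A_space \<rho> \<Longrightarrow> z \<in> bernstein_region \<rho> \<Longrightarrow>
      cmod (\<Sum>j\<in>{n<..N}. Ks_inv_term s f z j) \<le> D * A_norm \<rho> f / sqrt (geg_eigenvalue s (Suc n))"
    using Ks_inv_tail_bound[OF s \<rho>] by blast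
  obtain C2 where C2: "0 \<le> C2" "\<And>n x w f z. gauss_jacobi_rule s n x w \<Longrightarrow> f \<in> A_space \<rho> \<Longrightarrow> z \<in> bernstein_region \<rho> \<Longrightarrow>
    cmod (\<Sum>j\<le>n. inverse (of_real (geg_eigenvalue s j)) * (geg_coeff_num s n x w f j - geg_coeff s f j)
        * geg_normalized s j z)
      \<le> C2 * A_norm \<rho> f * (\<rho> / \<rho>) ^ n * (real n + 1) powr (- s)"
    using aliasing_bound[OF s \<rho> \<rho>] by blast
  define l where "l = geg_eigenvalue s 0"
  have l: "0 < l" using geg_eigenvalue_pos[OF s(1)] by (simp add: l_def)
  define C where "C = D / sqrt l + C2"
  have C: "0 \<le> C" using D C2 l by (simp add: C_def)
  have "A_norm \<rho> (Ks_error s n x w f) \<le> C * (real n + 1) powr (- (s/2)) * A_norm \<rho> f"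
    if rule: "gauss_jacobi_rule s n x w" and f: "f \<in> A_space \<rho>" for n x w f
  proof (rule A_norm_le)
    fix z assume z: "z \<in> bernstein_region \<rho>"
    have A: "0 \<le> A_norm \<rho> f" using A_norm_nonneg[OF f] \<rho> by simp
    let ?P = "(real n + 1) powr (- (s/2))"
    have sq: "sqrt l * (real n + 1) powr (s/2) \<le> sqrt (geg_eigenvalue s (Suc n))"
    proof (rule real_le_rsqrt)
      have "(sqrt l * (real n + 1) powr (s/2))^2 = l * (real n + 1) powr s"
        using l by (simp add: power_mult_distrib) (simp add: power2_eq_square flip: powr_add)
      also have "\<dots> \<le> geg_eigenvalue s n" using geg_eigenvalue_lower[OF s, of n] by (simp add: l_def)
      also have "\<dots> \<le> geg_eigenvalue s (Suc n)" by (rule geg_eigenvalue_mono[OF s(1)])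
      finally show "(sqrt l * (real n + 1) powr (s/2))^2 \<le> geg_eigenvalue s (Suc n)" .
    qed
    have "cmod (Ks_inv s f z - (\<Sum>j\<le>n. Ks_inv_term s f z j)) \<le> D * A_norm \<rho> f / sqrt (geg_eigenvalue s (Suc n))"
      unfolding Ks_inv_def by (rule suminf_tail_bound[OF summable_Ks_inv_term[OF f z] D(2)[OF f z]])
    also have "\<dots> \<le> D * A_norm \<rho> f / (sqrt l * (real n + 1) powr (s/2))"
      using D A l sq geg_eigenvalue_pos[OF s(1), of "Suc n"] by (intro divide_left_mono mult_pos_pos) auto
    also have "\<dots> = D / sqrt l * A_norm \<rho> f * ?P" by (simp add: powr_minus_divide)
    finally have 1: "cmod (Ks_inv s f z - (\<Sum>j\<le>n. Ks_inv_term s f z j)) \<le> D / sqrt l * A_norm \<rho> f * ?P" .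
    have "C2 * A_norm \<rho> f * (\<rho> / \<rho>) ^ n * (real n + 1) powr (- s) \<le> C2 * A_norm \<rho> f * (\<rho> / \<rho>) ^ n * ?P"
      using C2(1) A s \<rho> by (intro mult_left_mono powr_mono) auto
    then have 2: "cmod (\<Sum>j\<le>n. inverse (of_real (geg_eigenvalue s j)) *
        (geg_coeff_num s n x w f j - geg_coeff s f j) * geg_normalized s j z)
       \<le> C2 * A_norm \<rho> f * ?P"
      using C2(2)[OF rule f z] \<rho> by simp
    have "cmod (Ks_error s n x w f z) \<le> D / sqrt l * A_norm \<rho> f * ?P + C2 * A_norm \<rho> f * ?P"
      unfolding Ks_error_decomposition[OF s \<rho>] by (intro order_trans[OF norm_triangle_ineq4] add_mono 1 2)
    also have "\<dots> = C * ?P * A_norm \<rho> f" by (simp add: C_def algebra_simps)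
    finally show "cmod (Ks_error s n x w f z) \<le> C * ?P * A_norm \<rho> f" .
  qed (use \<rho> in auto)
  then show thesis using that C by blast
qed

lemma A_space_linear_combination:
  assumes "f \<in> A_space \<rho>" "g \<in> A_space \<rho>"
  shows "(\<lambda>u. a * f u + b * g u) \<in> A_space \<rho>"
  using assms unfolding A_space_def by (auto intro!: analytic_intros)

lemma geg_coeff_linear:
  assumes f: "f \<in> A_space \<rho>" and g: "g \<in> A_space \<rho>"
  shows "geg_coeff s (\<lambda>u. a * f u + b * g u) j = a * geg_coeff s f j + b * geg_coeff s g j"
proof -
  note F = has_integral_geg_coeff[OF s(1) \<rho>]
  have "((\<lambda>t. a * (f (bernstein_path \<rho> t) * bernstein_speed \<rho> t * geg_second s j (bernstein_path \<rho> t))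
      + b * (g (bernstein_path \<rho> t) * bernstein_speed \<rho> t * geg_second s j (bernstein_path \<rho> t)))
      has_integral (a * geg_coeff s f j + b * geg_coeff s g j)) {0..1}"
    by (intro has_integral_add has_integral_mult_right F f g)
  then have "((\<lambda>t. (a * f (bernstein_path \<rho> t) + b * g (bernstein_path \<rho> t)) * bernstein_speed \<rho> t
      * geg_second s j (bernstein_path \<rho> t))
      has_integral (a * geg_coeff s f j + b * geg_coeff s g j)) {0..1}"
    by (rule has_integral_eq[rotated]) (simp add: algebra_simps)
  then show ?thesis using F[OF A_space_linear_combination[OF f g, of a b], of j]
      by (rule has_integral_unique[symmetric])
qed

lemma Ks_inv_in_A_space:
  assumes f: "f \<in> A_space \<rho>"
  shows "Ks_inv s f \<in> A_space \<rho>"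
proof -
  obtain \<rho>' where \<rho>': "\<rho> < \<rho>'" "f \<in> A_space \<rho>'" using A_space_extends[OF f \<rho>] by blast
  define \<mu> where "\<mu> = (\<rho> + \<rho>') / 2"
  have \<mu>: "\<rho> < \<mu>" "\<mu> < \<rho>'" "1 < \<mu>" "1 < \<rho>'" using \<rho>' \<rho> by (simp_all add: \<mu>_def)
  obtain C where C: "0 \<le> C" "\<And>f z j. f \<in> A_space \<rho>' \<Longrightarrow> z \<in> bernstein_region \<mu> \<Longrightarrow>
    cmod (Ks_inv_term s f z j) \<le> C * A_norm \<rho>' f * (\<mu> / \<rho>') ^ j"
    using Ks_inv_term_bound[OF s \<mu>(4) \<mu>(3)] by blast
  define U where "U = {z. cmod (z - 1) + cmod (z + 1) < \<mu> + 1 / \<mu>}"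
  have oU: "open U" unfolding U_def by (intro open_Collect_less continuous_intros)
  have U: "U \<subseteq> bernstein_region \<mu>" by (auto simp: U_def bernstein_region_def)
  have "\<not> \<mu> + 1 / \<mu> \<le> \<rho> + 1 / \<rho>" using add_inverse_le_iff[of \<mu> \<rho>] \<mu> \<rho> by simp
  then have BU: "bernstein_region \<rho> \<subseteq> U" by (auto simp: U_def bernstein_region_def)
  have "uniform_limit U (\<lambda>n z. \<Sum>j<n. Ks_inv_term s f z j) (\<lambda>z. \<Sum>j. Ks_inv_term s f z j) sequentially"
  proof (rule Weierstrass_m_test)
    show "cmod (Ks_inv_term s f z j) \<le> C * A_norm \<rho>' f * (\<mu> / \<rho>') ^ j" if "z \<in> U" for j z
      using that U by (intro C(2) \<rho>') auto
    show "summable (\<lambda>j. C * A_norm \<rho>' f * (\<mu> / \<rho>') ^ j)" using \<mu>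
        by (intro summable_mult summable_geometric) auto
  qed
  then have ul: "uniform_limit U (\<lambda>n z. \<Sum>j<n. Ks_inv_term s f z j) (Ks_inv s f) sequentially"
    by (simp add: Ks_inv_def[abs_def])
  have "Ks_inv s f holomorphic_on U"
  proof (rule holomorphic_uniform_sequence[OF oU])
    show "(\<lambda>z. \<Sum>j<n. Ks_inv_term s f z j) holomorphic_on U" for n
      unfolding Ks_inv_term_def by (intro holomorphic_intros geg_normalized_holomorphic)
    fix z assume "z \<in> U"
    then obtain d where "0 < d" "cball z d \<subseteq> U" using oU open_contains_cball by blast
    then show "\<exists>d>0. cball z d \<subseteq> U \<and> uniform_limit (cball z d) (\<lambda>n z. \<Sum>j<n. Ks_inv_term s f z j)
        (Ks_inv s f) sequentially"
      using uniform_limit_on_subset[OF ul] by blast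
  qed
  then show ?thesis unfolding A_space_def using BU oU by (auto simp: analytic_on_holomorphic)
qed

lemma Ks_inv_bounded:
  obtains M where "\<And>f z. f \<in> A_space \<rho> \<Longrightarrow> z \<in> bernstein_region \<rho> \<Longrightarrow> cmod (Ks_inv s f z) \<le> M * A_norm \<rho> f"
proof -
  obtain D where D: "0 < D" "\<And>f z n N. f \<in> A_space \<rho> \<Longrightarrow> z \<in> bernstein_region \<rho> \<Longrightarrow>
      cmod (\<Sum>j\<in>{n<..N}. Ks_inv_term s f z j) \<le> D * A_norm \<rho> f / sqrt (geg_eigenvalue s (Suc n))"
    using Ks_inv_tail_bound[OF s \<rho>] by blast
  obtain C where C: "0 \<le> C" "\<And>f z j. f \<in> A_space \<rho> \<Longrightarrow> z \<in> bernstein_region \<rho> \<Longrightarrow>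
    cmod (Ks_inv_term s f z j) \<le> C * A_norm \<rho> f * (\<rho> / \<rho>) ^ j"
    using Ks_inv_term_bound[OF s \<rho> \<rho>] by blast
  have "cmod (Ks_inv s f z) \<le> (D / sqrt (geg_eigenvalue s (Suc 0)) + C) * A_norm \<rho> f"
    if f: "f \<in> A_space \<rho>" and z: "z \<in> bernstein_region \<rho>" for f z
  proof -
    have "cmod (Ks_inv s f z - (\<Sum>j\<le>0. Ks_inv_term s f z j)) \<le> D * A_norm \<rho> f / sqrt (geg_eigenvalue s (Suc 0))"
      unfolding Ks_inv_def by (rule suminf_tail_bound[OF summable_Ks_inv_term[OF f z] D(2)[OF f z]])
    moreover have "cmod (Ks_inv_term s f z 0) \<le> C * A_norm \<rho> f" using C(2)[OF f z, of 0] by simp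
    moreover have "cmod (Ks_inv s f z) \<le> cmod (Ks_inv s f z - Ks_inv_term s f z 0) + cmod (Ks_inv_term s f z 0)"
      using norm_triangle_ineq[of "Ks_inv s f z - Ks_inv_term s f z 0" "Ks_inv_term s f z 0"] by simp
    ultimately show ?thesis by (simp add: algebra_simps)
  qed
  then show thesis using that by blast
qed

lemma A_operator_Ks_inv: "A_operator \<rho> (Ks_inv s)"
  unfolding A_operator_def
proof (intro conjI ballI allI)
  show "Ks_inv s f \<in> A_space \<rho>" if "f \<in> A_space \<rho>" for f using that by (rule Ks_inv_in_A_space)
  show "Ks_inv s (\<lambda>u. a * f u + b * g u) z = a * Ks_inv s f z + b * Ks_inv s g z"
    if f: "f \<in> A_space \<rho>" and g: "g \<in> A_space \<rho>" and z: "z \<in> bernstein_region \<rho>" for f g a b z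
  proof -
    have "Ks_inv_term s (\<lambda>u. a * f u + b * g u) z = (\<lambda>j. a * Ks_inv_term s f z j + b * Ks_inv_term s g z j)"
      unfolding Ks_inv_term_def geg_coeff_linear[OF f g] by (simp add: fun_eq_iff algebra_simps)
    then show ?thesis unfolding Ks_inv_def
      using summable_Ks_inv_term[OF f z] summable_Ks_inv_term[OF g z]
      by (simp add: suminf_add[symmetric] suminf_mult summable_mult)
  qed
  obtain M where "\<And>f z. f \<in> A_space \<rho> \<Longrightarrow> z \<in> bernstein_region \<rho> \<Longrightarrow> cmod (Ks_inv s f z) \<le> M * A_norm \<rho> f"
    using Ks_inv_bounded by blast
  then show "\<exists>M. \<forall>f\<in>A_space \<rho>. A_norm \<rho> (Ks_inv s f) \<le> M * A_norm \<rho> f"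
    using \<rho> by (intro exI[of _ M] ballI A_norm_le) auto
qed

lemma A_operator_Ks_inv_num:
  assumes rule: "gauss_jacobi_rule s n x w"
  shows "A_operator \<rho> (Ks_inv_num s n x w)"
  unfolding A_operator_def
proof (intro conjI ballI allI)
  show "Ks_inv_num s n x w f \<in> A_space \<rho>" for f
  proof -
    have "Ks_inv_num s n x w f holomorphic_on UNIV"
      unfolding Ks_inv_num_eq[abs_def] by (intro holomorphic_intros geg_normalized_holomorphic)
    then show ?thesis unfolding A_space_def analytic_on_holomorphic by blast
  qed
  show "Ks_inv_num s n x w (\<lambda>u. a * f u + b * g u) z
      = a * Ks_inv_num s n x w f z + b * Ks_inv_num s n x w g z" for f g a b z
  proof -
    have "geg_coeff_num s n x w (\<lambda>u. a * f u + b * g u) j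
        = a * geg_coeff_num s n x w f j + b * geg_coeff_num s n x w g j" for j
      unfolding geg_coeff_num_def sum_distrib_left sum.distrib[symmetric]
          by (intro sum.cong) (simp_all add: algebra_simps add_divide_distrib)
    then show ?thesis unfolding Ks_inv_num_eq sum_distrib_left sum.distrib[symmetric]
      by (intro sum.cong) (simp_all add: algebra_simps)
  qed
  \<comment> \<open>Boundedness is inherited from the exact inverse and the error.\<close>
  obtain M where M: "\<And>f z. f \<in> A_space \<rho> \<Longrightarrow> z \<in> bernstein_region \<rho> \<Longrightarrow> cmod (Ks_inv s f z) \<le> M * A_norm \<rho> f"
    using Ks_inv_bounded by blast
  obtain C where C: "0 \<le> C" "\<And>n x w f. gauss_jacobi_rule s n x w \<Longrightarrow> f \<in> A_space \<rho> \<Longrightarrow>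
    A_norm \<rho> (Ks_error s n x w f) \<le> C * (real n + 1) powr (- (s/2)) * A_norm \<rho> f"
    using Ks_error_bound_same_region by blast
  show "\<exists>M. \<forall>f\<in>A_space \<rho>. A_norm \<rho> (Ks_inv_num s n x w f) \<le> M * A_norm \<rho> f"
  proof (intro exI ballI A_norm_le)
    fix f z assume f: "f \<in> A_space \<rho>" and z: "z \<in> bernstein_region \<rho>"
    have "Ks_error s n x w f \<in> A_space \<rho>"
    proof -
      have "Ks_inv_num s n x w f holomorphic_on UNIV"
        unfolding Ks_inv_num_eq[abs_def] by (intro holomorphic_intros geg_normalized_holomorphic)
      then have "Ks_inv_num s n x w f analytic_on bernstein_region \<rho>" unfolding analytic_on_holomorphic by blast
      then show ?thesis using Ks_inv_in_A_space[OF f] unfolding A_space_def Ks_error_def[abs_def]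
        by (auto intro: analytic_on_diff)
    qed
    from norm_le_A_norm[OF this z] have "cmod (Ks_error s n x w f z)
        \<le> C * (real n + 1) powr (- (s/2)) * A_norm \<rho> f"
      using C(2)[OF rule f] by linarith
    moreover have "cmod (Ks_inv_num s n x w f z) \<le> cmod (Ks_inv s f z) + cmod (Ks_error s n x w f z)"
      using norm_triangle_ineq4[of "Ks_inv s f z" "Ks_error s n x w f z"] by (simp add: Ks_error_def)
    ultimately show "cmod (Ks_inv_num s n x w f z) \<le> (M + C * (real n + 1) powr (- (s/2))) * A_norm \<rho> f"
      using M[OF f z] by (simp add: algebra_simps)
  qed (use \<rho> in simp)
qed

end

theorem theorem5p3:
  fixes s \<rho> :: real and x w :: "nat \<Rightarrow> nat \<Rightarrow> real"
  assumes s: "0 < s" "s < 1"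
    and rho: "1 < \<rho>"
    and rule: "\<And>n. 1 \<le> n \<Longrightarrow> gauss_jacobi_rule s n (x n) (w n)"
  shows "(\<forall>f\<in>A_space \<rho>. \<forall>z\<in>bernstein_region \<rho>. summable (Ks_inv_term s f z)) \<and>
    (\<forall>\<nu>. 1 < \<nu> \<and> \<nu> < \<rho> \<longrightarrow>
       (\<exists>C::real. \<forall>n\<ge>1. \<forall>f\<in>A_space \<rho>.
          A_norm \<nu> (Ks_error s n (x n) (w n) f)
            \<le> C * real n powr s * (\<nu> / \<rho>) ^ n * A_norm \<rho> f)) \<and>
    A_operator \<rho> (Ks_inv s) \<and>
    (\<forall>n\<ge>1. A_operator \<rho> (Ks_inv_num s n (x n) (w n))) \<and>
    (\<lambda>n. A_opnorm \<rho> (Ks_error s n (x n) (w n))) \<longlonglongrightarrow> 0"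
proof (intro conjI ballI allI impI)
  show "summable (Ks_inv_term s f z)" if "f \<in> A_space \<rho>" "z \<in> bernstein_region \<rho>" for f z
    using that by (rule summable_Ks_inv_term[OF s rho])
  show "\<exists>C::real. \<forall>n\<ge>1. \<forall>f\<in>A_space \<rho>. A_norm \<nu> (Ks_error s n (x n) (w n) f)
      \<le> C * real n powr s * (\<nu> / \<rho>) ^ n * A_norm \<rho> f" if "1 < \<nu> \<and> \<nu> < \<rho>" for \<nu>
    using that Ks_error_bound_smaller_region[OF s rho, of \<nu>] rule by metis
  show "A_operator \<rho> (Ks_inv s)" by (rule A_operator_Ks_inv[OF s rho])
  show "A_operator \<rho> (Ks_inv_num s n (x n) (w n))" if "n \<ge> 1" for n
    using that by (intro A_operator_Ks_inv_num[OF s rho] rule)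
  obtain C where C: "0 \<le> C" "\<And>n x w f. gauss_jacobi_rule s n x w \<Longrightarrow> f \<in> A_space \<rho> \<Longrightarrow>
    A_norm \<rho> (Ks_error s n x w f) \<le> C * (real n + 1) powr (- (s/2)) * A_norm \<rho> f"
    using Ks_error_bound_same_region[OF s rho] by blast
  have le: "A_opnorm \<rho> (Ks_error s n (x n) (w n)) \<le> ennreal (C * (real n + 1) powr (- (s/2)))" if n: "1 \<le> n" for n
    unfolding A_opnorm_def
  proof (intro SUP_least ennreal_leI)
    fix f assume "f \<in> {f \<in> A_space \<rho>. A_norm \<rho> f \<le> 1}"
    then have f: "f \<in> A_space \<rho>" "A_norm \<rho> f \<le> 1" by auto
    have "A_norm \<rho> (Ks_error s n (x n) (w n) f) \<le> C * (real n + 1) powr (- (s/2)) * A_norm \<rho> f"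
      by (rule C(2)[OF rule[OF n] f(1)])
    also have "\<dots> \<le> C * (real n + 1) powr (- (s/2)) * 1" using C(1) f(2) by (intro mult_left_mono) auto
    finally show "A_norm \<rho> (Ks_error s n (x n) (w n) f) \<le> C * (real n + 1) powr (- (s/2))" by simp
  qed
  have "(\<lambda>n. real (Suc n) powr (- (s/2))) \<longlonglongrightarrow> 0"
    using s by (intro tendsto_neg_powr filterlim_compose[OF filterlim_real_sequentially filterlim_Suc]) auto
  then have "(\<lambda>n. (real n + 1) powr (- (s/2))) \<longlonglongrightarrow> 0" by (simp add: add.commute)
  then have "(\<lambda>n. C * (real n + 1) powr (- (s/2))) \<longlonglongrightarrow> C * 0" by (rule tendsto_mult_left)
  then have lim: "(\<lambda>n. ennreal (C * (real n + 1) powr (- (s/2)))) \<longlonglongrightarrow> 0"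
    using tendsto_ennrealI[of _ "C * 0"] by simp
  show "(\<lambda>n. A_opnorm \<rho> (Ks_error s n (x n) (w n))) \<longlonglongrightarrow> 0"
    by (rule tendsto_sandwich[OF _ _ tendsto_const lim])
      (use le in \<open>auto intro!: eventually_sequentiallyI[of 1]\<close>)
qed

end
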